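(* Let $H$ be a Tonelli Hamiltonian on $\mathbb T^d$ with associated Lagrangian $L$. Let $(h_n)$ be mesh sizes and $(\tau_n)$ positive time steps with $\tau_n\to0$, $h_n\to0$ and $h_n/\tau_n\to0$. Let $\mu_*$ be a full-support Mather measure, i.e. a continuous Mather measure with $\operatorname{spt}(\mu_* )=\widetilde{\mathcal M}_L$. Let $(\nu_n)_n$ be a recovery sequence for $\mu_*$ (see context), set $\eta_n:=\mathcal A_{h_n,\tau_n}(\nu_n)-\bar L(h_n,\tau_n)$, and let $\varepsilon_n\to0$ with $\eta_n\le\varepsilon_n$ for all sufficiently large $n$. Then for every fixed $r>0$ there exists $\delta_r>0$ such that $$\widetilde{\mathcal M}_L\subset\liminf_{n\to\infty}\mathcal S_{h_n,\tau_n}^{\varepsilon_n,r,\delta_r}\subset\limsup_{n\to\infty}\mathcal S_{h_n,\tau_n}^{\varepsilon_n,r,\delta_r}\subset\bigl(\widetilde{\mathcal M}_L\bigr)_r,$$ where $\liminf$, $\limsup$ are Kuratowski limits and $(\widetilde{\mathcal M}_L)_r$ is the open $r$-neighborhood of $\widetilde{\mathcal M}_L$.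
   Context: $\mathbb T^d=\mathbb R^d/\mathbb Z^d$. $H\in C^2(\mathbb T^d\times\mathbb R^d)$ is a Tonelli Hamiltonian: $D^2_{pp}H(x,p)>0$ everywhere and $H$ is superlinear in $p$. The Tonelli Lagrangian is $L(x,v)=\sup_{p\in\mathbb R^d}\{p\cdot v-H(x,p)\}$; it is of class $C^2$, strictly convex in $v$, and superlinear: for every $K>0$ there is $C(K)\in\mathbb R$ with $L(x,v)\ge K|v|-C(K)$ for all $(x,v)$. $\alpha(H)$ is the unique constant for which $H(x,Du)=\alpha(H)$ on $\mathbb T^d$ has a viscosity solution. Let $X=\mathbb T^d\times\mathbb R^d$ with a fixed product metric $d_X$ built from the flat distance and the Euclidean distance (e.g. $d_X^2=d_{\mathbb T^d}^2+|\cdot|^2$). For $A\subset X$, $A_r=\{z\in X:\inf_{w\in A}d_X(z,w)<r\}$. A probability measure $\mu$ on $X$ is closed if $\int v\cdot D\phi(x)\,d\mu(x,v)=0$ for all $\phi\in C^1(\mathbb T^d)$. A (continuous) Mather measure is a closed probability measure minimizing $\int L\,d\mu$ among closed probability measures (the minimum is $-\alpha(H)$). The Mather set $\widetilde{\mathcal M}_L$ is the closure of the union of the supports of all Mather measures; it is compact. Mesh sizes are always of the form $h=1/N$ with $N\ge1$ an integer. The grid is $\mathcal G_h=\{x_i=ih \bmod \mathbb Z^d: i\in\{0,\dots,N-1\}^d\}$, with grid points identified with representatives in $[0,1)^d$. Put $v_{ij}^\ell=(x_j+\ell-x_i)/\tau$ for $\ell\in\mathbb Z^d$. $\mathcal H_{h,\tau}$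 is the set of families $\mu=(\mu_{ij}^\ell)_{x_i,x_j\in\mathcal G_h,\ell\in\mathbb Z^d}$ with $\mu_{ij}^\ell\ge0$, $\sum_{i,j,\ell}\mu_{ij}^\ell=1$ and $\sum_{j,\ell}\mu_{ij}^\ell=\sum_{j,\ell}\mu_{ji}^\ell$ for every $x_i$. Reconstruction: $\mathcal R_{h,\tau}\mu=\sum_{i,j,\ell}\mu_{ij}^\ell\delta_{(x_i,v_{ij}^\ell)}\in\mathcal P(X)$. Action: $\mathcal A_{h,\tau}(\mu)=\sum_{i,j,\ell}L(x_i,v_{ij}^\ell)\mu_{ij}^\ell$. $\bar L(h,\tau)=\min_{\mathcal H_{h,\tau}}\mathcal A_{h,\tau}$ (equivalently, the unique constant for which $u(x_j)+\tau\bar L(h,\tau)=\min_{x_i\in\mathcal G_h,\ell\in\mathbb Z^d}\{u(x_i)+\tau L(x_i,v_{ij}^\ell)\}$ has a solution $u:\mathcal G_h\to\mathbb R$). Recovery sequence for a Mather measure $\mu$: $\nu_n\in\mathcal H_{h_n,\tau_n}$ such that $\mathcal R_{h_n,\tau_n}\nu_n\rightharpoonup\mu$ narrowly, $\mathcal A_{h_n,\tau_n}(\nu_n)\to-\alpha(H)$, and $0\le\mathcal A_{h_n,\tau_n}(\nu_n)-\bar L(h_n,\tau_n)\le C(\tau_n+h_n/\tau_n)$ for some constant $C>0$. Such sequences exist. Mass-threshold sets: for $\varepsilon\ge0$, $\mathcal H_{h,\tau}^\varepsilon=\{\mu\in\mathcal H_{h,\tau}:\mathcal A_{h,\tau}(\mu)\le\bar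 L(h,\tau)+\varepsilon\}$ and $\widetilde{\mathcal H}_{h,\tau}^\varepsilon=\{\mathcal R_{h,\tau}\mu:\mu\in\mathcal H_{h,\tau}^\varepsilon\}$. Fix $\kappa:[0,\infty)\to[0,1]$ nonincreasing and Lipschitz with $\kappa=1$ on $[0,1/2]$ and $\kappa=0$ on $[1,\infty)$. For $\nu\in\mathcal P(X)$, $r>0$, $z\in X$ let $m_{\nu,r}(z)=\int_X\kappa(d_X(z,w)/r)\,d\nu(w)$, and $Q_{h,\tau,r}^\varepsilon(z)=\sup_{\widetilde\mu\in\widetilde{\mathcal H}_{h,\tau}^\varepsilon}m_{\widetilde\mu,r}(z)$. For $0<\delta\le1$, $\mathcal S_{h,\tau}^{\varepsilon,r,\delta}=\{z\in X:Q_{h,\tau,r}^\varepsilon(z)\ge\delta\}$. Kuratowski limits: $z\in\limsup_kA_k$ iff there are $k_j\to\infty$ and $z_{k_j}\in A_{k_j}$ with $z_{k_j}\to z$; $z\in\liminf_kA_k$ iff there are $z_k\in A_k$ with $z_k\to z$. *)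

theory Defs
  imports "HOL-Probability.Probability"
begin

section \<open>The flat torus\<close>

definition int_vec :: "int ^ 'n \<Rightarrow> real ^ 'n" where
  "int_vec l = (\<chi> k. of_int (l $ k))"

definition torus_rel :: "real ^ 'n \<Rightarrow> real ^ 'n \<Rightarrow> bool" where
  "torus_rel x y \<longleftrightarrow> (\<exists>l. x = y + int_vec l)"

lemma int_vec_simps:
  "int_vec 0 = 0" "int_vec (a + b) = int_vec a + int_vec b" "int_vec (- a) = - int_vec a"
  by (simp_all add: int_vec_def vec_eq_iff)

quotient_type 'n torus = "real ^ 'n" / "torus_rel :: real ^ ('n::finite) \<Rightarrow> _"
  morphisms rep_torus to_torus
proof (rule equivpI)
  show "reflp (torus_rel :: real ^ 'n \<Rightarrow> _)"
    unfolding reflp_def torus_rel_def by (metis add.right_neutral int_vec_simps(1))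
  show "symp (torus_rel :: real ^ 'n \<Rightarrow> _)"
    unfolding symp_def torus_rel_def
    by (metis add.assoc add.right_inverse add.right_neutral int_vec_simps(3))
  show "transp (torus_rel :: real ^ 'n \<Rightarrow> _)"
    unfolding transp_def torus_rel_def by (metis add.assoc int_vec_simps(2))
qed

lemma to_torus_eq_iff: "to_torus x = to_torus y \<longleftrightarrow> (\<exists>l. x = y + int_vec l)"
  using torus.abs_eq_iff[of x y] by (simp add: torus_rel_def)

lemma to_torus_rep: "to_torus (rep_torus a) = a"
  by (rule Quotient_abs_rep[OF Quotient_torus])

instantiation torus :: (finite) metric_space
begin

definition dist_torus :: "'a torus \<Rightarrow> 'a torus \<Rightarrow> real" where
  "dist_torus a b = setdist {x. to_torus x = a} {y. to_torus y = b}"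

definition uniformity_torus :: "('a torus \<times> 'a torus) filter" where
  "uniformity_torus = (INF e\<in>{0<..}. principal {(x, y). dist x y < e})"

definition open_torus :: "'a torus set \<Rightarrow> bool" where
  "open_torus U \<longleftrightarrow> (\<forall>x\<in>U. eventually (\<lambda>(x', y). x' = x \<longrightarrow> y \<in> U) uniformity)"

instance
proof
  have le: "dist (to_torus x) (to_torus y) \<le> dist x y" for x y :: "real ^ 'a"
    unfolding dist_torus_def by (rule setdist_le_dist) auto
  have approx: "\<exists>x y. to_torus x = a \<and> to_torus y = b \<and> dist x y < dist a b + e"
    if "e > 0" for a b :: "'a torus" and e
  proof (rule ccontr)
    assume "\<not> ?thesis"
    then have "dist a b + e \<le> setdist {x. to_torus x = a} {y. to_torus y = b}"
      by (intro le_setdistI) (use to_torus_rep in \<open>auto simp: not_less\<close>)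
    then show False using that by (simp add: dist_torus_def)
  qed
  fix a b c :: "'a torus"
  show "(dist a b = 0) = (a = b)"
  proof
    assume "a = b"
    then show "dist a b = 0" by (simp add: dist_torus_def setdist_refl)
  next
    assume d: "dist a b = 0"
    obtain x0 y0 where x0: "to_torus x0 = a" and y0: "to_torus y0 = b"
      by (rule that[OF to_torus_rep to_torus_rep])
    have "(x0 - y0) $ k \<in> \<int>" for k
    proof -
      have "(x0 - y0) $ k \<in> closure \<int>"
        unfolding closure_approachable
      proof (intro allI impI)
        fix e :: real assume "e > 0"
        then obtain x y where xy: "to_torus x = a" "to_torus y = b" "dist x y < e"
          using approx[of e a b] d by auto
        obtain l m where l: "x = x0 + int_vec l" and m: "y = y0 + int_vec m"
          using xy(1,2) unfolding x0[symmetric] y0[symmetric] to_torus_eq_iff by blast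
        have "dist (of_int (m $ k - l $ k)) ((x0 - y0) $ k) = \<bar>(x - y) $ k\<bar>"
          by (simp add: l m int_vec_def dist_real_def)
        also have "\<dots> \<le> norm (x - y)" by (rule component_le_norm_cart)
        finally show "\<exists>z\<in>\<int>. dist z ((x0 - y0) $ k) < e"
          using xy(3) unfolding dist_norm[symmetric]
            by (intro bexI[of _ "of_int (m $ k - l $ k)"]) auto
      qed
      then show ?thesis by (simp add: closure_closed)
    qed
    then have "\<exists>j. (x0 - y0) $ k = of_int j" for k by (metis Ints_cases)
    then obtain l where l: "\<And>k. (x0 - y0) $ k = of_int (l k)" by metis
    have "x0 $ k = y0 $ k + of_int (l k)" for k using l[of k] by simp
    then have "x0 = y0 + int_vec (\<chi> k. l k)"
      by (simp add: int_vec_def vec_eq_iff)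
    then show "a = b" unfolding x0[symmetric] y0[symmetric] to_torus_eq_iff by blast
  qed
  show "dist a b \<le> dist a c + dist b c"
  proof (rule field_le_epsilon)
    fix e :: real assume "e > 0"
    then obtain x z y z' where x: "to_torus x = a" "to_torus z = c" "dist x z < dist a c + e/2"
      and y: "to_torus y = b" "to_torus z' = c" "dist y z' < dist b c + e/2"
      using approx[of "e/2"] by (meson half_gt_zero)
    obtain l where l: "z = z' + int_vec l" using x(2) unfolding y(2)[symmetric] to_torus_eq_iff by blast
    have "to_torus (y + int_vec l) = b" unfolding y(1)[symmetric] to_torus_eq_iff by blast
    then have "dist a b \<le> dist x (y + int_vec l)" using le[of x "y + int_vec l"] x(1) by simp
    also have "\<dots> \<le> dist x z + dist (y + int_vec l) z" by (rule dist_triangle2)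
    also have "dist (y + int_vec l) z = dist y z'" by (simp add: l dist_norm)
    finally show "dist a b \<le> dist a c + dist b c + e" using x(3) y(3) by simp
  qed
qed (simp_all add: uniformity_torus_def open_torus_def)

end

lemma dist_to_torus: "dist (to_torus x) (to_torus y) = (INF l. norm (x - y + int_vec l))"
proof -
  have le: "setdist {u. to_torus u = to_torus x} {v. to_torus v = to_torus y}
      \<le> norm (x - y + int_vec l)" for l
    by (rule order_trans[OF setdist_le_dist[of "x + int_vec l" _ y]])
      (use to_torus_eq_iff in \<open>auto simp: dist_norm algebra_simps\<close>)
  have bdd: "bdd_below (range (\<lambda>l. norm (x - y + int_vec l)))"
    by (rule bdd_belowI[of _ 0]) auto
  have "(INF l. norm (x - y + int_vec l)) \<le> dist u v"
    if uv: "to_torus u = to_torus x" "to_torus v = to_torus y" for u v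
  proof -
    obtain l m where "u = x + int_vec l" "v = y + int_vec m"
      using uv unfolding to_torus_eq_iff by blast
    then have "dist u v = norm (x - y + int_vec (l + - m))"
      unfolding int_vec_simps(2,3) dist_norm by (simp add: algebra_simps)
    then show ?thesis using cINF_lower[OF bdd, of "l + - m"] by simp
  qed
  then show ?thesis
    unfolding dist_torus_def by (intro antisym cINF_greatest le le_setdistI) auto
qed

text \<open>The phase space \<open>X\<close> is \<^typ>\<open>'n torus \<times> (real ^ 'n)\<close>; the library's product metric
  is \<open>d\<^sub>X\<^sup>2 = d\<^sub>T\<^sup>2 + |\<cdot>|\<^sup>2\<close>.\<close>

section \<open>Differentiability classes and derivatives\<close>

definition class_C1 :: "('a::real_normed_vector \<Rightarrow> 'b::real_normed_vector) \<Rightarrow> bool" where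
  "class_C1 f \<longleftrightarrow> (\<exists>f'. (\<forall>x. (f has_derivative blinfun_apply (f' x)) (at x)) \<and>
     continuous_on UNIV f')"

definition class_C2 :: "('a::real_normed_vector \<Rightarrow> 'b::real_normed_vector) \<Rightarrow> bool" where
  "class_C2 f \<longleftrightarrow> (\<exists>f'. (\<forall>x. (f has_derivative blinfun_apply (f' x)) (at x)) \<and> class_C1 f')"

definition gradient :: "(real ^ 'n \<Rightarrow> real) \<Rightarrow> real ^ 'n \<Rightarrow> real ^ ('n::finite)" where
  "gradient f x = (\<chi> k. frechet_derivative f (at x) (axis k 1))"

definition hessian :: "(real ^ 'n \<Rightarrow> real) \<Rightarrow> real ^ 'n \<Rightarrow> real ^ 'n ^ ('n::finite)" where
  "hessian f x = jacobian (gradient f) (at x)"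

definition torus_C1 :: "('n::finite torus \<Rightarrow> real) \<Rightarrow> bool" where
  "torus_C1 \<phi> \<longleftrightarrow> class_C1 (\<lambda>x. \<phi> (to_torus x))"

text \<open>The lift of \<open>\<phi>\<close> is periodic, so the choice of representative is immaterial.\<close>

definition torus_gradient :: "('n::finite torus \<Rightarrow> real) \<Rightarrow> 'n torus \<Rightarrow> real ^ 'n" where
  "torus_gradient \<phi> a = gradient (\<lambda>x. \<phi> (to_torus x)) (rep_torus a)"

section \<open>Tonelli Hamiltonians\<close>

definition tonelli_hamiltonian :: "('n::finite torus \<Rightarrow> real ^ 'n \<Rightarrow> real) \<Rightarrow> bool" where
  "tonelli_hamiltonian H \<longleftrightarrow>
     class_C2 (\<lambda>(x, p). H (to_torus x) p) \<and>
     (\<forall>x p w. w \<noteq> 0 \<longrightarrow> 0 < w \<bullet> (hessian (H x) p *v w)) \<and>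
     (\<forall>K>0. \<exists>C. \<forall>x p. H x p \<ge> K * norm p - C)"

definition lagrangian ::
    "('n::finite torus \<Rightarrow> real ^ 'n \<Rightarrow> real) \<Rightarrow> 'n torus \<Rightarrow> real ^ 'n \<Rightarrow> real" where
  "lagrangian H x v = (SUP p. p \<bullet> v - H x p)"

definition viscosity_solution ::
    "('n::finite torus \<Rightarrow> real ^ 'n \<Rightarrow> real) \<Rightarrow> real \<Rightarrow> ('n torus \<Rightarrow> real) \<Rightarrow> bool" where
  "viscosity_solution H c u \<longleftrightarrow> continuous_on UNIV u \<and>
     (\<forall>\<phi> x. torus_C1 \<phi> \<longrightarrow>
        ((\<forall>\<^sub>F y in nhds x. u y - \<phi> y \<le> u x - \<phi> x) \<longrightarrow> H x (torus_gradient \<phi> x) \<le> c) \<and>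
        ((\<forall>\<^sub>F y in nhds x. u y - \<phi> y \<ge> u x - \<phi> x) \<longrightarrow> H x (torus_gradient \<phi> x) \<ge> c))"

definition critical_value :: "('n::finite torus \<Rightarrow> real ^ 'n \<Rightarrow> real) \<Rightarrow> real" where
  "critical_value H = (THE c. \<exists>u. viscosity_solution H c u)"

section \<open>Mather measures\<close>

definition closed_measure :: "('n::finite torus \<times> (real ^ 'n)) measure \<Rightarrow> bool" where
  "closed_measure \<mu> \<longleftrightarrow> prob_space \<mu> \<and> sets \<mu> = sets borel \<and>
     (\<forall>\<phi>. torus_C1 \<phi> \<longrightarrow>
        has_bochner_integral \<mu> (\<lambda>(x, v). v \<bullet> torus_gradient \<phi> x) 0)"

text \<open>\<open>L\<close> is bounded below, so it fails to be integrable against a probability measure only when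
  its integral is \<open>+\<infinity>\<close>. The Bochner integral would return \<open>0\<close> there.\<close>

definition action ::
    "('n::finite torus \<Rightarrow> real ^ 'n \<Rightarrow> real) \<Rightarrow> ('n torus \<times> (real ^ 'n)) measure \<Rightarrow> ereal" where
  "action H \<mu> =
     (if integrable \<mu> (\<lambda>(x, v). lagrangian H x v)
      then ereal (\<integral>(x, v). lagrangian H x v \<partial>\<mu>) else \<infinity>)"

definition mather_measure ::
    "('n::finite torus \<Rightarrow> real ^ 'n \<Rightarrow> real) \<Rightarrow> ('n torus \<times> (real ^ 'n)) measure \<Rightarrow> bool" where
  "mather_measure H \<mu> \<longleftrightarrow> closed_measure \<mu> \<and>
     (\<forall>\<mu>'. closed_measure \<mu>' \<longrightarrow> action H \<mu> \<le> action H \<mu>')"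

definition spt :: "'a::topological_space measure \<Rightarrow> 'a set" where
  "spt \<mu> = {z. \<forall>U. open U \<longrightarrow> z \<in> U \<longrightarrow> 0 < emeasure \<mu> U}"

definition mather_set ::
    "('n::finite torus \<Rightarrow> real ^ 'n \<Rightarrow> real) \<Rightarrow> ('n torus \<times> (real ^ 'n)) set" where
  "mather_set H = closure (\<Union>{spt \<mu> | \<mu>. mather_measure H \<mu>})"

section \<open>Discrete measures\<close>

definition mesh_size :: "real \<Rightarrow> bool" where
  "mesh_size h \<longleftrightarrow> (\<exists>N::nat. 1 \<le> N \<and> h = 1 / real N)"

text \<open>Grid points are represented in \<open>[0,1)\<^sup>d\<close>; for \<open>h = 1/N\<close> the condition \<open>m h < 1\<close> says
  \<open>m \<in> {0,\<dots>,N-1}\<close>.\<close>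

definition grid :: "real \<Rightarrow> (real ^ 'n::finite) set" where
  "grid h = {x. \<forall>k. \<exists>m::nat. x $ k = real m * h \<and> real m * h < 1}"

definition velocity :: "real \<Rightarrow> real ^ 'n \<Rightarrow> real ^ 'n \<Rightarrow> int ^ 'n \<Rightarrow> real ^ 'n::finite" where
  "velocity \<tau> x y l = (1 / \<tau>) *\<^sub>R (y + int_vec l - x)"

text \<open>A family \<open>\<mu>\<^sub>i\<^sub>j\<^sup>l\<close> is a function of \<open>(x\<^sub>i, x\<^sub>j, l)\<close>; its values off the grid are irrelevant.\<close>

type_synonym 'n family = "(real ^ 'n) \<times> (real ^ 'n) \<times> (int ^ 'n) \<Rightarrow> real"

abbreviation grid_steps :: "real \<Rightarrow> ((real ^ 'n) \<times> (real ^ 'n) \<times> (int ^ 'n::finite)) set" where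
  "grid_steps h \<equiv> grid h \<times> grid h \<times> UNIV"

definition discrete_measures :: "real \<Rightarrow> ('n::finite) family set" where
  "discrete_measures h = {\<mu>.
     (\<forall>s\<in>grid_steps h. 0 \<le> \<mu> s) \<and>
     (\<mu> has_sum 1) (grid_steps h) \<and>
     (\<forall>x\<in>grid h. (\<Sum>\<^sub>\<infinity>(y, l)\<in>grid h \<times> UNIV. \<mu> (x, y, l)) =
                  (\<Sum>\<^sub>\<infinity>(y, l)\<in>grid h \<times> UNIV. \<mu> (y, x, l)))}"

text \<open>\<open>\<Sum> \<mu>\<^sub>i\<^sub>j\<^sup>l \<delta>\<close> at \<open>(x\<^sub>i, v\<^sub>i\<^sub>j\<^sup>l)\<close>, written as the image of the weighted counting measure.\<close>

definition reconstruction ::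
    "real \<Rightarrow> real \<Rightarrow> ('n::finite) family \<Rightarrow> ('n torus \<times> (real ^ 'n)) measure" where
  "reconstruction h \<tau> \<mu> =
     distr (density (count_space (grid_steps h)) (\<lambda>s. ennreal (\<mu> s))) borel
       (\<lambda>(x, y, l). (to_torus x, velocity \<tau> x y l))"

text \<open>As for \<open>action\<close>, a failure of summability means that the value is \<open>+\<infinity>\<close>.\<close>

definition discrete_action ::
    "('n::finite torus \<Rightarrow> real ^ 'n \<Rightarrow> real) \<Rightarrow> real \<Rightarrow> real \<Rightarrow> 'n family \<Rightarrow> ereal" where
  "discrete_action H h \<tau> \<mu> =
     (let f = (\<lambda>(x, y, l). lagrangian H (to_torus x) (velocity \<tau> x y l) * \<mu> (x, y, l))
      in if f summable_on grid_steps h then ereal (infsum f (grid_steps h)) else \<infinity>)"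

definition discrete_min ::
    "('n::finite torus \<Rightarrow> real ^ 'n \<Rightarrow> real) \<Rightarrow> real \<Rightarrow> real \<Rightarrow> ereal" where
  "discrete_min H h \<tau> = (INF \<mu>\<in>discrete_measures h. discrete_action H h \<tau> \<mu>)"

definition narrowly_converges ::
    "(nat \<Rightarrow> 'a::topological_space measure) \<Rightarrow> 'a measure \<Rightarrow> bool" where
  "narrowly_converges M \<mu> \<longleftrightarrow>
     (\<forall>f :: 'a \<Rightarrow> real. continuous_on UNIV f \<longrightarrow> bounded (range f) \<longrightarrow>
        (\<lambda>n. \<integral>z. f z \<partial>M n) \<longlonglongrightarrow> (\<integral>z. f z \<partial>\<mu>))"

definition recovery_sequence ::
    "('n::finite torus \<Rightarrow> real ^ 'n \<Rightarrow> real) \<Rightarrow> (nat \<Rightarrow> real) \<Rightarrow> (nat \<Rightarrow> real) \<Rightarrow>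
     ('n torus \<times> (real ^ 'n)) measure \<Rightarrow> (nat \<Rightarrow> 'n family) \<Rightarrow> bool" where
  "recovery_sequence H h \<tau> \<mu> \<nu> \<longleftrightarrow>
     (\<forall>n. \<nu> n \<in> discrete_measures (h n)) \<and>
     narrowly_converges (\<lambda>n. reconstruction (h n) (\<tau> n) (\<nu> n)) \<mu> \<and>
     (\<lambda>n. discrete_action H (h n) (\<tau> n) (\<nu> n)) \<longlonglongrightarrow> ereal (- critical_value H) \<and>
     (\<exists>C>0. \<forall>n.
        0 \<le> discrete_action H (h n) (\<tau> n) (\<nu> n) - discrete_min H (h n) (\<tau> n) \<and>
        discrete_action H (h n) (\<tau> n) (\<nu> n) - discrete_min H (h n) (\<tau> n)
          \<le> ereal (C * (\<tau> n + h n / \<tau> n)))"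

section \<open>Mass-threshold sets\<close>

definition almost_minimizers ::
    "('n::finite torus \<Rightarrow> real ^ 'n \<Rightarrow> real) \<Rightarrow> real \<Rightarrow> real \<Rightarrow> real \<Rightarrow> 'n family set" where
  "almost_minimizers H h \<tau> \<epsilon> =
     {\<mu> \<in> discrete_measures h. discrete_action H h \<tau> \<mu> \<le> discrete_min H h \<tau> + ereal \<epsilon>}"

definition cutoff :: "(real \<Rightarrow> real) \<Rightarrow> bool" where
  "cutoff \<kappa> \<longleftrightarrow> \<kappa> ` {0..} \<subseteq> {0..1} \<and> antimono_on {0..} \<kappa> \<and> (\<exists>C. C-lipschitz_on {0..} \<kappa>) \<and>
     (\<forall>t\<in>{0..1/2}. \<kappa> t = 1) \<and> (\<forall>t\<in>{1..}. \<kappa> t = 0)"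

definition local_mass ::
    "(real \<Rightarrow> real) \<Rightarrow> 'a::metric_space measure \<Rightarrow> real \<Rightarrow> 'a \<Rightarrow> real" where
  "local_mass \<kappa> \<nu> r z = (\<integral>w. \<kappa> (dist z w / r) \<partial>\<nu>)"

definition max_local_mass ::
    "(real \<Rightarrow> real) \<Rightarrow> ('n::finite torus \<Rightarrow> real ^ 'n \<Rightarrow> real) \<Rightarrow> real \<Rightarrow> real \<Rightarrow> real \<Rightarrow> real \<Rightarrow>
     'n torus \<times> (real ^ 'n) \<Rightarrow> real" where
  "max_local_mass \<kappa> H h \<tau> \<epsilon> r z =
     (SUP \<mu>\<in>reconstruction h \<tau> ` almost_minimizers H h \<tau> \<epsilon>. local_mass \<kappa> \<mu> r z)"

definition threshold_set ::
    "(real \<Rightarrow> real) \<Rightarrow> ('n::finite torus \<Rightarrow> real ^ 'n \<Rightarrow> real) \<Rightarrow> real \<Rightarrow> real \<Rightarrow> real \<Rightarrow> real \<Rightarrow>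
     real \<Rightarrow> ('n torus \<times> (real ^ 'n)) set" where
  "threshold_set \<kappa> H h \<tau> \<epsilon> r \<delta> = {z. max_local_mass \<kappa> H h \<tau> \<epsilon> r z \<ge> \<delta>}"

section \<open>Neighbourhoods and Kuratowski limits\<close>

text \<open>\<^const>\<open>infdist\<close> to the empty set is \<open>0\<close> by convention, hence the guard.\<close>

definition nbhd :: "'a::metric_space set \<Rightarrow> real \<Rightarrow> 'a set" where
  "nbhd A r = {z. A \<noteq> {} \<and> infdist z A < r}"

definition kuratowski_limsup :: "(nat \<Rightarrow> 'a::topological_space set) \<Rightarrow> 'a set" where
  "kuratowski_limsup A =
     {z. \<exists>k w. strict_mono (k :: nat \<Rightarrow> nat) \<and> (\<forall>j. w j \<in> A (k j)) \<and> w \<longlonglongrightarrow> z}"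

definition kuratowski_liminf :: "(nat \<Rightarrow> 'a::topological_space set) \<Rightarrow> 'a set" where
  "kuratowski_liminf A = {z. \<exists>w. (\<forall>k. w k \<in> A k) \<and> w \<longlonglongrightarrow> z}"

end

theory Submission
  imports Defs
begin

text \<open>
  The discrete minimum \<open>c\<^sub>n\<close> converges to \<open>-\<alpha>(H)\<close>, by the recovery sequence. Everything rests on two
  facts.

  No closed measure has action below \<open>lim c\<^sub>n\<close>. The least cost of lattice walks, with \<open>c\<^sub>n\<close> subtracted
  from the Lagrangian, is a discrete subsolution \<open>u\<close>. Averaging \<open>u\<close> against a trigonometric kernel that
  is an exact partition of unity on the grid gives \<open>C\<^sup>1\<close> functions \<open>\<phi>\<close> with
  \<open>v \<bullet> D\<phi> \<le> L - c\<^sub>n + o(1)\<close>, and strict inequality by a definite amount for large \<open>|v|\<close>. Integrating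
  against a closed measure yields the bound and shows that minimizing measures live on a bounded set of
  velocities, so the Mather set is compact.

  Limits of families with bounded action exist and are closed. Points of phase space are coded by reals
  in such a way that convergence of codes forces convergence of points; Helly's and Skorohod's theorems on
  the line then give almost surely convergent representations, and Fatou's lemma with superlinearity
  gives closedness and lower semicontinuity of the action.

  Hence a limit of almost minimizers keeping mass near \<open>z\<close> is a Mather measure that charges the ball
  around \<open>z\<close>, and on the compact Mather set the local mass of the full-support measure is bounded below.
  Since the Kuratowski lower limit asks for a point of every set of the sequence, the finitely many
  remaining indices are handled with exact discrete minimizers.
\<close>

section \<open>Functions on the torus and the Lagrangian\<close>

text \<open>The potentials have an oscillation bound uniform in \<open>n\<close>, but they live on
  lattices that refine with \<open>n\<close>. Their average has to commute with lattice
  translations, reproduce constants exactly and have derivative bounds free of \<open>N\<close>.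
  Powers of cosines do this: equally spaced sums are exact on trigonometric polynomials of degree
  below \<open>N\<close>, so the exponent \<open>m\<close> is fixed by the accuracy before
  \<open>N\<close> grows, and the spread of the kernel is measured by squared sines of total mean
  d/(2m+2).

  Velocities are unbounded, so the subsolution inequality is first proved on a ball. Its restriction
  to the unit ball already bounds the gradient, and superlinearity then covers the remaining
  velocities.

  In the limit, the term v . D phi has linear growth and no dominating function. For every e > 0,
  however, e L plus or minus this term is bounded below; Fatou applies, and e tends to 0.

  \<open>critical_value H\<close> enters as the limit of the recovery actions, up to sign. That this
  limit is the least action of closed measures is derived: subsolutions give the lower bound, limits
  of discrete minimizers attain it.\<close>

lemma to_torus_add_int_vec [simp]: "to_torus (x + int_vec l) = to_torus x"
  unfolding to_torus_eq_iff by blast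

lemma dist_to_torus_le: "dist (to_torus x) (to_torus y) \<le> dist x y"
  unfolding dist_torus_def by (rule setdist_le_dist) auto

lemma continuous_on_to_torus [continuous_intros]:
  assumes "continuous_on A f"
  shows "continuous_on A (\<lambda>x. to_torus (f x))"
proof -
  have "continuous_on UNIV (to_torus :: real ^ 'n \<Rightarrow> 'n torus)"
    unfolding continuous_on_iff using dist_to_torus_le le_less_trans by blast
  then show ?thesis using continuous_on_compose2[OF _ assms] by blast
qed

text \<open>A strict bound on an infimum over integer translates is realised by one of them, so
  nearby torus points have nearby lifts.\<close>

lemma torus_lift_near:
  assumes "dist (to_torus x) b < e"
  obtains y where "to_torus y = b" "dist x y < e"
proof -
  obtain y where y: "to_torus y = b" using to_torus_rep by blast
  have "(INF l. norm (x - y + int_vec l)) < e"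
    using assms unfolding y[symmetric] dist_to_torus .
  then obtain l where l: "norm (x - y + int_vec l) < e"
    using cINF_less_iff[of UNIV "\<lambda>l. norm (x - y + int_vec l)" e] bdd_belowI2[of UNIV 0 "\<lambda>l. norm (x - y + int_vec l)"]
    by auto
  have "x - (y + int_vec (- l)) = x - y + int_vec l" by (simp add: int_vec_simps(3))
  then have "dist x (y + int_vec (- l)) < e"
    using l by (simp only: dist_norm)
  then show ?thesis using that[of "y + int_vec (- l)"] y by simp
qed

text \<open>A torus point near \<open>to_torus x\<close> lifts to a point equally near
  \<open>x\<close>; hence a modulus of continuity of the lift also serves on the torus.\<close>

lemma continuous_on_torus_descent:
  fixes f :: "'n::finite torus \<times> 'b::metric_space \<Rightarrow> 'c::metric_space"
  assumes "continuous_on UNIV (\<lambda>(x, v). f (to_torus x, v))"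
  shows "continuous_on UNIV f"
  unfolding continuous_on_iff
proof (intro ballI allI impI)
  fix z :: "'n torus \<times> 'b" and e :: real assume "e > 0"
  obtain a v where z: "z = (a, v)" by (cases z)
  obtain x where x: "to_torus x = a" using to_torus_rep by blast
  obtain d where d: "d > 0" "\<And>y w. dist (y, w) (x, v) < d \<Longrightarrow> dist (f (to_torus y, w)) (f (a, v)) < e"
    using assms \<open>e > 0\<close> unfolding continuous_on_iff x[symmetric] by (fastforce dest: bspec[of _ _ "(x, v)"])
  \<comment> \<open>Halving \<open>d\<close> leaves room for bounding the product distance by the
    sum of the coordinate distances.\<close>
  have "dist (f (b, w)) (f z) < e" if "dist (b, w) z < d / 2" for b w
  proof -
    have db: "dist b a < d / 2" and dw: "dist w v < d / 2"
      using that dist_fst_le[of "(b, w)" z] dist_snd_le[of "(b, w)" z] by (auto simp: z)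
    obtain y where y: "to_torus y = b" "dist x y < d / 2"
      using torus_lift_near[of x b "d/2"] db by (auto simp: x dist_commute)
    have "dist (y, w) (x, v) \<le> dist y x + dist w v"
      unfolding dist_Pair_Pair by (rule sqrt_sum_squares_le_sum) auto
    also have "\<dots> < d" using y(2) dw by (simp add: dist_commute)
    finally show ?thesis using d(2) y(1) z by blast
  qed
  then show "\<exists>d>0. \<forall>x'\<in>UNIV. dist x' z < d \<longrightarrow> dist (f x') (f z) < e"
    using \<open>d > 0\<close> by (intro exI[of _ "d / 2"]) auto
qed

lemma to_torus_unit_cube:
  obtains x where "to_torus x = a" "x \<in> cbox 0 1"
proof -
  obtain y where y: "to_torus y = a" using to_torus_rep by blast
  define x where "x = y + int_vec (\<chi> k. - \<lfloor>y $ k\<rfloor>)"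
  have "x $ k = frac (y $ k)" for k
    by (simp add: x_def int_vec_def frac_def)
  then have "x \<in> cbox 0 1"
    by (simp add: mem_box_cart less_imp_le[OF frac_lt_1])
  then show ?thesis using that[of x] y by (simp add: x_def)
qed

lemma compact_torus [simp]: "compact (UNIV :: 'n::finite torus set)"
proof -
  have "to_torus ` cbox 0 1 = (UNIV :: 'n torus set)"
    using to_torus_unit_cube by (metis UNIV_eq_I image_eqI)
  then show ?thesis
    using compact_continuous_image[OF continuous_on_to_torus[OF continuous_on_id] compact_cbox, of 0 1]
    by metis
qed

lemma borel_measurable_to_torus [measurable]:
  "(\<lambda>(x, v). (to_torus x, v)) \<in> measurable borel (borel :: ('n::finite torus \<times> (real ^ 'n)) measure)"
  unfolding case_prod_unfold
  by (rule borel_measurable_continuous_onI) (intro continuous_intros)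

lemma continuous_on_torus_ball_bounded:
  fixes f :: "'n::finite torus \<times> (real ^ 'n) \<Rightarrow> real"
  assumes "continuous_on UNIV f"
  shows "\<exists>B. \<forall>a v. norm v \<le> R \<longrightarrow> \<bar>f (a, v)\<bar> \<le> B"
proof -
  have "compact (f ` (UNIV \<times> cball 0 R))"
    by (intro compact_continuous_image compact_Times compact_torus compact_cball
        continuous_on_subset[OF assms]) auto
  then obtain B where "\<And>y. y \<in> f ` (UNIV \<times> cball 0 R) \<Longrightarrow> norm y \<le> B"
    by (meson compact_imp_bounded bounded_iff)
  then show ?thesis by (intro exI[of _ B]) auto
qed

lemma onorm_inner_left_le:
  fixes g :: "'a::real_inner"
  assumes "norm g \<le> b"
  shows "onorm (\<lambda>v. v \<bullet> g) \<le> b"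
proof (rule onorm_bound)
  fix v
  have "norm (v \<bullet> g) \<le> norm v * norm g"
    unfolding real_norm_def by (rule Cauchy_Schwarz_ineq2)
  also have "\<dots> \<le> norm v * b" using assms by (intro mult_left_mono) auto
  finally show "norm (v \<bullet> g) \<le> b * norm v" by (simp add: mult.commute)
qed (use order_trans[OF norm_ge_zero assms] in simp)

lemma class_C2_continuous:
  assumes "class_C2 f" shows "continuous_on UNIV f"
  using assms has_derivative_continuous unfolding class_C2_def
  by (metis continuous_at_imp_continuous_on)

context
  fixes H :: "'n::finite torus \<Rightarrow> real ^ 'n \<Rightarrow> real"
  assumes H: "tonelli_hamiltonian H"
begin

lemma tonelli_continuous: "continuous_on UNIV (\<lambda>(a, p). H a p)"
proof (rule continuous_on_torus_descent)
  have "continuous_on UNIV (\<lambda>(x, p). H (to_torus x) p)"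
    using H class_C2_continuous unfolding tonelli_hamiltonian_def by blast
  then show "continuous_on UNIV (\<lambda>(x, v). case (to_torus x, v) of (a, p) \<Rightarrow> H a p)"
    by simp
qed

lemma tonelli_bounded: "\<exists>B. \<forall>a p. norm p \<le> R \<longrightarrow> \<bar>H a p\<bar> \<le> B"
  using continuous_on_torus_ball_bounded[OF tonelli_continuous] by simp

lemma tonelli_superlinear: "\<exists>C. \<forall>a p. H a p \<ge> K * norm p - C"
proof -
  obtain C where C: "H a p \<ge> (\<bar>K\<bar> + 1) * norm p - C" for a p
    using H unfolding tonelli_hamiltonian_def by (metis abs_ge_zero add_nonneg_pos zero_less_one)
  have "K * norm p \<le> (\<bar>K\<bar> + 1) * norm p" for p :: "real ^ 'n"
    by (rule mult_right_mono) auto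
  then have "H a p \<ge> K * norm p - C" for a p
    using C[where a=a and p=p] order_trans by (smt (verit))
  then show ?thesis by blast
qed

text \<open>Slope \<open>R + 1\<close> in superlinearity beats the linear term by
  \<open>norm p\<close>. The supremum defining the Lagrangian is therefore finite, and large momenta
  are irrelevant to it uniformly in \<open>a\<close> and in \<open>norm v \<le> R\<close>.\<close>

lemma legendre_bound: "\<exists>C. \<forall>a v p. norm v \<le> R \<longrightarrow> p \<bullet> v - H a p \<le> C - norm p"
proof -
  obtain C where C: "H a p \<ge> (R + 1) * norm p - C" for a p
    using tonelli_superlinear by blast
  have "p \<bullet> v - H a p \<le> C - norm p" if "norm v \<le> R" for a v p
  proof -
    have "p \<bullet> v \<le> norm p * norm v" by (rule norm_cauchy_schwarz)
    also have "\<dots> \<le> norm p * R" using that by (intro mult_left_mono) auto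
    finally show ?thesis using C[where p=p and a=a] by (simp add: algebra_simps)
  qed
  then show ?thesis by blast
qed

lemma lagrangian_ge: "p \<bullet> v - H a p \<le> lagrangian H a v"
proof -
  obtain C where C: "p \<bullet> v - H a p \<le> C - norm p" for p
    using legendre_bound by blast
  have "p \<bullet> v - H a p \<le> C" for p
    using C[of p] norm_ge_zero[of p] by linarith
  then have "bdd_above (range (\<lambda>p. p \<bullet> v - H a p))"
    by (rule bdd_aboveI2)
  then show ?thesis unfolding lagrangian_def by (rule cSUP_upper[OF UNIV_I])
qed

text \<open>Test the supremum with the momentum of length \<open>\<bar>K\<bar>\<close> along
  \<open>v\<close>; there \<open>H\<close> is bounded by compactness of the torus.\<close>

lemma lagrangian_superlinear: "\<exists>C. \<forall>a v. lagrangian H a v \<ge> K * norm v - C"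
proof -
  obtain B where B: "\<And>a p. norm p \<le> \<bar>K\<bar> \<Longrightarrow> \<bar>H a p\<bar> \<le> B"
    using tonelli_bounded by blast
  have "lagrangian H a v \<ge> K * norm v - B" for a v
  proof -
    have "(K *\<^sub>R sgn v) \<bullet> v = K * norm v"
      by (cases "v = 0") (simp_all add: sgn_div_norm dot_square_norm power2_eq_square)
    moreover have "norm (K *\<^sub>R sgn v) \<le> \<bar>K\<bar>"
      by (simp add: norm_sgn)
    ultimately show ?thesis
      using lagrangian_ge[of "K *\<^sub>R sgn v" v a] B[of "K *\<^sub>R sgn v" a] by linarith
  qed
  then show ?thesis by blast
qed

text \<open>Momenta outside the ball of radius \<open>C + B\<close> give values below
  \<open>- B\<close>, which the zero momentum already reaches. The supremum is thus governed by a
  compact set, on which the integrand is uniformly continuous, and the modulus passes to the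
  supremum.\<close>

lemma lagrangian_continuous: "continuous_on UNIV (\<lambda>(a, v). lagrangian H a v)"
  unfolding continuous_on_iff
proof (intro ballI allI impI)
  fix z :: "'n torus \<times> (real ^ 'n)" and e :: real assume "e > 0"
  define R where "R = norm (snd z) + 1"
  obtain C where C: "\<And>a v p. norm v \<le> R \<Longrightarrow> p \<bullet> v - H a p \<le> C - norm p"
    using legendre_bound by blast
  obtain B where B: "\<And>a p. norm p \<le> 0 \<Longrightarrow> \<bar>H a p\<bar> \<le> B"
    using tonelli_bounded by blast
  define F where "F = (\<lambda>(p, a, v). p \<bullet> v - H a p)"
  have "continuous_on UNIV (\<lambda>q. H (fst (snd q)) (fst q))"
    by (rule continuous_on_compose2[OF tonelli_continuous, of UNIV "\<lambda>q. (fst (snd q), fst q)", simplified])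
      (intro continuous_intros)
  then have "continuous_on UNIV F"
    unfolding F_def case_prod_unfold by (intro continuous_intros)
  then have "uniformly_continuous_on (cball 0 (C + B) \<times> UNIV \<times> cball 0 R) F"
    by (intro compact_uniformly_continuous compact_Times compact_cball compact_torus)
      (rule continuous_on_subset, auto)
  then obtain d where "d > 0" and d: "\<And>q q'. q \<in> cball 0 (C + B) \<times> UNIV \<times> cball 0 R \<Longrightarrow>
      q' \<in> cball 0 (C + B) \<times> UNIV \<times> cball 0 R \<Longrightarrow> dist q' q < d \<Longrightarrow> dist (F q') (F q) < e / 2"
    unfolding uniformly_continuous_on_def using half_gt_zero[OF \<open>e > 0\<close>] by meson
  have main: "lagrangian H b w \<le> lagrangian H a v + e / 2"
    if close: "dist (b, w) (a, v) < d" and nw: "norm w \<le> R" and nv: "norm v \<le> R" for a b v w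
    unfolding lagrangian_def[of H b w]
  proof (rule cSUP_least)
    fix p
    show "p \<bullet> w - H b p \<le> lagrangian H a v + e / 2"
    proof (cases "norm p \<le> C + B")
      case True
      have "dist (p, b, w) (p, a, v) < d"
        using close by (simp add: dist_Pair_Pair)
      then have "dist (F (p, b, w)) (F (p, a, v)) < e / 2"
        by (rule d[rotated 2]) (use True nw nv in auto)
      then have "F (p, b, w) \<le> F (p, a, v) + e / 2"
        unfolding dist_real_def by linarith
      then show ?thesis using lagrangian_ge[of p v a] by (simp add: F_def)
    next
      case False
      have "p \<bullet> w - H b p \<le> - B" using C[OF nw, of p b] False by linarith
      also have "\<dots> \<le> lagrangian H a v" using lagrangian_ge[of 0 v a] B[of 0 a] by simp
      finally show ?thesis using \<open>e > 0\<close> by linarith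
    qed
  qed simp
  show "\<exists>d>0. \<forall>z'\<in>UNIV. dist z' z < d \<longrightarrow>
      dist (case z' of (a, v) \<Rightarrow> lagrangian H a v) (case z of (a, v) \<Rightarrow> lagrangian H a v) < e"
  proof (intro exI[of _ "min d 1"] conjI ballI impI)
    fix z' assume close: "dist z' z < min d 1"
    obtain a v b w where z: "z = (a, v)" "z' = (b, w)" by (cases z, cases z')
    have "dist w v < 1" using close dist_snd_le[of z' z] by (simp add: z)
    then have "norm w \<le> R" "norm v \<le> R"
      using norm_triangle_ineq2[of w v] by (auto simp: R_def z dist_norm)
    then have "lagrangian H b w \<le> lagrangian H a v + e / 2" "lagrangian H a v \<le> lagrangian H b w + e / 2"
      using close by (auto intro!: main simp: z dist_commute)
    then show "dist (case z' of (a, v) \<Rightarrow> lagrangian H a v) (case z of (a, v) \<Rightarrow> lagrangian H a v) < e"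
      using \<open>e > 0\<close> by (auto simp: z dist_real_def)
  qed (use \<open>d > 0\<close> in auto)
qed

lemma lagrangian_bounded: "\<exists>B. \<forall>a v. norm v \<le> R \<longrightarrow> \<bar>lagrangian H a v\<bar> \<le> B"
  using continuous_on_torus_ball_bounded[OF lagrangian_continuous] by simp

lemma lagrangian_measurable: "(\<lambda>(a, v). lagrangian H a v) \<in> borel_measurable borel"
  by (rule borel_measurable_continuous_onI[OF lagrangian_continuous])

end

section \<open>Functions of class C^1 on the torus\<close>

lemma torus_C1I:
  fixes g :: "'n::finite torus \<Rightarrow> real ^ 'n"
  assumes der: "\<And>x. ((\<lambda>x. \<phi> (to_torus x)) has_derivative (\<lambda>v. v \<bullet> g (to_torus x))) (at x)"
    and cont: "continuous_on UNIV (\<lambda>x. g (to_torus x))"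
  shows "torus_C1 \<phi>" "torus_gradient \<phi> = g"
proof -
  have "continuous_on UNIV (\<lambda>x. blinfun_inner_left (g (to_torus x)))"
    by (rule bounded_linear.continuous_on[OF bounded_linear_blinfun_inner_left cont])
  then show "torus_C1 \<phi>"
    unfolding torus_C1_def class_C1_def using der
    by (intro exI[of _ "\<lambda>x. blinfun_inner_left (g (to_torus x))"]) simp
  have "frechet_derivative (\<lambda>x. \<phi> (to_torus x)) (at x) = (\<lambda>v. v \<bullet> g (to_torus x))" for x
    by (rule frechet_derivative_at[OF der, symmetric])
  then show "torus_gradient \<phi> = g"
    by (simp add: torus_gradient_def gradient_def to_torus_rep inner_axis' fun_eq_iff)
qed

text \<open>The lift is invariant under integer translations, and derivatives are unique, so the
  gradient is periodic. The representative chosen inside \<open>torus_gradient\<close> can then be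
  replaced by any other.\<close>

lemma
  fixes \<phi> :: "'n::finite torus \<Rightarrow> real"
  assumes "torus_C1 \<phi>"
  shows torus_C1_has_derivative:
      "((\<lambda>x. \<phi> (to_torus x)) has_derivative (\<lambda>v. v \<bullet> torus_gradient \<phi> (to_torus x))) (at x)"
    and torus_gradient_lift_continuous: "continuous_on UNIV (\<lambda>x. torus_gradient \<phi> (to_torus x))"
proof -
  define f where "f = (\<lambda>x. \<phi> (to_torus x))"
  obtain f' where f': "\<And>x. (f has_derivative blinfun_apply (f' x)) (at x)" "continuous_on UNIV f'"
    using assms unfolding torus_C1_def class_C1_def f_def by blast
  have grad: "gradient f x = (\<chi> k. f' x (axis k 1))" for x
    unfolding gradient_def by (simp add: frechet_derivative_at[OF f'(1), symmetric])
  have inner: "blinfun_apply (f' x) v = v \<bullet> gradient f x" for x v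
  proof -
    have "blinfun_apply (f' x) v = blinfun_apply (f' x) (\<Sum>k\<in>UNIV. v $ k *\<^sub>R axis k 1)"
      by (rule arg_cong[where f="blinfun_apply (f' x)"])
        (use basis_expansion[of v] in \<open>simp add: scalar_mult_eq_scaleR\<close>)
    also have "\<dots> = (\<Sum>k\<in>UNIV. v $ k * blinfun_apply (f' x) (axis k 1))"
      by (simp add: blinfun.sum_right blinfun.scaleR_right)
    also have "\<dots> = v \<bullet> gradient f x" by (simp add: grad inner_vec_def)
    finally show ?thesis .
  qed
  have periodic: "gradient f (x + int_vec l) = gradient f x" for x l
  proof -
    have "((f \<circ> (\<lambda>x. x + int_vec l)) has_derivative (blinfun_apply (f' (x + int_vec l)) \<circ> (\<lambda>v. v))) (at x)"
      by (rule diff_chain_at) (auto intro!: derivative_eq_intros f'(1))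
    moreover have "f \<circ> (\<lambda>x. x + int_vec l) = f" by (simp add: f_def fun_eq_iff)
    ultimately have "blinfun_apply (f' (x + int_vec l)) = blinfun_apply (f' x)"
      using has_derivative_unique[OF _ f'(1)] by (simp add: comp_def)
    then show ?thesis by (simp add: grad)
  qed
  have tg: "torus_gradient \<phi> (to_torus x) = gradient f x" for x
  proof -
    obtain l where "rep_torus (to_torus x) = x + int_vec l"
      using to_torus_rep to_torus_eq_iff by blast
    then show ?thesis by (simp add: torus_gradient_def periodic f_def[symmetric])
  qed
  show "((\<lambda>x. \<phi> (to_torus x)) has_derivative (\<lambda>v. v \<bullet> torus_gradient \<phi> (to_torus x))) (at x)"
    using f'(1)[of x] unfolding tg inner f_def by (simp add: inner[abs_def, unfolded f_def])
  have "continuous_on UNIV (gradient f)"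
    unfolding grad[abs_def] by (intro continuous_intros f'(2))
  then show "continuous_on UNIV (\<lambda>x. torus_gradient \<phi> (to_torus x))"
    by (simp add: tg)
qed

context
  fixes \<phi> :: "'n::finite torus \<Rightarrow> real"
  assumes C1: "torus_C1 \<phi>"
begin

lemma torus_gradient_continuous: "continuous_on UNIV (torus_gradient \<phi>)"
proof -
  \<comment> \<open>The real coordinate is a dummy: \<open>continuous_on_torus_descent\<close>
    speaks of products.\<close>
  have "continuous_on UNIV (\<lambda>(a, u::real). torus_gradient \<phi> a)"
    by (rule continuous_on_torus_descent)
      (use continuous_on_compose2[OF torus_gradient_lift_continuous[OF C1]
          continuous_on_fst[OF continuous_on_id]] in \<open>simp add: case_prod_unfold\<close>)
  from continuous_on_compose2[OF this, of UNIV "\<lambda>a. (a, 0)"] show ?thesis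
    by (simp add: continuous_intros)
qed

lemma torus_gradient_bounded: "\<exists>G\<ge>0. \<forall>a. norm (torus_gradient \<phi> a) \<le> G"
proof -
  have "compact (range (torus_gradient \<phi>))"
    by (intro compact_continuous_image torus_gradient_continuous compact_torus)
  then obtain G where "\<And>a. norm (torus_gradient \<phi> a) \<le> G"
    by (meson compact_imp_bounded bounded_iff rangeI)
  then show ?thesis using order_trans[OF norm_ge_zero] by blast
qed

text \<open>Mean value inequality for the function minus its linearisation at \<open>x\<close>. The
  radius does not depend on \<open>x\<close> because the gradient is uniformly continuous on the
  compact torus.\<close>

lemma torus_C1_uniformly_differentiable:
  assumes "e > 0"
  shows "\<exists>d>0. \<forall>x y. norm y \<le> d \<longrightarrow>
    \<bar>\<phi> (to_torus (x + y)) - \<phi> (to_torus x) - y \<bullet> torus_gradient \<phi> (to_torus x)\<bar> \<le> e * norm y"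
proof -
  have "uniformly_continuous_on UNIV (torus_gradient \<phi>)"
    by (rule compact_uniformly_continuous[OF torus_gradient_continuous compact_torus])
  then obtain d where "d > 0" and d: "\<And>a b. dist a b < d \<Longrightarrow>
      dist (torus_gradient \<phi> a) (torus_gradient \<phi> b) < e"
    unfolding uniformly_continuous_on_def using assms by (metis UNIV_I)
  have "\<bar>\<phi> (to_torus (x + y)) - \<phi> (to_torus x) - y \<bullet> torus_gradient \<phi> (to_torus x)\<bar> \<le> e * norm y"
    if "norm y \<le> d / 2" for x y
  proof -
    define F where "F z = \<phi> (to_torus z) - z \<bullet> torus_gradient \<phi> (to_torus x)" for z
    have "norm (F (x + y) - F x) \<le> e * norm (x + y - x)"
    proof (rule differentiable_bound)
      show "convex (cball x (d / 2))" by simp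
      fix z assume "z \<in> cball x (d / 2)"
      then have "dist z x < d" using \<open>d > 0\<close> by (auto simp: dist_commute)
      then have "dist (to_torus z) (to_torus x) < d"
        using dist_to_torus_le le_less_trans by blast
      then have near: "norm (torus_gradient \<phi> (to_torus z) - torus_gradient \<phi> (to_torus x)) \<le> e"
        using d by (metis dist_norm less_imp_le)
      show "(F has_derivative (\<lambda>v. v \<bullet> (torus_gradient \<phi> (to_torus z) - torus_gradient \<phi> (to_torus x))))
          (at z within cball x (d / 2))"
        unfolding F_def inner_diff_right
        by (intro derivative_intros has_derivative_at_withinI[OF torus_C1_has_derivative[OF C1]])
      show "onorm (\<lambda>v. v \<bullet> (torus_gradient \<phi> (to_torus z) - torus_gradient \<phi> (to_torus x))) \<le> e"
        by (rule onorm_inner_left_le[OF near])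
    qed (use that \<open>d > 0\<close> in \<open>auto simp: dist_norm\<close>)
    then show ?thesis by (simp add: F_def inner_add_left algebra_simps)
  qed
  then show ?thesis using \<open>d > 0\<close> by (intro exI[of _ "d / 2"]) auto
qed

lemma torus_C1_lipschitz:
  assumes G: "\<And>a. norm (torus_gradient \<phi> a) \<le> G"
  shows "\<bar>\<phi> (to_torus (x + y)) - \<phi> (to_torus x)\<bar> \<le> G * norm y"
proof -
  have "norm (\<phi> (to_torus (x + y)) - \<phi> (to_torus x)) \<le> G * norm (x + y - x)"
  proof (rule differentiable_bound[OF convex_UNIV])
    fix z
    show "((\<lambda>x. \<phi> (to_torus x)) has_derivative (\<lambda>v. v \<bullet> torus_gradient \<phi> (to_torus z))) (at z)"
      by (rule torus_C1_has_derivative[OF C1])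
    show "onorm (\<lambda>v. v \<bullet> torus_gradient \<phi> (to_torus z)) \<le> G"
      by (rule onorm_inner_left_le[OF G])
  qed auto
  then show ?thesis by simp
qed

end

section \<open>A trigonometric averaging kernel on the lattice\<close>

text \<open>The mean of cos(pi t)^(2m) over a period, that is, its constant Fourier
  coefficient.\<close>

definition cos_mean :: "nat \<Rightarrow> real" where
  "cos_mean m = real (2 * m choose m) / 4 ^ m"

lemma cos_mean_pos: "cos_mean m > 0"
  by (simp add: cos_mean_def)

text \<open>Wallis' recursion. The difference is the mean of sin^2 cos^(2m), hence an unnormalised
  second moment of the kernel.\<close>

lemma cos_mean_Suc: "cos_mean m - cos_mean (Suc m) = cos_mean m / (2 * real m + 2)"
proof -
  have eq: "cos_mean m = fact (2 * m) / (fact m * fact m * 4 ^ m)" for m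
    using binomial_fact[of m "2 * m", where 'a = real] by (simp add: cos_mean_def mult_2)
  have "fact (2 * Suc m) = (2 * real m + 2) * (2 * real m + 1) * fact (2 * m)"
    by (simp add: algebra_simps)
  then have "cos_mean (Suc m) = (2 * real m + 2) * (2 * real m + 1) * fact (2 * m) /
      (((real m + 1) * fact m) * ((real m + 1) * fact m) * (4 * 4 ^ m))"
    unfolding eq by (simp add: algebra_simps)
  also have "\<dots> = cos_mean m * ((2 * real m + 2) * (2 * real m + 1) / ((real m + 1) * (real m + 1) * 4))"
    unfolding eq by (simp add: field_simps)
  also have "(2 * real m + 2) * (2 * real m + 1) / ((real m + 1) * (real m + 1) * 4) = 1 - 1 / (2 * real m + 2)"
    by (simp add: divide_simps) (simp add: algebra_simps)
  finally show ?thesis by (simp add: right_diff_distrib)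
qed

text \<open>A geometric sum of roots of unity. The frequency \<open>k - m\<close> is nonzero and at
  most \<open>m < N\<close> in modulus, so it is no multiple of \<open>N\<close> and the ratio
  \<open>z\<close> is not 1.\<close>

lemma sum_cis_shift:
  assumes "k \<noteq> m" "k \<le> 2 * m" "m < N"
  shows "(\<Sum>i<N. cis ((2 * real k - 2 * real m) * (pi * (t - real i / real N)))) = 0"
proof -
  define z where "z = cis (- 2 * pi * (real k - real m) / real N)"
  have zN: "z ^ N = 1"
  proof -
    have "real N * (- 2 * pi * (real k - real m) / real N) = 2 * pi * of_int (int m - int k)"
      using assms by (simp add: field_simps)
    then have "z ^ N = cis (2 * pi * of_int (int m - int k))"
      by (simp only: z_def Complex.DeMoivre)
    then show ?thesis by (metis cis_multiple_2pi Ints_of_int)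
  qed
  have "z \<noteq> 1"
  proof
    assume "z = 1"
    then have "cos (- 2 * pi * (real k - real m) / real N) = 1"
      by (simp add: z_def complex_eq_iff)
    then obtain j :: int where "- 2 * pi * (real k - real m) / real N = real_of_int j * 2 * pi"
      unfolding cos_one_2pi_int by blast
    then have "pi * (real m - real k) = pi * (real_of_int j * real N)"
      using assms by (simp add: field_simps)
    then have "real m - real k = real_of_int j * real N" by simp
    then have "real_of_int (int m - int k) = real_of_int (j * int N)" by simp
    then have eq: "int m - int k = j * int N" by (simp only: of_int_eq_iff)
    have "\<bar>int m - int k\<bar> < int N" using assms by linarith
    then have "\<bar>j\<bar> * int N < 1 * int N" by (simp add: eq abs_mult)
    then have "\<bar>j\<bar> < 1" by (rule mult_right_less_imp_less) simp
    then show False using eq assms by simp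
  qed
  have "cis ((2 * real k - 2 * real m) * (pi * (t - real i / real N))) =
      cis ((2 * real k - 2 * real m) * (pi * t)) * z ^ i" for i
    unfolding z_def Complex.DeMoivre cis_mult by (simp add: algebra_simps diff_divide_distrib)
  then have "(\<Sum>i<N. cis ((2 * real k - 2 * real m) * (pi * (t - real i / real N)))) =
      cis ((2 * real k - 2 * real m) * (pi * t)) * (\<Sum>i<N. z ^ i)"
    by (simp add: sum_distrib_left)
  also have "(\<Sum>i<N. z ^ i) = 0"
    using \<open>z \<noteq> 1\<close> zN by (simp add: sum_gp_strict)
  finally show ?thesis by simp
qed

text \<open>The trigonometric polynomial has degree \<open>m < N\<close>, so only its constant
  Fourier mode survives summation over \<open>N\<close> equally spaced points, whatever the offset
  \<open>t\<close>.\<close>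

lemma sum_cos_power:
  assumes "m < N"
  shows "(\<Sum>i<N. cos (pi * (t - real i / real N)) ^ (2 * m)) = real N * cos_mean m"
proof -
  define \<theta> where "\<theta> i = pi * (t - real i / real N)" for i
  have expand: "complex_of_real (cos \<theta> ^ (2 * m)) =
      (\<Sum>k\<le>2 * m. of_nat (2 * m choose k) / 4 ^ m * cis ((2 * real k - 2 * real m) * \<theta>))" for \<theta>
  proof -
    have "complex_of_real (cos \<theta>) = (cis \<theta> + cis (- \<theta>)) / 2"
      by (simp add: complex_eq_iff)
    then have "complex_of_real (cos \<theta> ^ (2 * m)) = (cis \<theta> + cis (- \<theta>)) ^ (2 * m) / 2 ^ (2 * m)"
      by (simp only: of_real_power power_divide)
    also have "(2 :: complex) ^ (2 * m) = 4 ^ m" by (simp add: power_mult)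
    also have "(cis \<theta> + cis (- \<theta>)) ^ (2 * m) / 4 ^ m =
        (\<Sum>k\<le>2 * m. of_nat (2 * m choose k) * cis \<theta> ^ k * cis (- \<theta>) ^ (2 * m - k)) / 4 ^ m"
      by (simp only: binomial_ring)
    also have "\<dots> = (\<Sum>k\<le>2 * m. of_nat (2 * m choose k) * cis ((2 * real k - 2 * real m) * \<theta>)) / 4 ^ m"
      by (intro arg_cong2[where f="(/)"] sum.cong refl) (simp add: Complex.DeMoivre cis_mult mult.assoc of_nat_diff algebra_simps)
    finally show ?thesis by (simp add: sum_divide_distrib)
  qed
  have "complex_of_real (\<Sum>i<N. cos (\<theta> i) ^ (2 * m)) =
      (\<Sum>i<N. \<Sum>k\<le>2 * m. of_nat (2 * m choose k) / 4 ^ m * cis ((2 * real k - 2 * real m) * \<theta> i))"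
    unfolding of_real_sum expand ..
  also have "\<dots> = (\<Sum>k\<le>2 * m. of_nat (2 * m choose k) / 4 ^ m *
      (\<Sum>i<N. cis ((2 * real k - 2 * real m) * \<theta> i)))"
    by (subst sum.swap) (simp add: sum_distrib_left)
  also have "\<dots> = (\<Sum>k\<in>{m}. of_nat (2 * m choose k) / 4 ^ m *
      (\<Sum>i<N. cis ((2 * real k - 2 * real m) * \<theta> i)))"
    by (rule sum.mono_neutral_right) (use sum_cis_shift[OF _ _ assms] in \<open>auto simp: \<theta>_def\<close>)
  also have "\<dots> = complex_of_real (real N * cos_mean m)"
    by (simp add: cos_mean_def)
  finally show ?thesis unfolding \<theta>_def of_real_eq_iff .
qed

definition cos_kernel :: "nat \<Rightarrow> real ^ 'n::finite \<Rightarrow> real" where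
  "cos_kernel m x = (\<Prod>k\<in>UNIV. cos (pi * x $ k) ^ (2 * m))"

definition lattice_box :: "nat \<Rightarrow> (int ^ 'n::finite) set" where
  "lattice_box N = {z. \<forall>k. 0 \<le> z $ k \<and> z $ k < int N}"

text \<open>A discrete convolution with a periodic kernel. The denominator is the total weight of
  the kernel, exactly and at every real \<open>x\<close>, once \<open>m < N\<close>.\<close>

definition lattice_avg :: "nat \<Rightarrow> nat \<Rightarrow> (int ^ 'n \<Rightarrow> real) \<Rightarrow> real ^ 'n::finite \<Rightarrow> real" where
  "lattice_avg N m F x =
     (\<Sum>z\<in>lattice_box N. F z * cos_kernel m (x - int_vec z /\<^sub>R real N)) / (real N * cos_mean m) ^ CARD('n)"

lemma lattice_box_image:
  "bij_betw vec_lambda (PiE (UNIV :: 'n::finite set) (\<lambda>_. {0..<int N})) (lattice_box N)"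
proof (rule bij_betw_byWitness[where f' = vec_nth])
qed (auto simp: lattice_box_def)

lemma finite_lattice_box [simp]: "finite (lattice_box N)"
  using bij_betw_finite[OF lattice_box_image] by (simp add: finite_PiE)

lemma card_lattice_box: "card (lattice_box N :: (int ^ 'n::finite) set) = N ^ CARD('n)"
proof -
  have "card (PiE (UNIV :: 'n set) (\<lambda>_. {0..<int N})) = card (lattice_box N :: (int ^ 'n) set)"
    by (rule bij_betw_same_card[OF lattice_box_image])
  then show ?thesis by (simp add: card_PiE)
qed

lemma sum_lattice_box_prod:
  "(\<Sum>z\<in>lattice_box N. \<Prod>k\<in>UNIV. f k (z $ k)) = (\<Prod>k\<in>(UNIV :: 'n::finite set). \<Sum>i<N. (f k (int i) :: real))"
proof -
  have "(\<Sum>z\<in>lattice_box N. \<Prod>k\<in>UNIV. f k (z $ k)) =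
      (\<Sum>g\<in>PiE (UNIV :: 'n set) (\<lambda>_. {0..<int N}). \<Prod>k\<in>UNIV. f k (vec_lambda g $ k))"
    by (rule sum.reindex_bij_betw[OF lattice_box_image, symmetric])
  also have "\<dots> = (\<Prod>k\<in>(UNIV :: 'n set). \<Sum>i\<in>{0..<int N}. f k i)"
    by (subst prod_sum_PiE) auto
  also have "\<dots> = (\<Prod>k\<in>(UNIV :: 'n set). \<Sum>i<N. f k (int i))"
  proof (rule prod.cong[OF refl])
    fix k
    have "bij_betw int {..<N} {0..<int N}"
      by (rule bij_betw_byWitness[where f' = nat]) auto
    then show "(\<Sum>i\<in>{0..<int N}. f k i) = (\<Sum>i<N. f k (int i))"
      by (rule sum.reindex_bij_betw[symmetric])
  qed
  finally show ?thesis .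
qed

lemma sum_lattice_box_shift:
  fixes G :: "int ^ 'n::finite \<Rightarrow> real"
  assumes "N > 0" and per: "\<And>z l. G (z + int N *s l) = G z"
  shows "(\<Sum>z\<in>lattice_box N. G (z + w)) = (\<Sum>z\<in>lattice_box N. G z)"
proof -
  define \<rho> where "\<rho> w z = (\<chi> k. (z $ k + w $ k) mod int N)" for w z :: "int ^ 'n"
  have "bij_betw (\<rho> w) (lattice_box N) (lattice_box N)"
  proof (rule bij_betw_byWitness[where f' = "\<rho> (- w)"])
  qed (use \<open>N > 0\<close> in \<open>auto simp: \<rho>_def lattice_box_def vec_eq_iff mod_simps\<close>)
  then have "(\<Sum>z\<in>lattice_box N. G (\<rho> w z)) = (\<Sum>z\<in>lattice_box N. G z)"
    by (rule sum.reindex_bij_betw)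
  moreover have "G (\<rho> w z) = G (z + w)" for z
  proof -
    have "z + w = \<rho> w z + int N *s (\<chi> k. (z $ k + w $ k) div int N)"
      by (simp add: \<rho>_def vec_eq_iff)
    then show ?thesis using per by metis
  qed
  ultimately show ?thesis by simp
qed

lemma cos_kernel_nonneg: "cos_kernel m x \<ge> 0"
  by (simp add: cos_kernel_def prod_nonneg)

lemma cos_kernel_periodic: "cos_kernel m (x + int_vec l) = cos_kernel m x"
proof -
  have "cos (pi * (t + of_int j)) ^ (2 * m) = cos (pi * t) ^ (2 * m)" for t and j :: int
  proof -
    have "(cos (pi * (t + of_int j)))\<^sup>2 = (cos (pi * t))\<^sup>2"
      by (simp add: distrib_left cos_add power_mult_distrib)
    then show ?thesis by (simp add: power_mult)
  qed
  then show ?thesis by (simp add: cos_kernel_def int_vec_def)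
qed

lemma cos_kernel_torus [simp]: "cos_kernel m (rep_torus (to_torus x) - y) = cos_kernel m (x - y)"
proof -
  obtain l where "rep_torus (to_torus x) = x + int_vec l"
    using to_torus_rep to_torus_eq_iff by blast
  then show ?thesis using cos_kernel_periodic[of m "x - y" l] by (simp add: algebra_simps)
qed

lemma cos_kernel_rep [simp]: "cos_kernel m (rep_torus (to_torus x)) = cos_kernel m x"
  using cos_kernel_torus[of m x 0] by simp

lemma lattice_avg_mono:
  assumes "\<And>z. F z \<le> G z"
  shows "lattice_avg N m F x \<le> lattice_avg N m G x"
  unfolding lattice_avg_def using cos_mean_pos[of m]
  by (intro divide_right_mono sum_mono mult_right_mono assms cos_kernel_nonneg) simp

lemma lattice_avg_add: "lattice_avg N m (\<lambda>z. F z + G z) x = lattice_avg N m F x + lattice_avg N m G x"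
  by (simp add: lattice_avg_def distrib_right sum.distrib add_divide_distrib)

lemma lattice_avg_cmult: "lattice_avg N m (\<lambda>z. c * F z) x = c * lattice_avg N m F x"
  by (simp add: lattice_avg_def sum_distrib_left mult.assoc)

lemma lattice_avg_const:
  fixes x :: "real ^ 'n::finite"
  assumes "m < N" shows "lattice_avg N m (\<lambda>z. c) x = c"
proof -
  have "(\<Sum>z\<in>lattice_box N. cos_kernel m (x - int_vec z /\<^sub>R real N)) =
      (\<Sum>z\<in>lattice_box N. \<Prod>k\<in>UNIV. cos (pi * (x $ k - real_of_int (z $ k) / real N)) ^ (2 * m))"
    by (simp add: cos_kernel_def int_vec_def divide_inverse mult.commute)
  also have "\<dots> = (real N * cos_mean m) ^ CARD('n)"
    by (subst sum_lattice_box_prod) (simp add: sum_cos_power[OF assms])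
  finally show ?thesis
    using assms cos_mean_pos[of m] by (simp add: lattice_avg_def sum_distrib_left[symmetric])
qed

text \<open>By sin^2 = 1 - cos^2 each coordinate contributes a difference of consecutive cosine
  means. The kernel is thus concentrated at scale 1/sqrt(m), with a bound independent of
  \<open>N\<close> and \<open>x\<close>.\<close>

lemma lattice_avg_sin:
  fixes x :: "real ^ 'n::finite"
  assumes "Suc m < N"
  shows "lattice_avg N m (\<lambda>z. \<Sum>k\<in>UNIV. (sin (pi * (x $ k - real_of_int (z $ k) / real N)))\<^sup>2) x
     = real CARD('n) / (2 * real m + 2)"
proof -
  define w where "w = (\<lambda>k i. cos (pi * (x $ k - real_of_int i / real N)) ^ (2 * m))"
  define s where "s = (\<lambda>k i. (sin (pi * (x $ k - real_of_int i / real N)))\<^sup>2)"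
  have ker: "cos_kernel m (x - int_vec z /\<^sub>R real N) = (\<Prod>k\<in>UNIV. w k (z $ k))" for z
    by (simp add: w_def cos_kernel_def int_vec_def divide_inverse mult.commute)
  have cs: "(1 - c\<^sup>2) * c ^ (2 * m) = c ^ (2 * m) - c ^ (2 * Suc m)" for c :: real
    by (simp add: algebra_simps power2_eq_square)
  have sw: "(\<Sum>i<N. s k (int i) * w k (int i)) = real N * cos_mean m / (2 * real m + 2)" for k
  proof -
    have "(\<Sum>i<N. s k (int i) * w k (int i)) = (\<Sum>i<N. cos (pi * (x $ k - real i / real N)) ^ (2 * m)
        - cos (pi * (x $ k - real i / real N)) ^ (2 * Suc m))"
      by (simp only: s_def w_def sin_squared_eq of_int_of_nat_eq cs)
    also have "\<dots> = real N * (cos_mean m - cos_mean (Suc m))"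
      unfolding sum_subtractf sum_cos_power[OF assms] sum_cos_power[OF Suc_lessD[OF assms]]
      by (simp only: right_diff_distrib)
    finally show ?thesis by (simp add: cos_mean_Suc)
  qed
  have one: "(\<Sum>z\<in>lattice_box N. s j (z $ j) * cos_kernel m (x - int_vec z /\<^sub>R real N)) =
      (real N * cos_mean m) ^ CARD('n) / (2 * real m + 2)" for j
  proof -
    \<comment> \<open>Written with a conditional factor, the weight on the single coordinate
      \<open>j\<close> is a product over all coordinates, so the sum over the box
      factorises.\<close>
    have "s j (z $ j) * cos_kernel m (x - int_vec z /\<^sub>R real N) =
        (\<Prod>k\<in>UNIV. (if k = j then s j (z $ k) else 1) * w k (z $ k))" for z
      by (simp add: ker prod.distrib)
    then have "(\<Sum>z\<in>lattice_box N. s j (z $ j) * cos_kernel m (x - int_vec z /\<^sub>R real N)) =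
        (\<Prod>k\<in>UNIV. \<Sum>i<N. (if k = j then s j (int i) else 1) * w k (int i))"
      by (simp add: sum_lattice_box_prod[where f="\<lambda>k i. (if k = j then s j i else 1) * w k i"])
    also have "\<dots> = (\<Prod>k\<in>UNIV. (if k = j then inverse (2 * real m + 2) else 1) * (real N * cos_mean m))"
      using sw sum_cos_power[of m N] assms
      by (intro prod.cong refl) (auto simp: w_def divide_inverse)
    also have "\<dots> = (real N * cos_mean m) ^ CARD('n) / (2 * real m + 2)"
      by (simp add: prod.distrib divide_inverse mult.commute)
    finally show ?thesis .
  qed
  have "(\<Sum>z\<in>lattice_box N. (\<Sum>k\<in>UNIV. s k (z $ k)) * cos_kernel m (x - int_vec z /\<^sub>R real N)) =
      (\<Sum>j\<in>(UNIV :: 'n set). (real N * cos_mean m) ^ CARD('n) / (2 * real m + 2))"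
    unfolding sum_distrib_right by (subst sum.swap) (simp add: one)
  moreover have "(real N * cos_mean m) ^ CARD('n) \<noteq> 0" using assms cos_mean_pos[of m] by simp
  ultimately show ?thesis by (simp add: lattice_avg_def s_def)
qed

text \<open>This turns an inequality between \<open>F (z + w)\<close> and \<open>F z\<close> on
  lattice points into one between the averages at \<open>x + w/N\<close> and at \<open>x\<close>,
  for every real \<open>x\<close>.\<close>

lemma lattice_avg_shift:
  fixes F :: "int ^ 'n::finite \<Rightarrow> real"
  assumes "N > 0" and per: "\<And>z l. F (z + int N *s l) = F z"
  shows "lattice_avg N m F (x + int_vec w /\<^sub>R real N) = lattice_avg N m (\<lambda>z. F (z + w)) x"
proof -
  define G where "G z = F z * cos_kernel m (x + int_vec w /\<^sub>R real N - int_vec z /\<^sub>R real N)" for z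
  have "G (z + int N *s l) = G z" for z l
  proof -
    have "int_vec (z + int N *s l) /\<^sub>R real N = int_vec z /\<^sub>R real N + int_vec l"
      using \<open>N > 0\<close> by (simp add: vec_eq_iff int_vec_def field_simps)
    then have "x + int_vec w /\<^sub>R real N - int_vec (z + int N *s l) /\<^sub>R real N =
        x + int_vec w /\<^sub>R real N - int_vec z /\<^sub>R real N + int_vec (- l)"
      by (simp add: int_vec_simps)
    then show ?thesis unfolding G_def per by (simp only: cos_kernel_periodic)
  qed
  then have "(\<Sum>z\<in>lattice_box N. G z) = (\<Sum>z\<in>lattice_box N. G (z + w))"
    by (rule sum_lattice_box_shift[OF \<open>N > 0\<close>, symmetric])
  also have "\<dots> = (\<Sum>z\<in>lattice_box N. F (z + w) * cos_kernel m (x - int_vec z /\<^sub>R real N))"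
    by (simp add: G_def int_vec_simps scaleR_add_right algebra_simps)
  finally show ?thesis by (simp add: lattice_avg_def G_def)
qed

section \<open>Derivatives of lattice averages, with bounds uniform in \<open>N\<close>\<close>

definition kernel_gradient :: "nat \<Rightarrow> real ^ 'n::finite \<Rightarrow> real ^ 'n" where
  "kernel_gradient m x = torus_gradient (\<lambda>a. cos_kernel m (rep_torus a)) (to_torus x)"

lemma cos_kernel_C1: "torus_C1 (\<lambda>a. cos_kernel m (rep_torus (a :: 'n::finite torus)))"
proof -
  define g where "g x = (\<chi> k. (real (2 * m) * cos (pi * x $ k) ^ (2 * m - 1) * (- sin (pi * x $ k) * pi)) *
      (\<Prod>j\<in>UNIV - {k}. cos (pi * x $ j) ^ (2 * m)))" for x :: "real ^ 'n"
  have der: "(cos_kernel m has_derivative (\<lambda>v. v \<bullet> g x)) (at x)" for x :: "real ^ 'n"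
  proof -
    have "((\<lambda>x. cos (pi * x $ k) ^ (2 * m)) has_derivative
        (\<lambda>v. v $ k * (real (2 * m) * cos (pi * x $ k) ^ (2 * m - 1) * (- sin (pi * x $ k) * pi)))) (at x)" for k
      by (rule derivative_eq_intros bounded_linear.has_derivative[OF bounded_linear_vec_nth] refl)+
        (simp add: fun_eq_iff algebra_simps)
    then have "((\<lambda>x. \<Prod>k\<in>UNIV. cos (pi * x $ k) ^ (2 * m)) has_derivative
        (\<lambda>v. \<Sum>k\<in>UNIV. v $ k * (real (2 * m) * cos (pi * x $ k) ^ (2 * m - 1) * (- sin (pi * x $ k) * pi)) *
          (\<Prod>j\<in>UNIV - {k}. cos (pi * x $ j) ^ (2 * m)))) (at x)"
      by (rule has_derivative_prod)
    then show ?thesis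
      by (simp only: cos_kernel_def[abs_def] g_def inner_vec_def inner_real_def vec_lambda_beta mult.assoc)
  qed
  have "continuous_on UNIV g"
    unfolding g_def by (intro continuous_intros)
  show ?thesis
    unfolding torus_C1_def class_C1_def cos_kernel_rep
    using der bounded_linear.continuous_on[OF bounded_linear_blinfun_inner_left \<open>continuous_on UNIV g\<close>]
    by (intro exI[of _ "\<lambda>x. blinfun_inner_left (g x)"]) simp
qed

definition lattice_avg_gradient ::
    "nat \<Rightarrow> nat \<Rightarrow> (int ^ 'n \<Rightarrow> real) \<Rightarrow> real ^ 'n::finite \<Rightarrow> real ^ 'n" where
  "lattice_avg_gradient N m F x =
     (\<Sum>z\<in>lattice_box N. F z *\<^sub>R kernel_gradient m (x - int_vec z /\<^sub>R real N)) /\<^sub>R (real N * cos_mean m) ^ CARD('n)"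

lemma to_torus_rep_diff: "to_torus (rep_torus (to_torus x) - y) = to_torus (x - y)"
proof -
  obtain l where "rep_torus (to_torus x) = x + int_vec l"
    using to_torus_rep to_torus_eq_iff by blast
  then have "rep_torus (to_torus x) - y = (x - y) + int_vec l" by simp
  then show ?thesis by (simp only: to_torus_add_int_vec)
qed

lemma lattice_avg_C1:
  fixes F :: "int ^ 'n::finite \<Rightarrow> real" and N m :: nat
  defines "\<phi> \<equiv> \<lambda>a. lattice_avg N m F (rep_torus a)"
  shows "torus_C1 \<phi>" "\<phi> (to_torus x) = lattice_avg N m F x"
    "torus_gradient \<phi> (to_torus x) = lattice_avg_gradient N m F x"
proof -
  have lift: "\<phi> (to_torus x) = lattice_avg N m F x" for x
    by (simp add: \<phi>_def lattice_avg_def)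
  then show "\<phi> (to_torus x) = lattice_avg N m F x" .
  have grad_lift: "lattice_avg_gradient N m F (rep_torus (to_torus x)) = lattice_avg_gradient N m F x" for x :: "real ^ 'n"
    by (simp add: lattice_avg_gradient_def kernel_gradient_def to_torus_rep_diff)
  have ker: "(cos_kernel m has_derivative (\<lambda>v. v \<bullet> kernel_gradient m x)) (at x)" for x :: "real ^ 'n"
    using torus_C1_has_derivative[OF cos_kernel_C1, of m x]
    by (simp add: kernel_gradient_def)
  have "((\<lambda>x. cos_kernel m (x - y)) has_derivative (\<lambda>v. v \<bullet> kernel_gradient m (x - y))) (at x)" for x y :: "real ^ 'n"
  proof -
    have "((\<lambda>x. x - y) has_derivative (\<lambda>v. v)) (at x)" by (auto intro!: derivative_eq_intros)
    from has_derivative_compose[OF this ker] show ?thesis .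
  qed
  then have der: "((\<lambda>x. \<phi> (to_torus x)) has_derivative (\<lambda>v. v \<bullet> lattice_avg_gradient N m F (rep_torus (to_torus x)))) (at x)" for x
    unfolding lift[abs_def] grad_lift unfolding lattice_avg_def lattice_avg_gradient_def divide_inverse
    by (auto intro!: derivative_eq_intros simp: inner_sum_right fun_eq_iff mult.commute)
  have "continuous_on UNIV (kernel_gradient m :: real ^ 'n \<Rightarrow> _)"
    unfolding kernel_gradient_def[abs_def] by (rule torus_gradient_lift_continuous[OF cos_kernel_C1])
  then have "continuous_on UNIV (\<lambda>x. kernel_gradient m (x - y))" for y :: "real ^ 'n"
    by (rule continuous_on_compose2) (auto intro: continuous_intros)
  then have "continuous_on UNIV (\<lambda>x. lattice_avg_gradient N m F x)"
    unfolding lattice_avg_gradient_def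
    by (intro continuous_on_scaleR continuous_on_sum continuous_on_const)
  then have cont: "continuous_on UNIV (\<lambda>x. lattice_avg_gradient N m F (rep_torus (to_torus x)))"
    unfolding grad_lift .
  show "torus_C1 \<phi>" by (rule torus_C1I(1)[OF der cont])
  show "torus_gradient \<phi> (to_torus x) = lattice_avg_gradient N m F x"
    unfolding torus_C1I(2)[OF der cont] grad_lift ..
qed

text \<open>The box has \<open>N ^ CARD('n)\<close> points, and the same power of \<open>N\<close>
  stands in the normalisation. This cancellation makes all later constants independent of the
  mesh.\<close>

lemma lattice_sum_bound:
  fixes p :: "int ^ 'n::finite \<Rightarrow> 'a::real_normed_vector"
  assumes "N > 0" "\<And>z. \<bar>F z\<bar> \<le> B" "\<And>z. norm (p z) \<le> b"
  shows "norm ((\<Sum>z\<in>lattice_box N. F z *\<^sub>R p z) /\<^sub>R (real N * cos_mean m) ^ CARD('n)) \<le> B * b / cos_mean m ^ CARD('n)"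
proof -
  have "norm (\<Sum>z\<in>lattice_box N. F z *\<^sub>R p z) \<le> (\<Sum>z\<in>(lattice_box N :: (int ^ 'n) set). B * b)"
    using assms order_trans[OF abs_ge_zero assms(2)]
    by (intro sum_norm_le) (auto intro!: mult_mono)
  also have "\<dots> = real N ^ CARD('n) * (B * b)" by (simp add: card_lattice_box)
  finally have "norm (\<Sum>z\<in>lattice_box N. F z *\<^sub>R p z) / (real N * cos_mean m) ^ CARD('n)
      \<le> real N ^ CARD('n) * (B * b) / (real N * cos_mean m) ^ CARD('n)"
    using cos_mean_pos[of m] by (intro divide_right_mono) simp_all
  also have "\<dots> = B * b / cos_mean m ^ CARD('n)"
    using assms(1) by (simp add: power_mult_distrib)
  finally show ?thesis
    using cos_mean_pos[of m] by (simp add: divide_inverse mult.commute)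
qed

lemma lattice_avg_gradient_bound:
  "\<exists>G. \<forall>N>0. \<forall>F::int ^ 'n::finite \<Rightarrow> real. \<forall>x. (\<forall>z. \<bar>F z\<bar> \<le> B) \<longrightarrow> norm (lattice_avg_gradient N m F x) \<le> G"
proof -
  obtain G where G: "norm (torus_gradient (\<lambda>a. cos_kernel m (rep_torus a)) (a :: 'n torus)) \<le> G" for a
    using torus_gradient_bounded[OF cos_kernel_C1] by blast
  show ?thesis
    unfolding lattice_avg_gradient_def
    by (rule exI[of _ "B * G / cos_mean m ^ CARD('n)"], intro allI impI lattice_sum_bound)
      (auto simp: kernel_gradient_def G)
qed

text \<open>The order of quantifiers matters: \<open>d\<close> is taken from the kernel alone,
  before \<open>N\<close> and \<open>F\<close>. The averaged function inherits the linearisation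
  error of the kernel, however irregular \<open>F\<close> is.\<close>

lemma lattice_avg_uniformly_differentiable:
  assumes "e > 0"
  shows "\<exists>d>0. \<forall>N>0. \<forall>F::int ^ 'n::finite \<Rightarrow> real. \<forall>x y. (\<forall>z. \<bar>F z\<bar> \<le> B) \<longrightarrow> norm y \<le> d \<longrightarrow>
    \<bar>lattice_avg N m F (x + y) - lattice_avg N m F x - y \<bullet> lattice_avg_gradient N m F x\<bar> \<le> e * norm y"
proof -
  \<comment> \<open>Compensates the factor \<open>B / cos_mean m ^ CARD('n)\<close> lost in
    \<open>lattice_sum_bound\<close>; the added 1 keeps the denominator positive.\<close>
  define e' where "e' = e * cos_mean m ^ CARD('n) / (\<bar>B\<bar> + 1)"
  have "e' > 0" using assms cos_mean_pos[of m] by (simp add: e'_def)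
  from torus_C1_uniformly_differentiable[OF cos_kernel_C1 this]
  obtain d where "d > 0" and d: "\<And>x y :: real ^ 'n. norm y \<le> d \<Longrightarrow>
      \<bar>cos_kernel m (x + y) - cos_kernel m x - y \<bullet> kernel_gradient m x\<bar> \<le> e' * norm y"
    unfolding kernel_gradient_def cos_kernel_rep by blast
  have "\<bar>lattice_avg N m F (x + y) - lattice_avg N m F x - y \<bullet> lattice_avg_gradient N m F x\<bar> \<le> e * norm y"
    if "N > 0" "\<forall>z. \<bar>F z\<bar> \<le> B" "norm y \<le> d" for N x y and F :: "int ^ 'n \<Rightarrow> real"
  proof -
    define p where "p z = cos_kernel m (x - int_vec z /\<^sub>R real N + y) - cos_kernel m (x - int_vec z /\<^sub>R real N)
        - y \<bullet> kernel_gradient m (x - int_vec z /\<^sub>R real N)" for z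
    have "lattice_avg N m F (x + y) - lattice_avg N m F x - y \<bullet> lattice_avg_gradient N m F x =
        (\<Sum>z\<in>lattice_box N. F z *\<^sub>R p z) /\<^sub>R (real N * cos_mean m) ^ CARD('n)"
      by (simp add: lattice_avg_def lattice_avg_gradient_def p_def inner_sum_right divide_inverse
          right_diff_distrib sum_subtractf sum.distrib algebra_simps)
    moreover have "norm ((\<Sum>z\<in>lattice_box N. F z *\<^sub>R p z) /\<^sub>R (real N * cos_mean m) ^ CARD('n))
        \<le> B * (e' * norm y) / cos_mean m ^ CARD('n)"
      using that d by (intro lattice_sum_bound) (auto simp: p_def)
    moreover have "B * (e' * norm y) / cos_mean m ^ CARD('n) = (B / (\<bar>B\<bar> + 1)) * (e * norm y)"
      using cos_mean_pos[of m] by (simp add: e'_def)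
    moreover have "(B / (\<bar>B\<bar> + 1)) * (e * norm y) \<le> 1 * (e * norm y)"
      using assms by (intro mult_right_mono) auto
    ultimately show ?thesis by simp
  qed
  then show ?thesis using \<open>d > 0\<close> by blast
qed

section \<open>Closed walks and discrete potentials\<close>

abbreviation lattice_point :: "nat \<Rightarrow> int ^ 'n \<Rightarrow> real ^ 'n::finite" where
  "lattice_point N z \<equiv> int_vec z /\<^sub>R real N"

text \<open>The representative in the unit cell, hence a grid point. The integer part removed here
  reappears as a winding number.\<close>

definition cell_point :: "nat \<Rightarrow> int ^ 'n \<Rightarrow> real ^ 'n::finite" where
  "cell_point N z = lattice_point N (\<chi> k. z $ k mod int N)"

lemma int_vec_nth: "int_vec z $ k = real_of_int (z $ k)"
  by (simp add: int_vec_def)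

lemma lattice_point_nth: "lattice_point N z $ k = real_of_int (z $ k) / real N"
  by (simp add: int_vec_def divide_inverse)

lemma grid_eq:
  assumes "N > 0"
  shows "grid (1 / real N) = lattice_point N ` lattice_box N"
proof (intro set_eqI iffI)
  fix x :: "real ^ 'n" assume "x \<in> grid (1 / real N)"
  then obtain m :: "'n \<Rightarrow> nat" where m: "\<And>k. x $ k = real (m k) * (1 / real N)" "\<And>k. real (m k) * (1 / real N) < 1"
    unfolding grid_def by (auto simp: choice_iff)
  have "m k < N" for k using m(2)[of k] assms by (simp add: field_simps)
  then have "(\<chi> k. int (m k)) \<in> lattice_box N" by (simp add: lattice_box_def)
  moreover have "x = lattice_point N (\<chi> k. int (m k))"
    using m(1) by (simp add: vec_eq_iff int_vec_def field_simps)
  ultimately show "x \<in> lattice_point N ` lattice_box N" by blast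
next
  fix x :: "real ^ 'n" assume "x \<in> lattice_point N ` lattice_box N"
  then obtain z where z: "x = lattice_point N z" "z \<in> lattice_box N" by blast
  have "x $ k = real (nat (z $ k)) * (1 / real N) \<and> real (nat (z $ k)) * (1 / real N) < 1" for k
    using z assms by (auto simp: lattice_box_def int_vec_def field_simps) (metis of_int_less_iff of_int_of_nat_eq)
  then show "x \<in> grid (1 / real N)" unfolding grid_def by blast
qed

lemma finite_grid:
  assumes "mesh_size h" shows "finite (grid h)"
proof -
  obtain N where "N > 0" "h = 1 / real N"
    using assms by (auto simp: mesh_size_def)
  then show ?thesis by (simp only: grid_eq finite_imageI finite_lattice_box)
qed

lemma cell_point_in_grid:
  assumes "N > 0" shows "cell_point N z \<in> grid (1 / real N)"
  unfolding grid_eq[OF assms] cell_point_def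
  by (rule imageI) (use assms in \<open>simp add: lattice_box_def\<close>)

lemma lattice_point_split:
  assumes "N > 0"
  shows "lattice_point N z = cell_point N z + int_vec (\<chi> k. z $ k div int N)"
proof -
  have eq: "real_of_int a / real N = real_of_int (a mod int N) / real N + real_of_int (a div int N)" for a
  proof -
    have "real_of_int a = real_of_int (a mod int N + a div int N * int N)"
      by (simp only: mod_div_mult_eq)
    then have "real_of_int a = real_of_int (a mod int N) + real_of_int (a div int N) * real N"
      by (simp only: of_int_add of_int_mult of_int_of_nat_eq)
    then show ?thesis using assms by (simp only: add_divide_distrib) simp
  qed
  show ?thesis
    unfolding cell_point_def vec_eq_iff lattice_point_nth vector_add_component vec_lambda_beta int_vec_nth
    by (intro allI eq)
qed

text \<open>The map \<open>s\<close> may repeat values: a walk can use the same step several times,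
  and the weights then accumulate.\<close>

lemma has_sum_of_bool:
  fixes c :: "'i \<Rightarrow> real"
  assumes "finite I" "\<And>i. i \<in> I \<Longrightarrow> s i \<in> A"
  shows "((\<lambda>x. \<Sum>i\<in>I. c i * of_bool (x = s i)) has_sum (\<Sum>i\<in>I. c i)) A"
proof -
  have "(\<Sum>x\<in>s ` I. \<Sum>i\<in>I. c i * of_bool (x = s i)) = (\<Sum>i\<in>I. \<Sum>x\<in>s ` I. c i * of_bool (x = s i))"
    by (rule sum.swap)
  also have "\<dots> = (\<Sum>i\<in>I. c i)"
    using assms(1) by (intro sum.cong refl) (simp add: if_distrib of_bool_def cong: if_cong)
  finally show ?thesis
    using assms by (intro has_sum_finite_neutralI[of "s ` I"] sum.neutral) auto
qed

abbreviation step_lagrangian ::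
    "('n::finite torus \<Rightarrow> real ^ 'n \<Rightarrow> real) \<Rightarrow> real \<Rightarrow> (real ^ 'n) \<times> (real ^ 'n) \<times> (int ^ 'n) \<Rightarrow> real" where
  "step_lagrangian H \<tau> \<equiv> \<lambda>(x, y, l). lagrangian H (to_torus x) (velocity \<tau> x y l)"

text \<open>Serves twice: for occupation measures of closed walks, and for families that put the
  mass of each pair of grid points on one winding number.\<close>

lemma atomic_family:
  fixes s :: "'i \<Rightarrow> (real ^ 'n) \<times> (real ^ 'n) \<times> (int ^ 'n::finite)"
  assumes I: "finite I" and s: "\<And>i. i \<in> I \<Longrightarrow> s i \<in> grid_steps h"
    and c: "\<And>i. i \<in> I \<Longrightarrow> 0 \<le> c i" "(\<Sum>i\<in>I. c i) = 1"
    and balanced: "\<And>x. x \<in> grid h \<Longrightarrow>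
      (\<Sum>i\<in>I. c i * of_bool (x = fst (s i))) = (\<Sum>i\<in>I. c i * of_bool (x = fst (snd (s i))))"
  defines "\<mu> \<equiv> \<lambda>x. \<Sum>i\<in>I. c i * of_bool (x = s i)"
  shows "\<mu> \<in> discrete_measures h"
    "discrete_action H h \<tau> \<mu> =
      ereal (\<Sum>i\<in>I. step_lagrangian H \<tau> (s i) * c i)"
proof -
  show "\<mu> \<in> discrete_measures h"
    unfolding discrete_measures_def
  proof (intro CollectI conjI ballI)
    show "0 \<le> \<mu> x" for x unfolding \<mu>_def using c(1) by (intro sum_nonneg) simp
    show "(\<mu> has_sum 1) (grid_steps h)"
      unfolding \<mu>_def c(2)[symmetric] by (rule has_sum_of_bool[OF I s])
    fix x :: "real ^ 'n" assume x: "x \<in> grid h"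
    have out: "(\<lambda>(y, l). \<mu> (x, y, l)) = (\<lambda>b. \<Sum>i\<in>I. (c i * of_bool (x = fst (s i))) * of_bool (b = snd (s i)))"
      by (auto simp: fun_eq_iff \<mu>_def prod_eq_iff intro!: sum.cong)
    have into: "(\<lambda>(y, l). \<mu> (y, x, l)) = (\<lambda>b. \<Sum>i\<in>I. (c i * of_bool (x = fst (snd (s i)))) *
        of_bool (b = (fst (s i), snd (snd (s i)))))"
      by (auto simp: fun_eq_iff \<mu>_def prod_eq_iff intro!: sum.cong)
    have sum_out: "((\<lambda>(y, l). \<mu> (x, y, l)) has_sum (\<Sum>i\<in>I. c i * of_bool (x = fst (s i)))) (grid h \<times> UNIV)"
      unfolding out using s by (intro has_sum_of_bool[OF I]) (auto simp: mem_Times_iff)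
    have sum_into: "((\<lambda>(y, l). \<mu> (y, x, l)) has_sum (\<Sum>i\<in>I. c i * of_bool (x = fst (snd (s i))))) (grid h \<times> UNIV)"
      unfolding into using s by (intro has_sum_of_bool[OF I]) (auto simp: mem_Times_iff)
    show "(\<Sum>\<^sub>\<infinity>(y, l)\<in>grid h \<times> UNIV. \<mu> (x, y, l)) = (\<Sum>\<^sub>\<infinity>(y, l)\<in>grid h \<times> UNIV. \<mu> (y, x, l))"
      by (simp only: infsumI[OF sum_out] infsumI[OF sum_into] balanced[OF x])
  qed
  define F where "F = step_lagrangian H \<tau>"
  define f where "f = (\<lambda>(x, y, l). lagrangian H (to_torus x) (velocity \<tau> x y l) * \<mu> (x, y, l))"
  have "f = (\<lambda>x. \<Sum>i\<in>I. (F (s i) * c i) * of_bool (x = s i))"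
    unfolding f_def \<mu>_def F_def case_prod_unfold sum_distrib_left prod.collapse
    by (intro ext sum.cong refl) (auto simp: of_bool_def)
  then have f_sum: "(f has_sum (\<Sum>i\<in>I. F (s i) * c i)) (grid_steps h)"
    by (simp only:) (rule has_sum_of_bool[OF I s])
  show "discrete_action H h \<tau> \<mu> =
      ereal (\<Sum>i\<in>I. step_lagrangian H \<tau> (s i) * c i)"
    unfolding discrete_action_def Let_def f_def[symmetric] F_def[symmetric]
    by (simp add: has_sum_imp_summable[OF f_sum] infsumI[OF f_sum])
qed

text \<open>Steps are unfolded to the whole lattice, where the pair of end points already determines
  the winding number.\<close>

definition step_cost ::
    "('n::finite torus \<Rightarrow> real ^ 'n \<Rightarrow> real) \<Rightarrow> nat \<Rightarrow> real \<Rightarrow> int ^ 'n \<Rightarrow> int ^ 'n \<Rightarrow> real" where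
  "step_cost H N \<tau> p q = lagrangian H (to_torus (lattice_point N p)) (lattice_point N (q - p) /\<^sub>R \<tau>)"

lemma lattice_point_add: "lattice_point N (p + q) = lattice_point N p + lattice_point N q"
  unfolding int_vec_simps(2) by (rule scaleR_add_right)

lemma lattice_point_period: "N > 0 \<Longrightarrow> lattice_point N (int N *s l) = int_vec l"
  by (simp add: vec_eq_iff lattice_point_nth int_vec_nth del: vector_scaleR_component)

lemma step_cost_periodic:
  assumes "N > 0"
  shows "step_cost H N \<tau> (p + int N *s l) (q + int N *s l) = step_cost H N \<tau> p q"
proof -
  have "q + int N *s l - (p + int N *s l) = q - p" by simp
  then show ?thesis
    unfolding step_cost_def lattice_point_add lattice_point_period[OF assms] by simp
qed

text \<open>The occupation measure of a closed walk on the lattice is balanced, because every visit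
  to a grid point is left again.\<close>

lemma discrete_min_le_closed_walk:
  fixes p :: "nat \<Rightarrow> int ^ 'n::finite"
  assumes N: "N > 0" and M: "M > 0" and closed: "p M = p 0 + int N *s l"
  shows "discrete_min H (1 / real N) \<tau> \<le> ereal ((\<Sum>i<M. step_cost H N \<tau> (p i) (p (Suc i))) / real M)"
proof -
  define h where "h = 1 / real N"
  \<comment> \<open>The winding number of step \<open>i\<close>: the change of the integer part that
    \<open>cell_point\<close> discards.\<close>
  define e where "e i = (\<chi> k. p (Suc i) $ k div int N - p i $ k div int N)" for i
  define s where "s i = (cell_point N (p i), cell_point N (p (Suc i)), e i)" for i
  have g: "cell_point N z \<in> grid h" for z :: "int ^ 'n"
    unfolding h_def by (rule cell_point_in_grid[OF N])
  have s: "s i \<in> grid_steps h" for i using g by (simp add: s_def)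
  have balanced: "(\<Sum>i<M. 1 / real M * of_bool (x = fst (s i))) = (\<Sum>i<M. 1 / real M * of_bool (x = fst (snd (s i))))" for x
  proof -
    have "cell_point N (p M) = cell_point N (p 0)" by (simp add: closed cell_point_def)
    then show ?thesis
      using sum.lessThan_Suc_shift[of "\<lambda>i. 1 / real M * of_bool (x = cell_point N (p i))" M]
      by (simp add: s_def)
  qed
  have cost: "step_lagrangian H \<tau> (s i) = step_cost H N \<tau> (p i) (p (Suc i))" for i
  proof -
    have "to_torus (lattice_point N (p i)) = to_torus (cell_point N (p i))"
      unfolding lattice_point_split[OF N] by simp
    moreover have "lattice_point N (p (Suc i) - p i) =
        cell_point N (p (Suc i)) + int_vec (e i) - cell_point N (p i)"
    proof -
      have "lattice_point N (p (Suc i) - p i) = lattice_point N (p (Suc i)) - lattice_point N (p i)"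
        using lattice_point_add[of N "p (Suc i) - p i" "p i"] by simp
      then show ?thesis
        unfolding lattice_point_split[OF N, of "p (Suc i)"] lattice_point_split[OF N, of "p i"]
        by (simp add: e_def int_vec_def vec_eq_iff)
    qed
    ultimately show ?thesis by (simp add: step_cost_def velocity_def s_def divide_inverse)
  qed
  have "discrete_min H h \<tau> \<le> discrete_action H h \<tau> (\<lambda>x. \<Sum>i<M. 1 / real M * of_bool (x = s i))"
    unfolding discrete_min_def
    by (rule INF_lower, rule atomic_family(1)) (use s M balanced in auto)
  also have "\<dots> = ereal (\<Sum>i<M. step_lagrangian H \<tau> (s i) * (1 / real M))"
    by (rule atomic_family(2)) (use s M balanced in auto)
  also have "\<dots> = ereal ((\<Sum>i<M. step_cost H N \<tau> (p i) (p (Suc i))) / real M)"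
    by (simp add: cost sum_divide_distrib)
  finally show ?thesis unfolding h_def .
qed

lemma norm_le_card_mult:
  fixes x :: "real ^ 'n::finite"
  assumes "\<And>k. \<bar>x $ k\<bar> \<le> b"
  shows "norm x \<le> real CARD('n) * b"
proof -
  have "norm x \<le> (\<Sum>k\<in>UNIV. \<bar>x $ k\<bar>)" by (rule norm_le_l1_cart)
  also have "\<dots> \<le> (\<Sum>k\<in>(UNIV :: 'n set). b)" by (intro sum_mono assms)
  finally show ?thesis by simp
qed

text \<open>The potential is the least cost of a walk arriving at a given lattice point. Walks can be
  closed up at bounded cost, which keeps the infimum finite.\<close>

lemma discrete_potential:
  fixes H :: "'n::finite torus \<Rightarrow> real ^ 'n \<Rightarrow> real"
  assumes H: "tonelli_hamiltonian H" and N: "N > 0" and \<tau>: "\<tau> > 0"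
    and c: "ereal c \<le> discrete_min H (1 / real N) \<tau>"
  obtains u :: "int ^ 'n \<Rightarrow> real"
  where "\<And>z l. u (z + int N *s l) = u z"
    "\<And>p q. u q \<le> u p + \<tau> * (step_cost H N \<tau> p q - c)"
proof -
  define W where "W p M = (\<Sum>i<M. \<tau> * (step_cost H N \<tau> (p i) (p (Suc i)) - c))" for p :: "nat \<Rightarrow> int ^ 'n" and M
  define V where "V q = {W p M | p M. p M = q}" for q
  define u where "u q = Inf (V q)" for q
  obtain B where B: "\<And>a v. norm v \<le> real CARD('n) / \<tau> \<Longrightarrow> \<bar>lagrangian H a v\<bar> \<le> B"
    using lagrangian_bounded[OF H] by blast
  \<comment> \<open>No negative cycles: the mean cost of a closed walk is at least the discrete
    minimum, hence at least \<open>c\<close>.\<close>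
  have closed: "W p M \<ge> 0" if "p M = p 0 + int N *s l" for p M l
  proof (cases "M = 0")
    case False
    have "c \<le> (\<Sum>i<M. step_cost H N \<tau> (p i) (p (Suc i))) / real M"
      using order_trans[OF c discrete_min_le_closed_walk[OF N _ that]] False by simp
    then have "0 \<le> (\<Sum>i<M. step_cost H N \<tau> (p i) (p (Suc i))) - real M * c"
      using False by (simp add: field_simps)
    also have "\<dots> = (\<Sum>i<M. step_cost H N \<tau> (p i) (p (Suc i)) - c)" by (simp add: sum_subtractf)
    finally show ?thesis using \<tau> by (simp add: W_def sum_distrib_left[symmetric])
  qed (simp add: W_def)
  have extend: "W (p(Suc M := q)) (Suc M) = W p M + \<tau> * (step_cost H N \<tau> (p M) q - c)" for p M q
    by (auto simp: W_def intro!: sum.cong)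
  have lower: "W p M \<ge> - (\<tau> * (B - c))" for p M
  proof -
    \<comment> \<open>Chooses the translate \<open>q\<close> of the starting point for which
      \<open>q - p M\<close> lies in the period box. One more step then closes the walk, with
      velocity at most \<open>CARD('n) / \<tau>\<close>, at cost at most \<open>B\<close>.\<close>
    define l where "l = (\<chi> k. - ((p 0 $ k - p M $ k) div int N))"
    define q where "q = p 0 + int N *s l"
    have d: "(q - p M) $ k = (p 0 $ k - p M $ k) mod int N" for k
      by (simp add: q_def l_def minus_div_mult_eq_mod[symmetric] algebra_simps)
    have "\<bar>lattice_point N (q - p M) $ k\<bar> \<le> 1" for k
    proof -
      have "0 \<le> (q - p M) $ k" "(q - p M) $ k \<le> int N"
        using N unfolding d by (simp_all add: less_imp_le)
      then have "0 \<le> real_of_int ((q - p M) $ k)" "real_of_int ((q - p M) $ k) \<le> real N"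
        using of_int_le_iff[of "(q - p M) $ k" "int N", where 'a = real] by simp_all
      then have "\<bar>real_of_int ((q - p M) $ k) / real N\<bar> \<le> 1" using N by simp
      then show ?thesis by (simp only: lattice_point_nth)
    qed
    then have "norm (lattice_point N (q - p M)) \<le> real CARD('n)"
      using norm_le_card_mult[of "lattice_point N (q - p M)" 1] by simp
    then have "norm (lattice_point N (q - p M) /\<^sub>R \<tau>) \<le> real CARD('n) / \<tau>"
      using \<tau> by (simp add: field_simps)
    from B[OF this] have "step_cost H N \<tau> (p M) q \<le> B"
      unfolding step_cost_def by (simp add: abs_le_iff)
    then have "\<tau> * (step_cost H N \<tau> (p M) q - c) \<le> \<tau> * (B - c)"
      using \<tau> by simp
    moreover have "0 \<le> W (p(Suc M := q)) (Suc M)"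
      by (rule closed[of _ _ l]) (simp add: q_def)
    ultimately show ?thesis unfolding extend by linarith
  qed
  have bdd: "bdd_below (V q)" for q
    using lower by (intro bdd_belowI) (auto simp: V_def)
  have ne: "V q \<noteq> {}" for q
    \<comment> \<open>The walk of length zero at \<open>q\<close>.\<close>
    unfolding V_def by (auto intro!: exI[of _ "\<lambda>_. q"])
  show ?thesis
  proof (rule that[of u])
    fix p q
    have "u q - \<tau> * (step_cost H N \<tau> p q - c) \<le> u p"
      unfolding u_def[of p]
    proof (rule cInf_greatest[OF ne])
      fix w assume "w \<in> V p"
      then obtain r M where r: "w = W r M" "r M = p" by (auto simp: V_def)
      then have "w + \<tau> * (step_cost H N \<tau> p q - c) \<in> V q"
        unfolding V_def using extend[of r M q] by (auto intro!: exI[of _ "r(Suc M := q)"] exI[of _ "Suc M"])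
      then show "u q - \<tau> * (step_cost H N \<tau> p q - c) \<le> w"
        using cInf_lower[OF _ bdd] unfolding u_def by fastforce
    qed
    then show "u q \<le> u p + \<tau> * (step_cost H N \<tau> p q - c)" by simp
  next
    fix z l
    have sub: "V z \<subseteq> V (z + int N *s l)" for z l
    proof
      fix w assume "w \<in> V z"
      then obtain r M where r: "w = W r M" "r M = z" by (auto simp: V_def)
      have "W (\<lambda>i. r i + int N *s l) M = W r M"
        by (simp add: W_def step_cost_periodic[OF N])
      then show "w \<in> V (z + int N *s l)"
        unfolding V_def using r by (auto intro!: exI[of _ "\<lambda>i. r i + int N *s l"] exI[of _ M])
    qed
    have "V (z + int N *s l) \<subseteq> V (z + int N *s l + int N *s (- l))" by (rule sub)
    also have "z + int N *s l + int N *s (- l) = z" by (simp add: vec_eq_iff)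
    finally show "u (z + int N *s l) = u z"
      using sub[of z l] by (simp add: u_def subset_antisym)
  qed
qed

text \<open>Rounding down \<open>i w / J\<close> splits the displacement \<open>w\<close> into
  \<open>J\<close> nearly equal integer steps; rounding costs at most one lattice unit per
  step.\<close>

lemma div_steps_bound:
  fixes w :: int
  assumes "J > 0" "0 \<le> w" "w \<le> int N"
  shows "0 \<le> int (Suc i) * w div int J - int i * w div int J"
    "real_of_int (int (Suc i) * w div int J - int i * w div int J) \<le> real N / real J + 1"
proof -
  have le: "int i * w \<le> int (Suc i) * w" using assms by (simp add: distrib_right)
  show "0 \<le> int (Suc i) * w div int J - int i * w div int J"
    using zdiv_mono1[OF le, of "int J"] assms by simp
  have "real_of_int (int (Suc i) * w div int J) \<le> real_of_int (int (Suc i) * w) / real J"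
    using floor_divide_of_int_eq[of "int (Suc i) * w" "int J", where 'a = real] of_int_floor_le
    by (metis of_int_of_nat_eq)
  moreover have "real_of_int (int i * w div int J) \<ge> real_of_int (int i * w) / real J - 1"
  proof -
    have "real_of_int (int i * w div int J) = real_of_int \<lfloor>real_of_int (int i * w) / real J\<rfloor>"
      using floor_divide_of_int_eq[of "int i * w" "int J", where 'a = real] by simp
    then show ?thesis by linarith
  qed
  moreover have "real_of_int (int (Suc i) * w) / real J - real_of_int (int i * w) / real J = real_of_int w / real J"
    by (simp add: algebra_simps add_divide_distrib)
  moreover have "real_of_int w / real J \<le> real N / real J"
    using assms by (intro divide_right_mono) auto
  ultimately show "real_of_int (int (Suc i) * w div int J - int i * w div int J) \<le> real N / real J + 1"
    by simp
qed

text \<open>Two lattice points are joined, modulo the period, by \<open>J\<close> steps of bounded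
  velocity in total time \<open>J \<tau> \<le> 2\<close>, and each step costs at most
  \<open>\<tau> * (B + C)\<close>. The bound is free of \<open>N\<close> and
  \<open>\<tau>\<close>.\<close>

lemma potential_oscillation:
  fixes u :: "int ^ 'n::finite \<Rightarrow> real"
  assumes N: "N > 0" and \<tau>: "0 < \<tau>" "\<tau> \<le> 1" "1 / real N \<le> \<tau>"
    and per: "\<And>z l. u (z + int N *s l) = u z"
    and step: "\<And>p q. u q \<le> u p + \<tau> * (step_cost H N \<tau> p q - c)"
    and B: "\<And>a v. norm v \<le> 2 * real CARD('n) \<Longrightarrow> \<bar>lagrangian H a v\<bar> \<le> B" and c: "\<bar>c\<bar> \<le> C"
  shows "\<bar>u p - u q\<bar> \<le> 2 * (B + C)"
proof -
  have "B \<ge> 0" using order_trans[OF abs_ge_zero B[of 0]] by simp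
  have "C \<ge> 0" using c by simp
  \<comment> \<open>Each coordinate moves by at most 1/J + 1/N per step. Both terms are at most
    \<open>\<tau>\<close>, which is why the velocity radius is \<open>2 * CARD('n)\<close>.\<close>
  define J where "J = nat \<lceil>1 / \<tau>\<rceil>"
  have J: "1 / \<tau> \<le> real J" "real J \<le> 1 / \<tau> + 1" 
    using \<tau> by (simp_all add: J_def of_nat_ceiling)
  then have "J > 0" using \<tau> by (smt (verit) of_nat_0_less_iff zero_less_divide_1_iff)
  have one: "u q - u p \<le> 2 * (B + C)" for p q
  proof -
    define w where "w = (\<chi> k. (q $ k - p $ k) mod int N)"
    define l where "l = (\<chi> k. (q $ k - p $ k) div int N)"
    have w: "0 \<le> w $ k" "w $ k \<le> int N" for k using N by (simp_all add: w_def less_imp_le)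
    have q: "q = p + w + int N *s l" by (simp add: vec_eq_iff w_def l_def)
    define r where "r i = p + (\<chi> k. int i * w $ k div int J)" for i
    have "u (r i) \<le> u p + real i * (\<tau> * (B + C))" for i
    proof (induction i)
      case 0
      have "r 0 = p" by (simp add: r_def vec_eq_iff)
      then show ?case by simp
    next
      case (Suc i)
      have diff: "(r (Suc i) - r i) $ k = int (Suc i) * w $ k div int J - int i * w $ k div int J" for k
        by (simp add: r_def)
      have "\<bar>lattice_point N (r (Suc i) - r i) $ k\<bar> \<le> 2 * \<tau>" for k
      proof -
        have "\<bar>lattice_point N (r (Suc i) - r i) $ k\<bar> \<le> (real N / real J + 1) / real N"
          using div_steps_bound[OF \<open>J > 0\<close> w[of k], of i] N
          by (simp add: int_vec_def diff[simplified] divide_inverse mult.commute mult_right_mono del: of_int_diff)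
        also have "\<dots> = 1 / real J + 1 / real N"
          using N by (simp add: field_simps)
        also have "1 / real J \<le> \<tau>" using J(1) \<tau> \<open>J > 0\<close> by (simp add: field_simps)
        finally show ?thesis using \<tau> by simp
      qed
      then have "norm (lattice_point N (r (Suc i) - r i)) \<le> real CARD('n) * (2 * \<tau>)"
        by (rule norm_le_card_mult)
      then have "norm (lattice_point N (r (Suc i) - r i)) / \<tau> \<le> 2 * real CARD('n)"
        using \<tau> by (subst pos_divide_le_eq) (simp_all add: mult_ac)
      then have "norm (lattice_point N (r (Suc i) - r i) /\<^sub>R \<tau>) \<le> 2 * real CARD('n)"
        using \<tau> by (simp only: norm_scaleR divide_inverse_commute abs_inverse abs_of_pos)
      from B[OF this] have "step_cost H N \<tau> (r i) (r (Suc i)) \<le> B"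
        unfolding step_cost_def by (simp add: abs_le_iff)
      then have "\<tau> * (step_cost H N \<tau> (r i) (r (Suc i)) - c) \<le> \<tau> * (B + C)"
        using \<tau> c by (intro mult_left_mono) auto
      then show ?case using step[of "r (Suc i)" "r i"] Suc by (simp add: algebra_simps)
    qed
    from this[of J] have "u (r J) \<le> u p + real J * (\<tau> * (B + C))" .
    moreover have "r J = p + w" using \<open>J > 0\<close> by (simp add: r_def vec_eq_iff)
    moreover have "real J * \<tau> \<le> 2"
      using mult_right_mono[OF J(2), of \<tau>] \<tau> by (simp add: distrib_right)
    then have "real J * (\<tau> * (B + C)) \<le> 2 * (B + C)"
      using mult_right_mono[of "real J * \<tau>" 2 "B + C"] \<open>B \<ge> 0\<close> \<open>C \<ge> 0\<close> by (simp add: mult.assoc)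
    ultimately show ?thesis using q per[of "p + w" l] by simp
  qed
  show ?thesis using one[of p q] one[of q p] by (simp add: abs_le_iff)
qed

section \<open>Smooth almost subsolutions\<close>

text \<open>Squared sines are a periodic substitute for squared distance whose kernel average is
  known exactly. If all are small, \<open>x\<close> and \<open>z\<close> are close modulo integers
  and uniform continuity applies; otherwise the last term exceeds the oscillation of the
  Lagrangian.\<close>

lemma lagrangian_sin_modulus:
  fixes H :: "'n::finite torus \<Rightarrow> real ^ 'n \<Rightarrow> real"
  assumes H: "tonelli_hamiltonian H" and "e > 0"
  obtains C d where "C \<ge> 0" "d > 0" "d \<le> 1"
    "\<And>x z v v'. norm v \<le> R \<Longrightarrow> norm (v' - v) \<le> d \<Longrightarrow>
      lagrangian H (to_torus z) v' \<le> lagrangian H (to_torus x) v + e +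
        C * (\<Sum>k\<in>UNIV. (sin (pi * (x $ k - z $ k)))\<^sup>2)"
proof -
  define n where "n = real CARD('n)"
  have "n > 0" by (simp add: n_def)
  have "uniformly_continuous_on (UNIV \<times> cball 0 (R + 1)) (\<lambda>(a, v). lagrangian H a v)"
    by (intro compact_uniformly_continuous compact_Times compact_torus compact_cball
        continuous_on_subset[OF lagrangian_continuous[OF H]]) auto
  then obtain \<rho> where "\<rho> > 0" and \<rho>: "\<And>a b v w. norm v \<le> R + 1 \<Longrightarrow> norm w \<le> R + 1 \<Longrightarrow>
      dist (b, w) (a, v) < \<rho> \<Longrightarrow> dist (lagrangian H b w) (lagrangian H a v) < e"
    unfolding uniformly_continuous_on_def using \<open>e > 0\<close> by fastforce
  obtain B where B: "\<And>a v. norm v \<le> R + 1 \<Longrightarrow> \<bar>lagrangian H a v\<bar> \<le> B"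
    using lagrangian_bounded[OF H] by blast
  \<comment> \<open>The threshold per coordinate: \<open>t \<le> 1 / 2\<close> keeps the sine
    monotone, and \<open>n * t \<le> \<rho> / 4\<close> keeps the points within the modulus
    \<open>\<rho>\<close>. The value \<open>s\<close> is the least squared sine beyond it.\<close>
  define t where "t = min (1 / 2) (\<rho> / (4 * n))"
  define s where "s = (sin (pi * t))\<^sup>2"
  define d where "d = min 1 (\<rho> / 2)"
  have t: "0 < t" "t \<le> 1 / 2" "n * t \<le> \<rho> / 4"
    using \<open>\<rho> > 0\<close> \<open>n > 0\<close> by (auto simp: t_def min_def field_simps)
  have "sin (pi * t) > 0"
    using t by (intro sin_gt_zero) (auto simp: field_simps)
  then have "s > 0" by (simp add: s_def)
  show ?thesis
  proof (rule that[of "2 * \<bar>B\<bar> / s" d])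
    fix x z v v' :: "real ^ 'n" assume nv: "norm v \<le> R" and close: "norm (v' - v) \<le> d"
    have "norm v' \<le> norm v + norm (v' - v)" by (rule norm_triangle_sub)
    then have nv': "norm v' \<le> R + 1" using nv close by (simp add: d_def)
    define S where "S = (\<Sum>k\<in>UNIV. (sin (pi * (x $ k - z $ k)))\<^sup>2)"
    have "S \<ge> 0" unfolding S_def by (simp add: sum_nonneg)
    \<comment> \<open>Rounding picks the nearest translate, so every coordinate of the difference
      has modulus at most 1/2.\<close>
    define l where "l = (\<chi> k. - round (x $ k - z $ k))"
    have comp: "(x - z + int_vec l) $ k = x $ k - z $ k - of_int (round (x $ k - z $ k))" for k
      by (simp add: l_def int_vec_nth)
    show "lagrangian H (to_torus z) v' \<le> lagrangian H (to_torus x) v + e + 2 * \<bar>B\<bar> / s * S"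
    proof (cases "\<forall>k. \<bar>(x - z + int_vec l) $ k\<bar> \<le> t")
      case True
      have "dist (to_torus z) (to_torus x) = dist (to_torus (x + int_vec l)) (to_torus z)"
        by (simp add: dist_commute)
      also have "\<dots> \<le> norm (x - z + int_vec l)"
        using dist_to_torus_le[of "x + int_vec l" z] by (simp add: dist_norm algebra_simps)
      also have "\<dots> \<le> n * t" unfolding n_def using True by (intro norm_le_card_mult) auto
      finally have "dist (to_torus z) (to_torus x) < \<rho> / 2" using t(3) \<open>\<rho> > 0\<close> by linarith
      moreover have "dist (to_torus z, v') (to_torus x, v) \<le> dist (to_torus z) (to_torus x) + dist v' v"
        unfolding dist_Pair_Pair by (rule sqrt_sum_squares_le_sum) auto
      moreover have "dist v' v \<le> \<rho> / 2" using close by (simp add: dist_norm d_def)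
      ultimately have "dist (lagrangian H (to_torus z) v') (lagrangian H (to_torus x) v) < e"
        using nv nv' by (intro \<rho>) auto
      then have "lagrangian H (to_torus z) v' \<le> lagrangian H (to_torus x) v + e"
        unfolding dist_real_def by linarith
      moreover have "0 \<le> 2 * \<bar>B\<bar> / s * S" using \<open>S \<ge> 0\<close> \<open>s > 0\<close> by simp
      ultimately show ?thesis by linarith
    next
      case False
      then obtain k where k: "\<bar>(x - z + int_vec l) $ k\<bar> > t" by (auto simp: not_le)
      define y where "y = \<bar>(x - z + int_vec l) $ k\<bar>"
      have y: "t \<le> y" "y \<le> 1 / 2"
        using k of_int_round_abs_le[of "x $ k - z $ k"] unfolding y_def comp by linarith+
      have "(sin (pi * (x $ k - z $ k)))\<^sup>2 = (sin (pi * y))\<^sup>2"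
      proof -
        have "x $ k - z $ k = (x - z + int_vec l) $ k + of_int (round (x $ k - z $ k))"
          unfolding comp by simp
        then have "(sin (pi * (x $ k - z $ k)))\<^sup>2 =
            (sin (pi * (x - z + int_vec l) $ k + pi * of_int (round (x $ k - z $ k))))\<^sup>2"
          by (metis distrib_left)
        also have "\<dots> = (sin (pi * (x - z + int_vec l) $ k))\<^sup>2"
          unfolding sin_add by (simp add: power_mult_distrib)
        also have "\<dots> = (sin (pi * y))\<^sup>2"
        proof -
          have "(sin (pi * \<bar>r\<bar>))\<^sup>2 = (sin (pi * r))\<^sup>2" for r by (simp add: abs_if)
          then show ?thesis unfolding y_def by (rule sym)
        qed
        finally show ?thesis .
      qed
      moreover have "sin (pi * t) \<le> sin (pi * y)"
      proof (rule sin_monotone_2pi_le)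
        have "0 \<le> pi * t" using t by simp
        then show "- (pi / 2) \<le> pi * t" using pi_half_gt_zero by linarith
        show "pi * t \<le> pi * y" "pi * y \<le> pi / 2" using y by simp_all
      qed
      then have "s \<le> (sin (pi * y))\<^sup>2"
        unfolding s_def using \<open>sin (pi * t) > 0\<close> by (intro power_mono) auto
      moreover have "(sin (pi * (x $ k - z $ k)))\<^sup>2 \<le> S"
        unfolding S_def by (rule member_le_sum) auto
      ultimately have "s \<le> S" by simp
      then have "2 * \<bar>B\<bar> \<le> 2 * \<bar>B\<bar> / s * S"
        using \<open>s > 0\<close> mult_left_mono[of 1 "S / s" "2 * \<bar>B\<bar>"] by (simp add: field_simps)
      moreover have "norm v \<le> R + 1" using nv by simp
      then have "\<bar>lagrangian H (to_torus x) v\<bar> \<le> \<bar>B\<bar>" using B[of v "to_torus x"] by linarith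
      moreover have "\<bar>lagrangian H (to_torus z) v'\<bar> \<le> \<bar>B\<bar>" using B[OF nv', of "to_torus z"] by linarith
      ultimately show ?thesis using \<open>e > 0\<close> by linarith
    qed
  qed (use \<open>s > 0\<close> \<open>\<rho> > 0\<close> in \<open>auto simp: d_def\<close>)
qed

text \<open>Round \<open>\<tau> v\<close> to a lattice vector and average the potential inequality
  along it. The left side is an increment of a C^1 function, close to \<open>\<tau>\<close> times v
  . D phi; divide by \<open>\<tau>\<close>. The error \<open>e\<close> is split into e/3 for the
  modulus, e/3 for the spread of the kernel, and e/6 each for linearisation and rounding.\<close>

lemma almost_subsolution_on_ball:
  fixes H :: "'n::finite torus \<Rightarrow> real ^ 'n \<Rightarrow> real"
  assumes H: "tonelli_hamiltonian H" and e: "e > 0" and R: "R \<ge> 0"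
  obtains \<delta> where "\<delta> > 0"
    "\<And>N \<tau> c. N > 0 \<Longrightarrow> 0 < \<tau> \<Longrightarrow> \<tau> < \<delta> \<Longrightarrow> 1 / real N < \<delta> \<Longrightarrow> 1 / real N / \<tau> < \<delta> \<Longrightarrow>
      \<bar>c\<bar> \<le> C \<Longrightarrow> ereal c \<le> discrete_min H (1 / real N) \<tau> \<Longrightarrow>
      \<exists>\<phi>. torus_C1 \<phi> \<and> (\<forall>a v. norm v \<le> R \<longrightarrow> v \<bullet> torus_gradient \<phi> a \<le> lagrangian H a v - c + e)"
proof -
  define n where "n = real CARD('n)"
  have "n > 0" by (simp add: n_def)
  obtain B where B: "\<And>a v. norm v \<le> 2 * n \<Longrightarrow> \<bar>lagrangian H a v\<bar> \<le> B"
    using lagrangian_bounded[OF H] by blast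
  obtain C' d where C': "C' \<ge> 0" "d > 0" "d \<le> 1"
    and modulus: "\<And>x z v v'. norm v \<le> R \<Longrightarrow> norm (v' - v) \<le> d \<Longrightarrow>
      lagrangian H (to_torus z) v' \<le> lagrangian H (to_torus x) v + e / 3 +
        C' * (\<Sum>k\<in>UNIV. (sin (pi * (x $ k - z $ k)))\<^sup>2)"
    using e by - (rule lagrangian_sin_modulus[OF H, of "e / 3" R], simp, rule that, assumption+)
  \<comment> \<open>The exponent depends on \<open>e\<close>, \<open>R\<close> and \<open>H\<close>
    but not on the mesh; it makes the averaged squared sines cost at most e/3.\<close>
  obtain m :: nat where "C' * n * 3 / e \<le> real m" using real_arch_simple by blast
  then have "C' * n * 3 \<le> real m * e"
    using e by (simp add: pos_divide_le_eq)
  also have "real m * e \<le> (2 * real m + 2) * e"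
    using e by (intro mult_right_mono) auto
  finally have m: "C' * (n / (2 * real m + 2)) \<le> e / 3"
    by (simp add: field_simps)
  \<comment> \<open>The increment has norm at most \<open>\<tau> * (R + 1)\<close>, so this accuracy
    costs at most \<open>\<tau> * (e / 6)\<close>.\<close>
  define e' where "e' = e / (6 * (R + 1))"
  have "e' > 0" using e R by (simp add: e'_def)
  obtain G where "\<forall>N>0. \<forall>F::int ^ 'n \<Rightarrow> real. \<forall>x. (\<forall>z. \<bar>F z\<bar> \<le> 2 * (B + C)) \<longrightarrow>
      norm (lattice_avg_gradient N m F x) \<le> G"
    using lattice_avg_gradient_bound by (rule exE)
  note G = this[rule_format]
  obtain d' where "d' > 0 \<and> (\<forall>N>0. \<forall>F::int ^ 'n \<Rightarrow> real. \<forall>x y. (\<forall>z. \<bar>F z\<bar> \<le> 2 * (B + C)) \<longrightarrow> norm y \<le> d' \<longrightarrow>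
      \<bar>lattice_avg N m F (x + y) - lattice_avg N m F x - y \<bullet> lattice_avg_gradient N m F x\<bar> \<le> e' * norm y)"
    using lattice_avg_uniformly_differentiable[OF \<open>e' > 0\<close>] by (rule exE)
  note d' = conjunct2[OF this, rule_format] and d'_pos = conjunct1[OF this]
  \<comment> \<open>In order: \<open>\<tau> \<le> 1\<close> and 1/N at most \<open>\<tau>\<close>
    for the oscillation bound; increments inside the radius \<open>d'\<close>;
    \<open>Suc m < N\<close>; rounded velocities within \<open>d\<close>; rounding error against the
    gradient at most e/6.\<close>
  define A where "A = {1, d' / (R + 1), 1 / (real m + 2), d / n, e / (6 * n * (\<bar>G\<bar> + 1))}"
  define \<delta> where "\<delta> = Min A"
  have "0 < e / (6 * n * (\<bar>G\<bar> + 1))"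
    using e \<open>n > 0\<close> by (intro divide_pos_pos mult_pos_pos) auto
  then have A: "finite A" "A \<noteq> {}" "\<forall>x\<in>A. 0 < x"
    unfolding A_def using d'_pos R \<open>n > 0\<close> C' by auto
  have le: "\<delta> \<le> x" if "x \<in> A" for x
    unfolding \<delta>_def by (rule Min_le[OF A(1) that])
  have \<delta>: "\<delta> > 0" "\<delta> \<le> 1" "\<delta> \<le> d' / (R + 1)" "\<delta> \<le> 1 / (real m + 2)" "\<delta> \<le> d / n"
      "\<delta> \<le> e / (6 * n * (\<bar>G\<bar> + 1))"
    using A Min_gr_iff[OF A(1,2), of 0] unfolding \<delta>_def[symmetric]
    by (blast, auto intro!: le simp: A_def)
  show ?thesis
  proof (rule that[OF \<delta>(1)])
    fix N :: nat and \<tau> c :: real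
    assume N: "N > 0" and \<tau>: "0 < \<tau>" "\<tau> < \<delta>" and h: "1 / real N < \<delta>" "1 / real N / \<tau> < \<delta>"
      and c: "\<bar>c\<bar> \<le> C" "ereal c \<le> discrete_min H (1 / real N) \<tau>"
    have "1 / real N < 1 / (real m + 2)" using h(1) \<delta>(4) by (rule less_le_trans)
    then have Nm: "Suc m < N" using N by (simp add: field_simps)
    have "1 / real N \<le> \<tau>"
    proof -
      have "1 / real N < \<delta> * \<tau>" using h(2) \<tau> by (subst (asm) pos_divide_less_eq) auto
      also have "\<dots> \<le> 1 * \<tau>" using \<delta>(2) \<tau> by (intro mult_right_mono) auto
      finally show ?thesis by simp
    qed
    have hd: "n * (1 / real N / \<tau>) \<le> d"
    proof -
      have "1 / real N / \<tau> \<le> d / n" using less_le_trans[OF h(2) \<delta>(5)] by (rule less_imp_le)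
      then show ?thesis using \<open>n > 0\<close> by (simp add: pos_le_divide_eq mult.commute)
    qed
    have hG: "n * (1 / real N / \<tau>) * \<bar>G\<bar> \<le> e / 6"
    proof -
      have "1 / real N / \<tau> \<le> e / (6 * n * (\<bar>G\<bar> + 1))" using less_le_trans[OF h(2) \<delta>(6)] by (rule less_imp_le)
      then have "1 / real N / \<tau> * (6 * n * (\<bar>G\<bar> + 1)) \<le> e"
        using \<open>n > 0\<close> by (subst (asm) pos_le_divide_eq) auto
      moreover have "1 / real N / \<tau> * (6 * n * \<bar>G\<bar>) \<le> 1 / real N / \<tau> * (6 * n * (\<bar>G\<bar> + 1))"
        using \<open>n > 0\<close> \<tau> by (intro mult_left_mono) auto
      ultimately show ?thesis by (simp add: mult_ac)
    qed
    obtain u :: "int ^ 'n \<Rightarrow> real" where per: "\<And>z l. u (z + int N *s l) = u z"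
      and step: "\<And>p q. u q \<le> u p + \<tau> * (step_cost H N \<tau> p q - c)"
      using discrete_potential[OF H N \<tau>(1) c(2)] by blast
    \<comment> \<open>Normalising at one point converts the oscillation bound into a sup bound, as
      the uniform kernel estimates require.\<close>
    define F where "F z = u z - u 0" for z
    have F: "\<bar>F z\<bar> \<le> 2 * (B + C)" for z
      unfolding F_def
      by (rule potential_oscillation[OF N \<tau>(1) _ _ per step _ c(1)])
        (use \<tau> \<delta> \<open>1 / real N \<le> \<tau>\<close> B in \<open>auto simp: n_def\<close>)
    have Fper: "F (z + int N *s l) = F z" for z l by (simp add: F_def per)
    define \<phi> where "\<phi> a = lattice_avg N m F (rep_torus a)" for a
    have "v \<bullet> torus_gradient \<phi> a \<le> lagrangian H a v - c + e" if nv: "norm v \<le> R" for a v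
    proof -
      obtain x where x: "to_torus x = a" using to_torus_rep by blast
      define g where "g = lattice_avg_gradient N m F x"
      have grad: "torus_gradient \<phi> a = g"
        unfolding x[symmetric] g_def \<phi>_def by (rule lattice_avg_C1(3))
      \<comment> \<open>The lattice displacement nearest below \<open>\<tau> v\<close>; its velocity
        \<open>v'\<close> differs from \<open>v\<close> by at most \<open>CARD('n)\<close> times
        h/\<open>\<tau>\<close>.\<close>
      define w where "w = (\<chi> k. \<lfloor>\<tau> * v $ k * real N\<rfloor>)"
      define y where "y = lattice_point N w"
      define v' where "v' = y /\<^sub>R \<tau>"
      have "\<bar>(y - \<tau> *\<^sub>R v) $ k\<bar> \<le> 1 / real N" for k
      proof -
        have "\<bar>real_of_int \<lfloor>\<tau> * v $ k * real N\<rfloor> - \<tau> * v $ k * real N\<bar> \<le> 1" by linarith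
        then have "\<bar>real_of_int \<lfloor>\<tau> * v $ k * real N\<rfloor> - \<tau> * v $ k * real N\<bar> / real N \<le> 1 / real N"
          using N by (intro divide_right_mono) auto
        moreover have "y $ k = real_of_int \<lfloor>\<tau> * v $ k * real N\<rfloor> / real N"
          by (simp only: y_def w_def lattice_point_nth vec_lambda_beta)
        then have "(y - \<tau> *\<^sub>R v) $ k = (real_of_int \<lfloor>\<tau> * v $ k * real N\<rfloor> - \<tau> * v $ k * real N) / real N"
          using N by (simp add: diff_divide_distrib)
        ultimately show ?thesis by simp
      qed
      then have y: "norm (y - \<tau> *\<^sub>R v) \<le> n * (1 / real N)"
        unfolding n_def by (rule norm_le_card_mult)
      have "v' - v = (y - \<tau> *\<^sub>R v) /\<^sub>R \<tau>"
        using \<tau> by (simp add: v'_def scaleR_diff_right)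
      then have "norm (v' - v) = norm (y - \<tau> *\<^sub>R v) / \<tau>"
        using \<tau> by (simp add: divide_inverse mult.commute)
      also have "\<dots> \<le> n * (1 / real N) / \<tau>" using y \<tau> by (intro divide_right_mono) auto
      finally have v': "norm (v' - v) \<le> d" using hd by simp
      have "norm v' \<le> norm v + norm (v' - v)" by (rule norm_triangle_sub)
      then have "norm v' \<le> R + 1" using nv v' C' by linarith
      moreover have yv: "y = \<tau> *\<^sub>R v'" using \<tau> by (simp add: v'_def)
      ultimately have ny: "norm y \<le> \<tau> * (R + 1)" using \<tau> by simp
      have "\<tau> * (R + 1) \<le> d'"
      proof -
        have "\<tau> \<le> d' / (R + 1)" using less_le_trans[OF \<tau>(2) \<delta>(3)] by (rule less_imp_le)
        then show ?thesis using R by (subst (asm) pos_le_divide_eq) auto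
      qed
      then have "norm y \<le> d'" using ny by linarith
      have "e' * norm y \<le> e' * (\<tau> * (R + 1))"
        using ny \<open>e' > 0\<close> by (intro mult_left_mono) auto
      also have "\<dots> = \<tau> * (e / 6)" using R by (simp add: e'_def field_simps)
      finally have low1: "lattice_avg N m F (x + y) - lattice_avg N m F x \<ge> y \<bullet> g - \<tau> * (e / 6)"
        using d'[where x = x and F = F, OF N F \<open>norm y \<le> d'\<close>] unfolding g_def by linarith
      have "\<bar>(y - \<tau> *\<^sub>R v) \<bullet> g\<bar> \<le> norm (y - \<tau> *\<^sub>R v) * norm g" by (rule Cauchy_Schwarz_ineq2)
      also have "\<dots> \<le> n * (1 / real N) * \<bar>G\<bar>"
        using y G[where x = x and F = F, OF N F] unfolding g_def by (intro mult_mono) (auto simp: \<open>n > 0\<close> less_imp_le)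
      also have "\<dots> = \<tau> * (n * (1 / real N / \<tau>) * \<bar>G\<bar>)" using \<tau> by simp
      also have "\<dots> \<le> \<tau> * (e / 6)" using hG \<tau> by (intro mult_left_mono) auto
      finally have low2: "y \<bullet> g \<ge> \<tau> * (v \<bullet> g) - \<tau> * (e / 6)"
        unfolding inner_diff_left inner_scaleR_left by linarith
      define S where "S z = (\<Sum>k\<in>UNIV. (sin (pi * (x $ k - real_of_int (z $ k) / real N)))\<^sup>2)" for z :: "int ^ 'n"
      have up: "F (z + w) \<le> F z + (\<tau> * (lagrangian H a v - c + e / 3) + \<tau> * C' * S z)" for z
      proof -
        have "step_cost H N \<tau> z (z + w) = lagrangian H (to_torus (lattice_point N z)) v'"
          unfolding step_cost_def v'_def y_def by (simp only: add_diff_cancel_left')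
        also have "\<dots> \<le> lagrangian H a v + e / 3 + C' * S z"
          using modulus[OF nv v', of "lattice_point N z" x] unfolding S_def x lattice_point_nth .
        finally have "\<tau> * (step_cost H N \<tau> z (z + w) - c) \<le> \<tau> * (lagrangian H a v + e / 3 + C' * S z - c)"
          using \<tau> by (intro mult_left_mono) auto
        then have "u (z + w) \<le> u z + \<tau> * (lagrangian H a v + e / 3 + C' * S z - c)"
          using step[of "z + w" z] by linarith
        then show ?thesis unfolding F_def by (simp add: algebra_simps)
      qed
      \<comment> \<open>All terms not involving \<open>F\<close> are constants or squared sines, so
        their averages are evaluated exactly.\<close>
      have "lattice_avg N m F (x + y) = lattice_avg N m (\<lambda>z. F (z + w)) x"
        unfolding y_def by (rule lattice_avg_shift[OF N Fper])
      also have "\<dots> \<le> lattice_avg N m (\<lambda>z. F z + (\<tau> * (lagrangian H a v - c + e / 3) + \<tau> * C' * S z)) x"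
        by (rule lattice_avg_mono) (rule up)
      also have "\<dots> = lattice_avg N m F x + (\<tau> * (lagrangian H a v - c + e / 3) + \<tau> * C' * (n / (2 * real m + 2)))"
        using lattice_avg_sin[OF Nm, of x] Nm
        by (simp only: lattice_avg_add lattice_avg_cmult lattice_avg_const[OF Suc_lessD[OF Nm]] S_def n_def)
      also have "\<dots> \<le> lattice_avg N m F x + (\<tau> * (lagrangian H a v - c + e / 3) + \<tau> * (e / 3))"
        using mult_left_mono[OF m, of \<tau>] \<tau> by (simp add: mult.assoc)
      finally have "\<tau> * (v \<bullet> g) \<le> \<tau> * (lagrangian H a v - c + e)"
        using low1 low2 by (simp add: algebra_simps)
      then show ?thesis unfolding grad using \<tau> by simp
    qed
    moreover have "torus_C1 \<phi>" unfolding \<phi>_def by (rule lattice_avg_C1(1))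
    ultimately show "\<exists>\<phi>. torus_C1 \<phi> \<and>
        (\<forall>a v. norm v \<le> R \<longrightarrow> v \<bullet> torus_gradient \<phi> a \<le> lagrangian H a v - c + e)" by blast
  qed
qed

lemma norm_le_of_inner_bound:
  fixes g :: "'a::real_inner"
  assumes "\<And>v. norm v \<le> 1 \<Longrightarrow> v \<bullet> g \<le> K" shows "norm g \<le> K"
proof (cases "g = 0")
  case True
  then show ?thesis using assms[of 0] by simp
next
  case False
  then have "sgn g \<bullet> g = norm g"
    by (simp add: sgn_div_norm dot_square_norm power2_eq_square)
  then show ?thesis using assms[of "sgn g"] by (simp add: norm_sgn)
qed

text \<open>The unit gap in the last clause is independent of \<open>e\<close>; it prevents measures
  of critical action from charging velocities beyond \<open>R\<close>.\<close>

definition almost_subsolution :: "('n::finite torus \<Rightarrow> real ^ 'n \<Rightarrow> real) \<Rightarrow> real \<Rightarrow> real \<Rightarrow> real \<Rightarrow> ('n torus \<Rightarrow> real) \<Rightarrow> bool" where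
  "almost_subsolution H R c e \<phi> \<longleftrightarrow> torus_C1 \<phi> \<and>
    (\<forall>a v. v \<bullet> torus_gradient \<phi> a \<le> lagrangian H a v - c + e) \<and>
    (\<forall>a v. norm v \<ge> R \<longrightarrow> v \<bullet> torus_gradient \<phi> a + 1 \<le> lagrangian H a v - c)"

text \<open>The radius is fixed before \<open>e\<close>: testing the ball inequality on unit
  velocities bounds the gradient by \<open>K\<close>, which depends neither on \<open>e\<close> nor
  on \<open>R\<close>. Superlinearity with slope \<open>K + 1\<close> then handles
  \<open>norm v \<ge> R\<close>.\<close>

lemma almost_subsolution_exists:
  fixes H :: "'n::finite torus \<Rightarrow> real ^ 'n \<Rightarrow> real"
  assumes H: "tonelli_hamiltonian H"
    and h: "\<And>n. mesh_size (h n)" and \<tau>: "\<And>n. 0 < \<tau> n"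
    and lim: "\<tau> \<longlonglongrightarrow> 0" "h \<longlonglongrightarrow> 0" "(\<lambda>n. h n / \<tau> n) \<longlonglongrightarrow> 0"
    and c: "\<And>n. ereal (c n) \<le> discrete_min H (h n) (\<tau> n)" "\<And>n. \<bar>c n\<bar> \<le> C"
  obtains R where "\<And>e. e > 0 \<Longrightarrow> \<forall>\<^sub>F n in sequentially. \<exists>\<phi>. almost_subsolution H R (c n) e \<phi>"
proof -
  obtain B where B: "\<And>a v. norm v \<le> 1 \<Longrightarrow> \<bar>lagrangian H a v\<bar> \<le> B"
    using lagrangian_bounded[OF H] by blast
  \<comment> \<open>Adds up the bounds \<open>B\<close> for the Lagrangian on the unit ball,
    \<open>C\<close> for \<open>- c n\<close>, and 1 for \<open>e1\<close>.\<close>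
  define K where "K = B + C + 1"
  obtain D where D: "\<And>a v. lagrangian H a v \<ge> (K + 1) * norm v - D"
    using lagrangian_superlinear[OF H] by blast
  \<comment> \<open>At least 1, to contain the unit ball; and for
    \<open>norm v \<ge> D + C + 1\<close> the surplus \<open>norm v - D - C\<close> yields the unit
    gap.\<close>
  define R where "R = max 1 (D + C + 1)"
  show ?thesis
  proof (rule that[of R])
    fix e :: real assume "e > 0"
    define e1 where "e1 = min e 1"
    obtain \<delta> where "\<delta> > 0" and \<delta>: "\<And>N \<tau> c. N > 0 \<Longrightarrow> 0 < \<tau> \<Longrightarrow> \<tau> < \<delta> \<Longrightarrow> 1 / real N < \<delta> \<Longrightarrow>
        1 / real N / \<tau> < \<delta> \<Longrightarrow> \<bar>c\<bar> \<le> C \<Longrightarrow> ereal c \<le> discrete_min H (1 / real N) \<tau> \<Longrightarrow>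
        \<exists>\<phi>. torus_C1 \<phi> \<and> (\<forall>a v. norm v \<le> R \<longrightarrow> v \<bullet> torus_gradient \<phi> a \<le> lagrangian H a v - c + e1)"
      by (rule almost_subsolution_on_ball[OF H, of e1 R C]) (use \<open>e > 0\<close> in \<open>auto simp: e1_def R_def\<close>)
    have "\<forall>\<^sub>F n in sequentially. \<tau> n < \<delta>" "\<forall>\<^sub>F n in sequentially. h n < \<delta>"
      "\<forall>\<^sub>F n in sequentially. h n / \<tau> n < \<delta>"
      using lim \<open>\<delta> > 0\<close> by (auto elim: order_tendstoD(2))
    then show "\<forall>\<^sub>F n in sequentially. \<exists>\<phi>. almost_subsolution H R (c n) e \<phi>"
    proof eventually_elim
      case (elim n)
      obtain N where N: "N > 0" "h n = 1 / real N" using h[of n] by (auto simp: mesh_size_def)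
      from \<delta>[OF N(1) \<tau>[of n] elim(1) elim(2,3)[unfolded N(2)] c(2)[of n] c(1)[of n, unfolded N(2)]]
      obtain \<phi> where \<phi>: "torus_C1 \<phi>"
        "\<And>a v. norm v \<le> R \<Longrightarrow> v \<bullet> torus_gradient \<phi> a \<le> lagrangian H a v - c n + e1" by blast
      have grad: "norm (torus_gradient \<phi> a) \<le> K" for a
      proof (rule norm_le_of_inner_bound)
        fix v :: "real ^ 'n" assume nv: "norm v \<le> 1"
        then have "v \<bullet> torus_gradient \<phi> a \<le> lagrangian H a v - c n + e1"
          by (intro \<phi>(2)) (simp add: R_def)
        then show "v \<bullet> torus_gradient \<phi> a \<le> K"
          using B[OF nv, of a] c(2)[of n] by (auto simp: K_def e1_def min_def split: if_splits)
      qed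
      have far: "v \<bullet> torus_gradient \<phi> a + 1 \<le> lagrangian H a v - c n" if "norm v \<ge> R" for a v
      proof -
        have "v \<bullet> torus_gradient \<phi> a \<le> norm v * norm (torus_gradient \<phi> a)" by (rule norm_cauchy_schwarz)
        also have "\<dots> \<le> norm v * K" using grad by (intro mult_left_mono) auto
        finally have "v \<bullet> torus_gradient \<phi> a \<le> K * norm v" by (simp add: mult.commute)
        moreover have "D + C + 1 \<le> norm v" using that by (simp add: R_def)
        moreover have "lagrangian H a v \<ge> K * norm v + norm v - D"
          using D[of v a] by (simp add: algebra_simps)
        ultimately show ?thesis using c(2)[of n] by linarith
      qed
      have "v \<bullet> torus_gradient \<phi> a \<le> lagrangian H a v - c n + e" for a v
      proof (cases "norm v \<le> R")
        case True
        from \<phi>(2)[OF this, of a] show ?thesis by (simp add: e1_def min_def split: if_splits)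
      next
        case False
        with far[of v a] \<open>e > 0\<close> show ?thesis by simp
      qed
      with \<phi>(1) far show ?case unfolding almost_subsolution_def by blast
    qed
  qed
qed

section \<open>Almost surely convergent representations\<close>

text \<open>The point of the Cantor set whose ternary digits are 2 on \<open>A\<close> and 0
  elsewhere.\<close>

definition cantor_code :: "nat set \<Rightarrow> real" where
  "cantor_code A = (\<Sum>k. indicat_real A k * (2 / 3 ^ (k + 1)))"

lemma cantor_weights_sums: "(\<lambda>i. 2 / 3 ^ (i + k + 1)) sums (1 / 3 ^ k :: real)"
proof -
  have "(\<lambda>i. (1/3::real) ^ i) sums (1 / (1 - 1/3))"
    by (rule geometric_sums) simp
  from sums_mult[OF this, of "2 / 3 ^ (k + 1)"] show ?thesis
    by (simp add: power_add power_divide field_simps)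
qed

lemma cantor_code_summable: "summable (\<lambda>k. indicat_real A k * (2 / 3 ^ (k + 1)))"
  by (rule summable_comparison_test'[OF sums_summable[OF cantor_weights_sums[of 0]], of 0])
    (auto simp: indicator_def)

lemma cantor_code_bounds: "0 \<le> cantor_code A" "cantor_code A \<le> 1"
proof -
  show "0 \<le> cantor_code A"
    unfolding cantor_code_def by (rule suminf_nonneg[OF cantor_code_summable]) simp
  have "cantor_code A \<le> (\<Sum>k. 2 / 3 ^ (k + 0 + 1))"
    unfolding cantor_code_def
    by (rule suminf_le[OF _ cantor_code_summable sums_summable[OF cantor_weights_sums]])
      (auto simp: indicator_def)
  then show "cantor_code A \<le> 1"
    using sums_unique[OF cantor_weights_sums[of 0]] by simp
qed

text \<open>At the first differing digit \<open>m\<close> the codes part by 2/3^(m+1), and all later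
  digits recover at most half of it. The gap left over is why ternary digits are used: with binary
  ones the tail could cancel it.\<close>

lemma cantor_code_separates:
  assumes less: "\<bar>cantor_code A - cantor_code B\<bar> < 1 / 3 ^ (k + 1)"
  shows "k \<in> A \<longleftrightarrow> k \<in> B"
proof (rule ccontr)
  assume differ: "\<not> ?thesis"
  define m where "m = (LEAST i. (i \<in> A) \<noteq> (i \<in> B))"
  have m: "(m \<in> A) \<noteq> (m \<in> B)"
    unfolding m_def by (rule LeastI[of "\<lambda>i. (i \<in> A) \<noteq> (i \<in> B)", OF differ])
  have "m \<le> k"
    unfolding m_def by (rule Least_le[of "\<lambda>i. (i \<in> A) \<noteq> (i \<in> B)", OF differ])
  have below: "(i \<in> A) = (i \<in> B)" if "i < m" for i
    using not_less_Least[OF that[unfolded m_def]] by blast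
  define D where "D i = (indicat_real A i - indicat_real B i) * (2 / 3 ^ (i + 1))" for i
  have Dsum: "summable D"
    unfolding D_def left_diff_distrib
    by (intro summable_diff cantor_code_summable)
  have "cantor_code A - cantor_code B = (\<Sum>i. D i)"
    unfolding cantor_code_def D_def left_diff_distrib
    by (rule suminf_diff[OF cantor_code_summable cantor_code_summable])
  also have "\<dots> = (\<Sum>i. D (i + Suc m)) + (\<Sum>i<Suc m. D i)"
    by (rule suminf_split_initial_segment[OF Dsum])
  also have "(\<Sum>i<Suc m. D i) = D m"
    using below by (simp add: D_def indicator_def)
  finally have eq: "cantor_code A - cantor_code B = (\<Sum>i. D (i + Suc m)) + D m" .
  have w: "(\<lambda>i. 2 / 3 ^ (i + Suc m + 1)) sums (1 / 3 ^ Suc m :: real)"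
    by (rule cantor_weights_sums)
  have "norm (\<Sum>i. D (i + Suc m)) \<le> (\<Sum>i. 2 / 3 ^ (i + Suc m + 1))"
    by (rule norm_suminf_le[OF _ sums_summable[OF w]])
      (auto simp: D_def indicator_def)
  also have "\<dots> = 1 / 3 ^ Suc m" by (rule sums_unique[OF w, symmetric])
  finally have tail: "\<bar>\<Sum>i. D (i + Suc m)\<bar> \<le> 1 / 3 ^ Suc m" by simp
  have "\<bar>D m\<bar> = 2 / 3 ^ Suc m"
    using m by (auto simp: D_def indicator_def)
  then have "\<bar>cantor_code A - cantor_code B\<bar> \<ge> 1 / 3 ^ Suc m"
    using eq tail by simp
  moreover have "(1 :: real) / 3 ^ (k + 1) \<le> 1 / 3 ^ Suc m"
    using \<open>m \<le> k\<close> by (intro divide_left_mono power_increasing) auto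
  ultimately show False using less by linarith
qed

text \<open>Every subset of a countable set is Borel, so decoding on countably many values is
  measurable whatever the regularity of the inverse code.\<close>

lemma countable_domain_measurable:
  fixes g :: "'a::t1_space \<Rightarrow> 'b"
  assumes "countable A" "c \<in> space N" "\<And>x. x \<in> A \<Longrightarrow> g x \<in> space N"
  shows "(\<lambda>x. if x \<in> A then g x else c) \<in> measurable borel N"
proof (rule measurableI)
  fix B assume "B \<in> sets N"
  have 1: "D \<in> sets borel" if "D \<subseteq> A" for D
    by (rule sets.countable) (use countable_subset[OF that assms(1)] in auto)
  have "(\<lambda>x. if x \<in> A then g x else c) -` B \<inter> space borel =
      A \<inter> g -` B \<union> (if c \<in> B then - A else {})"
    by (auto split: if_splits)
  also have "\<dots> \<in> sets borel"
    using 1[of "A \<inter> g -` B"] 1[of A] by auto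
  finally show "(\<lambda>x. if x \<in> A then g x else c) -` B \<inter> space borel \<in> sets borel" .
qed (use assms in auto)

text \<open>A bounded subsequence yields a cluster point. Each basic neighbourhood of it contains
  late terms, and membership in a fixed basic set is eventually constant because the codes are
  Cauchy; so all late terms lie in it. The limit of the codes is not assumed to be a code.\<close>

lemma coded_sequence_converges:
  fixes y :: "nat \<Rightarrow> 'a::euclidean_space"
  assumes basis: "topological_basis (range Bs)"
    and conv: "convergent (\<lambda>j. cantor_code {k. y j \<in> Bs k})"
    and bdd: "\<exists>\<^sub>F j in sequentially. norm (y j) \<le> R"
  shows "convergent y"
proof -
  obtain s :: "nat \<Rightarrow> nat" where s: "strict_mono s" "\<And>j. norm (y (s j)) \<le> R"
  proof -
    have "infinite {j. norm (y j) \<le> R}"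
      using bdd by (simp add: frequently_sequentially infinite_nat_iff_unbounded_le)
    from infinite_enumerate[OF this] show ?thesis using that by auto
  qed
  have "seq_compact (cball (0::'a) R)" by (rule compact_imp_seq_compact[OF compact_cball])
  then obtain a t where t: "strict_mono (t :: nat \<Rightarrow> nat)" "((y \<circ> s) \<circ> t) \<longlonglongrightarrow> a"
    using s(2) unfolding seq_compact_def by (metis comp_apply mem_cball_0)
  have "y \<longlonglongrightarrow> a"
  proof (rule topological_tendstoI)
    fix U :: "'a set" assume "open U" "a \<in> U"
    then obtain k where k: "a \<in> Bs k" "Bs k \<subseteq> U"
      using topological_basisE[OF basis, of U a] by (metis imageE)
    have "Cauchy (\<lambda>j. cantor_code {k. y j \<in> Bs k})"
      using conv by (simp add: Cauchy_convergent_iff)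
    then obtain N where N: "\<And>i j. i \<ge> N \<Longrightarrow> j \<ge> N \<Longrightarrow>
        dist (cantor_code {k. y i \<in> Bs k}) (cantor_code {k. y j \<in> Bs k}) < 1 / 3 ^ (k + 1)"
      using metric_CauchyD[of _ "1 / 3 ^ (k + 1)"] by (meson zero_less_divide_1_iff zero_less_numeral zero_less_power)
    have same: "y i \<in> Bs k \<longleftrightarrow> y j \<in> Bs k" if "i \<ge> N" "j \<ge> N" for i j
      using cantor_code_separates[OF N[OF that, unfolded dist_real_def]] by simp
    have "open (Bs k)" using basis by (simp add: topological_basis_open)
    then have "\<forall>\<^sub>F j in sequentially. ((y \<circ> s) \<circ> t) j \<in> Bs k"
      by (rule topological_tendstoD[OF t(2) _ k(1)])
    then obtain j where j: "j \<ge> N" "((y \<circ> s) \<circ> t) j \<in> Bs k"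
      using eventually_happens[OF eventually_conj[OF eventually_ge_at_top[of N]]]
      by (metis sequentially_bot)
    have "s (t j) \<ge> N"
      using j(1) seq_suble[OF s(1), of "t j"] seq_suble[OF t(1), of j] by linarith
    then have "y i \<in> Bs k" if "i \<ge> N" for i
      using same[OF that] j(2) by auto
    then show "\<forall>\<^sub>F j in sequentially. y j \<in> U"
      unfolding eventually_sequentially using k(2) by blast
  qed
  then show ?thesis by (rule convergentI)
qed

text \<open>Each point is coded by the basic open sets containing it. The coded laws live on [0,1],
  so they are tight, and the Skorohod variables are decoded on the countable supports. The moment
  bound excludes escape to infinity, which the codes alone would not detect.\<close>

lemma almost_sure_selection:
  fixes M :: "nat \<Rightarrow> 'a::euclidean_space measure"
  assumes prob: "\<And>j. prob_space (M j)" and sets: "\<And>j. sets (M j) = sets borel"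
    and A: "\<And>j. countable (A j)" "\<And>j. AE x in M j. x \<in> A j"
    and moment: "\<And>j. (\<integral>\<^sup>+x. ennreal (norm x) \<partial>M j) \<le> ennreal C"
  obtains \<Omega> :: "real measure" and r :: "nat \<Rightarrow> nat" and Y :: "nat \<Rightarrow> real \<Rightarrow> 'a" and Y0 :: "real \<Rightarrow> 'a"
  where "strict_mono r" "prob_space \<Omega>" "\<And>j. Y j \<in> borel_measurable \<Omega>" "Y0 \<in> borel_measurable \<Omega>"
    "\<And>j. distr \<Omega> borel (Y j) = M (r j)" "AE \<omega> in \<Omega>. (\<lambda>j. Y j \<omega>) \<longlonglongrightarrow> Y0 \<omega>"
proof -
  obtain \<B> :: "'a set set" where \<B>: "countable \<B>" "topological_basis \<B>"
    using ex_countable_basis by blast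
  have "\<B> \<noteq> {}"
    using \<B>(2) topological_basisE[of \<B> UNIV 0] by blast
  define Bs where "Bs = from_nat_into \<B>"
  have basis: "topological_basis (range Bs)"
    using \<B> \<open>\<B> \<noteq> {}\<close> by (simp add: Bs_def range_from_nat_into)
  have op: "open (Bs k)" for k using basis by (simp add: topological_basis_open)
  define f where "f x = cantor_code {k. x \<in> Bs k}" for x
  have f_eq: "f = (\<lambda>x. \<Sum>k. indicat_real (Bs k) x * (2 / 3 ^ (k + 1)))"
    by (simp add: f_def cantor_code_def fun_eq_iff indicator_def)
  have f_meas[measurable]: "f \<in> borel_measurable borel"
    unfolding f_eq using op by (intro borel_measurable_suminf borel_measurable_times borel_measurable_indicator) auto
  have f_bounds: "0 \<le> f x" "f x \<le> 1" for x
    using cantor_code_bounds by (auto simp: f_def)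
  have inj: "inj f"
  proof (rule injI, rule ccontr)
    fix x y assume "f x = f y" "x \<noteq> y"
    then obtain k where k: "x \<in> Bs k" "y \<notin> Bs k"
      using topological_basisE[OF basis, of "- {y}" x] by auto
    moreover have "k \<in> {k. x \<in> Bs k} \<longleftrightarrow> k \<in> {k. y \<in> Bs k}"
      by (rule cantor_code_separates) (use \<open>f x = f y\<close> in \<open>simp add: f_def\<close>)
    ultimately show False by simp
  qed
  have fM[measurable]: "f \<in> borel_measurable (M j)" for j
    using f_meas measurable_cong_sets[OF sets[of j] refl] by blast
  define m where "m j = distr (M j) borel f" for j
  interpret M: prob_space "M j" for j by (rule prob)
  have rd: "real_distribution (m j)" for j
    unfolding m_def by (rule M.real_distribution_distr) measurable
  \<comment> \<open>Tightness is phrased with half-open intervals, and code 0 is possible; hence the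
    left end -1.\<close>
  have mass: "measure (m j) {-1<..1} = 1" for j
  proof -
    have "-1 < f x" for x using f_bounds(1)[of x] by linarith
    then have "f -` {-1<..1} \<inter> space (M j) = space (M j)"
      using f_bounds(2) by auto
    then show ?thesis
      unfolding m_def by (subst measure_distr) (auto simp: M.prob_space)
  qed
  have "tight m"
    unfolding tight_def
  proof (intro conjI allI impI rd)
    fix e :: real assume "e > 0"
    then show "\<exists>a b. a < b \<and> (\<forall>n. 1 - e < measure (m n) {a<..b})"
      using mass by (intro exI[of _ "-1"] exI[of _ "1"]) simp
  qed
  from tight_imp_convergent_subsubsequence[OF this strict_mono_id]
  obtain r M0 where r: "strict_mono (r :: nat \<Rightarrow> nat)" "real_distribution M0"
    "weak_conv_m (\<lambda>j. m (r j)) M0" unfolding comp_def id_apply by blast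
  from Skorohod[OF rd r(2,3)] 
  obtain \<Omega> :: "real measure" and W :: "nat \<Rightarrow> real \<Rightarrow> real" and W0
    where W: "prob_space \<Omega>" "\<And>n. W n \<in> measurable \<Omega> borel"
    "\<And>n. distr \<Omega> borel (W n) = m (r n)"
    "\<And>x. x \<in> space \<Omega> \<Longrightarrow> (\<lambda>n. W n x) \<longlonglongrightarrow> W0 x"
    by blast
  note [measurable] = W(2) and [measurable_cong] = sets
  interpret \<Omega>: prob_space \<Omega> by (rule W(1))
  \<comment> \<open>The value 0 off the coded support is immaterial: \<open>W j\<close> almost
    surely takes values in the code of \<open>A (r j)\<close>.\<close>
  define g where "g j w = (if w \<in> f ` A (r j) then inv f w else 0)" for j w
  have g_meas[measurable]: "g j \<in> borel_measurable borel" for j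
    unfolding g_def using A by (intro countable_domain_measurable) auto
  have gf: "g j (f x) = x" if "x \<in> A (r j)" for j x
    using that inj by (simp add: g_def)
  define Y where "Y j \<omega> = g j (W j \<omega>)" for j \<omega>
  have Y_meas[measurable]: "Y j \<in> borel_measurable \<Omega>" for j
    unfolding Y_def by measurable
  have distrY: "distr \<Omega> borel (Y j) = M (r j)" for j
  proof -
    have "distr \<Omega> borel (Y j) = distr (distr \<Omega> borel (W j)) borel (g j)"
      unfolding Y_def by (subst distr_distr) (auto simp: comp_def)
    also have "\<dots> = distr (M (r j)) borel (\<lambda>x. g j (f x))"
      unfolding W(3) m_def by (subst distr_distr) (auto simp: comp_def)
    also have "\<dots> = distr (M (r j)) borel (\<lambda>x. x)"
    proof (rule distr_cong_AE[OF refl refl])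
      show "AE x in M (r j). g j (f x) = x"
        using A(2)[of "r j"] by eventually_elim (rule gf)
    qed measurable
    also have "\<dots> = M (r j)" by (rule distr_id2) (simp add: sets)
    finally show ?thesis .
  qed
  have "AE \<omega> in \<Omega>. W j \<omega> \<in> f ` A (r j)" for j
  proof -
    have [measurable]: "f ` A (r j) \<in> sets borel"
      by (rule sets.countable) (use A(1) in auto)
    have "AE x in M (r j). f x \<in> f ` A (r j)"
      using A(2)[of "r j"] by eventually_elim (rule imageI)
    then have "AE w in m (r j). w \<in> f ` A (r j)"
      unfolding m_def by (intro iffD2[OF AE_distr_iff]) measurable
    then show ?thesis
      unfolding W(3)[symmetric] by (rule AE_distrD[OF W(2)])
  qed
  then have ae1: "AE \<omega> in \<Omega>. \<forall>j. W j \<omega> \<in> f ` A (r j)"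
    by (simp add: AE_all_countable)
  \<comment> \<open>Fatou shows that the lower limit of the norms is almost surely finite. This
    makes infinitely many terms bounded by one radius, as \<open>coded_sequence_converges\<close>
    asks.\<close>
  have "(\<integral>\<^sup>+\<omega>. liminf (\<lambda>j. ennreal (norm (Y j \<omega>))) \<partial>\<Omega>)
      \<le> liminf (\<lambda>j. \<integral>\<^sup>+\<omega>. ennreal (norm (Y j \<omega>)) \<partial>\<Omega>)"
    by (rule nn_integral_liminf) measurable
  also have "\<dots> \<le> liminf (\<lambda>j::nat. ennreal C)"
  proof (intro Liminf_mono always_eventually allI)
    fix j
    have "(\<integral>\<^sup>+\<omega>. ennreal (norm (Y j \<omega>)) \<partial>\<Omega>) = (\<integral>\<^sup>+x. ennreal (norm x) \<partial>M (r j))"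
      unfolding distrY[symmetric] by (subst nn_integral_distr) auto
    then show "(\<integral>\<^sup>+\<omega>. ennreal (norm (Y j \<omega>)) \<partial>\<Omega>) \<le> ennreal C" using moment by simp
  qed
  also have "\<dots> < \<infinity>" by (simp add: Liminf_const)
  finally have "(\<integral>\<^sup>+\<omega>. liminf (\<lambda>j. ennreal (norm (Y j \<omega>))) \<partial>\<Omega>) \<noteq> \<infinity>" by simp
  then have ae2: "AE \<omega> in \<Omega>. liminf (\<lambda>j. ennreal (norm (Y j \<omega>))) \<noteq> \<infinity>"
    by (rule nn_integral_PInf_AE[rotated]) measurable
  have conv: "AE \<omega> in \<Omega>. convergent (\<lambda>j. Y j \<omega>)"
    using ae1 ae2
  proof (rule AE_mp[OF _ AE_mp[OF _ AE_I2]], intro impI)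
    fix \<omega> assume \<omega>: "\<omega> \<in> space \<Omega>" "liminf (\<lambda>j. ennreal (norm (Y j \<omega>))) \<noteq> \<infinity>"
      "\<forall>j. W j \<omega> \<in> f ` A (r j)"
    have "f (Y j \<omega>) = W j \<omega>" for j
      using \<omega>(3) gf[of _ j] unfolding Y_def by (metis imageE)
    then have c: "convergent (\<lambda>j. cantor_code {k. Y j \<omega> \<in> Bs k})"
      using W(4)[OF \<omega>(1)] by (auto simp: f_def convergent_def)
    obtain R where R: "liminf (\<lambda>j. ennreal (norm (Y j \<omega>))) < ennreal R" "R \<ge> 0"
    proof -
      obtain R0 where "liminf (\<lambda>j. ennreal (norm (Y j \<omega>))) = ennreal R0" "R0 \<ge> 0"
        using \<omega>(2) by (metis ennreal_cases infinity_ennreal_def)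
      then show ?thesis using that[of "R0 + 1"] by (simp add: ennreal_less_iff)
    qed
    have "\<exists>\<^sub>F j in sequentially. norm (Y j \<omega>) \<le> R"
    proof (rule ccontr)
      assume "\<not> ?thesis"
      then have "\<forall>\<^sub>F j in sequentially. ennreal R \<le> ennreal (norm (Y j \<omega>))"
        unfolding not_frequently by (auto elim!: eventually_mono intro!: ennreal_leI)
      then have "ennreal R \<le> liminf (\<lambda>j. ennreal (norm (Y j \<omega>)))"
        by (rule Liminf_bounded)
      then show False using R by simp
    qed
    then show "convergent (\<lambda>j. Y j \<omega>)"
      by (rule coded_sequence_converges[OF basis c])
  qed
  show ?thesis
  proof (rule that[OF r(1) W(1) Y_meas _ distrY])
    \<comment> \<open>The limit is taken of the decoded points themselves, since the limiting code
      \<open>W0\<close> may decode to nothing.\<close>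
    show "(\<lambda>\<omega>. lim (\<lambda>j. Y j \<omega>)) \<in> borel_measurable \<Omega>" by measurable
    show "AE \<omega> in \<Omega>. (\<lambda>j. Y j \<omega>) \<longlonglongrightarrow> lim (\<lambda>j. Y j \<omega>)"
      using conv by (simp add: convergent_LIMSEQ_iff)
  qed
qed

section \<open>Discrete measures as probability measures\<close>

lemma abs_summable_iff_summable_real:
  "Infinite_Set_Sum.abs_summable_on f A \<longleftrightarrow> (f summable_on A)" for f :: "'a \<Rightarrow> real"
  unfolding abs_summable_equivalent[symmetric] by (rule summable_on_iff_abs_summable_on_real[symmetric])

text \<open>A measure on steps rather than on phase space: the balance condition needs the end
  point, which the reconstruction forgets.\<close>

definition family_measure :: "real \<Rightarrow> ('n::finite) family \<Rightarrow> ((real ^ 'n) \<times> (real ^ 'n) \<times> (int ^ 'n)) measure" where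
  "family_measure h \<mu> = density (count_space (grid_steps h)) (\<lambda>s. ennreal (\<mu> s))"

text \<open>The position stays in Euclidean space so that \<open>almost_sure_selection\<close>
  applies; \<open>torus_proj\<close> passes to the torus afterwards.\<close>

definition phase_point :: "real \<Rightarrow> (real ^ 'n) \<times> (real ^ 'n) \<times> (int ^ 'n) \<Rightarrow> (real ^ 'n) \<times> (real ^ 'n::finite)" where
  "phase_point \<tau> = (\<lambda>(x, y, l). (x, velocity \<tau> x y l))"

definition torus_proj :: "(real ^ 'n) \<times> (real ^ 'n) \<Rightarrow> 'n torus \<times> (real ^ 'n::finite)" where
  "torus_proj = (\<lambda>(x, v). (to_torus x, v))"

lemma torus_proj_measurable [measurable]: "torus_proj \<in> measurable borel borel"
  unfolding torus_proj_def by (rule borel_measurable_to_torus)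

lemma continuous_on_torus_proj: "continuous_on UNIV torus_proj"
  unfolding torus_proj_def case_prod_unfold by (intro continuous_intros)

lemma reconstruction_eq:
  "reconstruction h \<tau> \<mu> = distr (distr (family_measure h \<mu>) borel (phase_point \<tau>)) borel torus_proj"
  unfolding reconstruction_def family_measure_def
  by (subst distr_distr[OF torus_proj_measurable])
    (auto simp: comp_def phase_point_def torus_proj_def case_prod_unfold)

lemma space_family_measure [simp]: "space (family_measure h \<mu>) = grid_steps h"
  by (simp add: family_measure_def)

lemma family_measure_measurable [measurable]: "f \<in> borel_measurable (family_measure h \<mu>)"
  by (simp add: family_measure_def)

lemma countable_int_vec [simp]: "countable (A :: (int ^ 'n::finite) set)"
proof -
  have "countable (UNIV :: (int ^ 'n) set)"
  proof (rule countable_image_inj_on)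
    have "countable (PiE (UNIV :: 'n set) (\<lambda>_. UNIV :: int set))"
      by (rule countable_PiE) auto
    then show "countable (vec_nth ` (UNIV :: (int ^ 'n) set))" by (rule countable_subset[rotated]) auto
    show "inj_on vec_nth (UNIV :: (int ^ 'n) set)" by (simp add: inj_on_def vec_nth_inject)
  qed
  then show ?thesis by (rule countable_subset[rotated]) simp
qed

lemma grid_norm_le:
  fixes x :: "real ^ 'n::finite"
  assumes "x \<in> grid h" "h \<ge> 0"
  shows "norm x \<le> real CARD('n)"
proof -
  have "\<bar>x $ k\<bar> \<le> 1" for k
    using assms unfolding grid_def by (smt (verit) mem_Collect_eq mult_nonneg_nonneg of_nat_0_le_iff)
  then show ?thesis using norm_le_card_mult[of x 1] by simp
qed

context
  fixes h :: real and \<mu> :: "('n::finite) family"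
  assumes h: "mesh_size h" and \<mu>: "\<mu> \<in> discrete_measures h"
begin

lemma family_nonneg: "s \<in> grid_steps h \<Longrightarrow> 0 \<le> \<mu> s"
  using \<mu> by (auto simp: discrete_measures_def)

lemma family_measure_integrable_iff:
  "integrable (family_measure h \<mu>) f \<longleftrightarrow> (\<lambda>s. f s * \<mu> s) summable_on grid_steps h"
proof -
  have "integrable (family_measure h \<mu>) f \<longleftrightarrow> integrable (count_space (grid_steps h)) (\<lambda>s. \<mu> s *\<^sub>R f s)"
    unfolding family_measure_def by (rule integrable_density) (auto simp: family_nonneg AE_count_space)
  also have "\<dots> \<longleftrightarrow> Infinite_Set_Sum.abs_summable_on (\<lambda>s. f s * \<mu> s) (grid_steps h)"
    by (simp add: abs_summable_on_def mult.commute)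
  also have "\<dots> \<longleftrightarrow> (\<lambda>s. f s * \<mu> s) summable_on grid_steps h"
    by (simp only: abs_summable_iff_summable_real)
  finally show ?thesis .
qed

lemma family_measure_integral:
  assumes "integrable (family_measure h \<mu>) f"
  shows "(\<integral>s. f s \<partial>family_measure h \<mu>) = (\<Sum>\<^sub>\<infinity>s\<in>grid_steps h. f s * \<mu> s)"
proof -
  have s: "Infinite_Set_Sum.abs_summable_on (\<lambda>s. f s * \<mu> s) (grid_steps h)"
    using assms unfolding family_measure_integrable_iff
    by (simp only: abs_summable_iff_summable_real)
  have "(\<integral>s. f s \<partial>family_measure h \<mu>) = (\<integral>s. \<mu> s *\<^sub>R f s \<partial>count_space (grid_steps h))"
    unfolding family_measure_def by (rule integral_density) (auto simp: family_nonneg AE_count_space)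
  also have "\<dots> = infsetsum (\<lambda>s. f s * \<mu> s) (grid_steps h)"
    by (simp add: infsetsum_def mult.commute)
  also have "\<dots> = (\<Sum>\<^sub>\<infinity>s\<in>grid_steps h. f s * \<mu> s)" by (rule infsetsum_infsum[OF s])
  finally show ?thesis .
qed

lemma family_sum: "(\<mu> has_sum 1) (grid_steps h)"
  using \<mu> by (simp add: discrete_measures_def)

lemma prob_space_family_measure: "prob_space (family_measure h \<mu>)"
proof
  have s: "Infinite_Set_Sum.abs_summable_on \<mu> (grid_steps h)"
    using has_sum_imp_summable[OF family_sum]
    by (simp only: abs_summable_iff_summable_real)
  have "emeasure (family_measure h \<mu>) (space (family_measure h \<mu>)) = (\<integral>\<^sup>+s. ennreal (\<mu> s) \<partial>count_space (grid_steps h))"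
    unfolding space_family_measure unfolding family_measure_def
    by (subst emeasure_density) (auto intro!: nn_integral_cong)
  also have "\<dots> = ennreal (infsetsum \<mu> (grid_steps h))"
    unfolding infsetsum_def using s
    by (intro nn_integral_eq_integral) (auto simp: abs_summable_on_def AE_count_space family_nonneg)
  also have "\<dots> = 1" by (simp add: infsetsum_infsum[OF s] infsumI[OF family_sum])
  finally show "emeasure (family_measure h \<mu>) (space (family_measure h \<mu>)) = 1" .
qed

text \<open>The discrete form of closedness: start and end point of a random step have the same law.
  Swapping the two grid coordinates turns one marginal sum into the other.\<close>

lemma family_measure_balanced:
  fixes f :: "real ^ 'n \<Rightarrow> real"
  shows "has_bochner_integral (family_measure h \<mu>) (\<lambda>(x, y, l). f y - f x) 0"
proof -
  interpret prob_space "family_measure h \<mu>" by (rule prob_space_family_measure)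
  have fin: "finite (grid h :: (real ^ 'n) set)" by (rule finite_grid[OF h])
  then obtain B where B: "\<And>x. x \<in> grid h \<Longrightarrow> \<bar>f x\<bar> \<le> B"
    using finite_imp_bounded[OF finite_imageI[OF fin, of f]] unfolding bounded_iff by auto
  have int1: "integrable (family_measure h \<mu>) (\<lambda>s. f (fst s))"
    by (rule integrable_const_bound[of _ B]) (auto simp: B intro!: AE_I2)
  have int2: "integrable (family_measure h \<mu>) (\<lambda>s. f (fst (snd s)))"
    by (rule integrable_const_bound[of _ B]) (auto simp: B intro!: AE_I2)
  have sum1: "(\<lambda>(x, b). f x * \<mu> (x, b)) summable_on grid h \<times> (grid h \<times> UNIV)"
    using int1 unfolding family_measure_integrable_iff by (simp add: case_prod_unfold)
  have sum2: "(\<lambda>(x, y, l). f y * \<mu> (x, y, l)) summable_on grid h \<times> (grid h \<times> UNIV)"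
    using int2 unfolding family_measure_integrable_iff by (simp add: case_prod_unfold)
  have bij: "bij_betw (\<lambda>(x, y, l). (y, x, l)) (grid h \<times> (grid h \<times> UNIV)) (grid h \<times> (grid h \<times> (UNIV :: (int ^ 'n) set)))"
    by (rule bij_betw_byWitness[where f' = "\<lambda>(x, y, l). (y, x, l)"]) auto
  have sum3: "(\<lambda>(y, b). f y * \<mu> (fst b, y, snd b)) summable_on grid h \<times> (grid h \<times> UNIV)"
    using summable_on_reindex_bij_betw[OF bij, of "\<lambda>(x, y, l). f y * \<mu> (x, y, l)"] sum2
    by (simp add: case_prod_unfold)
  have "(\<integral>s. f (fst (snd s)) \<partial>family_measure h \<mu>)
      = (\<Sum>\<^sub>\<infinity>(x, y, l)\<in>grid h \<times> (grid h \<times> UNIV). f y * \<mu> (x, y, l))"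
    by (subst family_measure_integral[OF int2]) (simp add: case_prod_unfold)
  also have "\<dots> = (\<Sum>\<^sub>\<infinity>(y, b)\<in>grid h \<times> (grid h \<times> UNIV). f y * \<mu> (fst b, y, snd b))"
    using infsum_reindex_bij_betw[OF bij, of "\<lambda>(x, y, l). f y * \<mu> (x, y, l)"]
    by (simp add: case_prod_unfold)
  also have "\<dots> = (\<Sum>\<^sub>\<infinity>y\<in>grid h. \<Sum>\<^sub>\<infinity>b\<in>grid h \<times> UNIV. f y * \<mu> (fst b, y, snd b))"
    by (rule infsum_Sigma'_banach[OF sum3, symmetric])
  also have "\<dots> = (\<Sum>\<^sub>\<infinity>x\<in>grid h. \<Sum>\<^sub>\<infinity>b\<in>grid h \<times> UNIV. f x * \<mu> (x, b))"
  proof (rule infsum_cong)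
    fix x :: "real ^ 'n" assume "x \<in> grid h"
    then have "(\<Sum>\<^sub>\<infinity>b\<in>grid h \<times> UNIV. \<mu> (x, b)) = (\<Sum>\<^sub>\<infinity>b\<in>grid h \<times> UNIV. \<mu> (fst b, x, snd b))"
      using \<mu> by (simp add: discrete_measures_def case_prod_unfold)
    then show "(\<Sum>\<^sub>\<infinity>b\<in>grid h \<times> UNIV. f x * \<mu> (fst b, x, snd b)) = (\<Sum>\<^sub>\<infinity>b\<in>grid h \<times> UNIV. f x * \<mu> (x, b))"
      by (simp add: infsum_cmult_right')
  qed
  also have "\<dots> = (\<Sum>\<^sub>\<infinity>(x, b)\<in>grid h \<times> (grid h \<times> UNIV). f x * \<mu> (x, b))"
    by (rule infsum_Sigma'_banach[OF sum1])
  also have "\<dots> = (\<integral>s. f (fst s) \<partial>family_measure h \<mu>)"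
    by (subst family_measure_integral[OF int1]) (simp add: case_prod_unfold)
  finally have "(\<integral>s. f (fst (snd s)) - f (fst s) \<partial>family_measure h \<mu>) = 0"
    using int1 int2 by simp
  then show ?thesis
    using Bochner_Integration.integrable_diff[OF int2 int1]
    by (simp add: has_bochner_integral_iff case_prod_unfold)
qed

text \<open>A finite bound excludes the value \<open>\<infinity>\<close>, hence the non-summable
  case of \<open>discrete_action\<close>.\<close>

lemma discrete_action_le:
  assumes "discrete_action H h \<tau> \<mu> \<le> ereal b"
  shows "integrable (family_measure h \<mu>) (step_lagrangian H \<tau>)"
    "(\<integral>s. step_lagrangian H \<tau> s \<partial>family_measure h \<mu>) \<le> b"
proof -
  let ?f = "\<lambda>(x, y, l). lagrangian H (to_torus x) (velocity \<tau> x y l) * \<mu> (x, y, l)"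
  have sum: "?f summable_on grid_steps h" and le: "infsum ?f (grid_steps h) \<le> b"
    using assms unfolding discrete_action_def Let_def by (auto split: if_splits)
  show int: "integrable (family_measure h \<mu>) (step_lagrangian H \<tau>)"
    unfolding family_measure_integrable_iff using sum by (simp add: case_prod_unfold)
  show "(\<integral>s. step_lagrangian H \<tau> s \<partial>family_measure h \<mu>) \<le> b"
    unfolding family_measure_integral[OF int] using le by (simp add: case_prod_unfold)
qed

lemma discrete_action_lower_bound:
  assumes "\<And>a v. lagrangian H a v \<ge> - B"
  shows "discrete_action H h \<tau> \<mu> \<ge> ereal (- B)"
proof (cases "discrete_action H h \<tau> \<mu> = \<infinity>")
  case False
  interpret prob_space "family_measure h \<mu>" by (rule prob_space_family_measure)
  let ?f = "step_lagrangian H \<tau>"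
  from False have eq: "discrete_action H h \<tau> \<mu> = ereal (\<Sum>\<^sub>\<infinity>s\<in>grid_steps h. ?f s * \<mu> s)"
    by (auto simp: discrete_action_def Let_def case_prod_unfold split: if_splits)
  note int = discrete_action_le(1)[OF eq_refl[OF eq]]
  have "(\<integral>s. - B \<partial>family_measure h \<mu>) \<le> (\<integral>s. ?f s \<partial>family_measure h \<mu>)"
    by (rule integral_mono[OF _ int]) (auto simp: assms case_prod_unfold)
  then show ?thesis
    unfolding eq family_measure_integral[OF int] by (simp add: prob_space[unfolded space_family_measure])
qed simp

end

section \<open>Passage to the limit: lower semicontinuity and closedness\<close>

lemma fatou_integral_le:
  fixes f :: "nat \<Rightarrow> 'a \<Rightarrow> real"
  assumes "prob_space M"
    and int: "\<And>i. integrable M (f i)" and f0: "f0 \<in> borel_measurable M"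
    and lower: "\<And>i x. f i x \<ge> - B"
    and conv: "AE x in M. (\<lambda>i. f i x) \<longlonglongrightarrow> f0 x"
    and le: "\<And>i. (\<integral>x. f i x \<partial>M) \<le> a i" and a: "a \<longlonglongrightarrow> a0"
  shows "integrable M f0" "(\<integral>x. f0 x \<partial>M) \<le> a0"
proof -
  interpret prob_space M by fact
  note [measurable] = f0 borel_measurable_integrable[OF int]
  have lower0: "AE x in M. f0 x + B \<ge> 0"
    using conv
  proof eventually_elim
    case (elim x)
    have "- B \<le> f0 x" by (rule LIMSEQ_le_const[OF elim]) (use lower in auto)
    then show ?case by simp
  qed
  \<comment> \<open>The shift by \<open>B\<close> makes everything nonnegative, so Fatou applies
    without prior integrability of the limit.\<close>
  have "(\<integral>\<^sup>+x. ennreal (f0 x + B) \<partial>M) = (\<integral>\<^sup>+x. liminf (\<lambda>i. ennreal (f i x + B)) \<partial>M)"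
  proof (rule nn_integral_cong_AE)
    show "AE x in M. ennreal (f0 x + B) = liminf (\<lambda>i. ennreal (f i x + B))"
      using conv
    proof eventually_elim
      case (elim x)
      have "(\<lambda>i. ennreal (f i x + B)) \<longlonglongrightarrow> ennreal (f0 x + B)"
        by (intro tendsto_ennrealI tendsto_intros elim)
      then show ?case by (intro lim_imp_Liminf[symmetric]) auto
    qed
  qed
  also have "\<dots> \<le> liminf (\<lambda>i. \<integral>\<^sup>+x. ennreal (f i x + B) \<partial>M)"
    by (rule nn_integral_liminf) measurable
  also have "\<dots> \<le> liminf (\<lambda>i. ennreal (a i + B))"
  proof (intro Liminf_mono always_eventually allI)
    fix i
    have "f i x + B \<ge> 0" for x using lower[of i x] by linarith
    then have "(\<integral>\<^sup>+x. ennreal (f i x + B) \<partial>M) = ennreal (\<integral>x. f i x + B \<partial>M)"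
      using int by (intro nn_integral_eq_integral) auto
    also have "(\<integral>x. f i x + B \<partial>M) = (\<integral>x. f i x \<partial>M) + B"
      using int by (simp add: prob_space)
    finally show "(\<integral>\<^sup>+x. ennreal (f i x + B) \<partial>M) \<le> ennreal (a i + B)"
      using le[of i] by (simp add: ennreal_leI)
  qed
  also have "liminf (\<lambda>i. ennreal (a i + B)) = ennreal (a0 + B)"
    by (intro lim_imp_Liminf tendsto_ennrealI tendsto_intros a) simp
  finally have bound: "(\<integral>\<^sup>+x. ennreal (f0 x + B) \<partial>M) \<le> ennreal (a0 + B)" .
  then have "(\<integral>\<^sup>+x. ennreal (f0 x + B) \<partial>M) < \<infinity>"
    using le_less_trans by (metis ennreal_less_top infinity_ennreal_def)
  then have int1: "integrable M (\<lambda>x. f0 x + B)"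
    using lower0 by (intro integrableI_nonneg) auto
  from Bochner_Integration.integrable_diff[OF this integrable_const[of B]]
  show int0: "integrable M f0" by simp
  have "- B \<le> a i" for i
  proof -
    have "(\<integral>x. - B \<partial>M) \<le> (\<integral>x. f i x \<partial>M)" by (rule integral_mono[OF _ int]) (use lower in auto)
    then show ?thesis using le[of i] by (simp add: prob_space)
  qed
  \<comment> \<open>\<open>ennreal\<close> truncates negative numbers to 0, so the bound can be read
    back in the reals only when its right side is nonnegative.\<close>
  then have "a0 + B \<ge> 0" using LIMSEQ_le_const[OF a, of "- B"] by auto
  have "ennreal (\<integral>x. f0 x + B \<partial>M) \<le> ennreal (a0 + B)"
    using bound nn_integral_eq_integral[OF int1 lower0] by simp
  then have "(\<integral>x. f0 x + B \<partial>M) \<le> a0 + B"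
    using \<open>a0 + B \<ge> 0\<close> by (simp add: ennreal_le_iff)
  then show "(\<integral>x. f0 x \<partial>M) \<le> a0" using int0 by (simp add: prob_space)
qed

text \<open>Base points and directions move along with the step size; differentiability uniform in
  the base point absorbs this.\<close>

lemma torus_C1_difference_quotient:
  fixes \<phi> :: "'n::finite torus \<Rightarrow> real"
  assumes \<phi>: "torus_C1 \<phi>" and x: "x \<longlonglongrightarrow> x0" and v: "v \<longlonglongrightarrow> v0"
    and t: "t \<longlonglongrightarrow> 0" "\<And>i::nat. t i > 0"
  shows "(\<lambda>i. (\<phi> (to_torus (x i + t i *\<^sub>R v i)) - \<phi> (to_torus (x i))) / t i)
    \<longlonglongrightarrow> v0 \<bullet> torus_gradient \<phi> (to_torus x0)"
proof -
  define g where "g x = torus_gradient \<phi> (to_torus x)" for x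
  have "(\<lambda>i. g (x i)) \<longlonglongrightarrow> g x0"
    unfolding g_def by (rule continuous_on_tendsto_compose[OF torus_gradient_lift_continuous[OF \<phi>] x]) auto
  then have lim: "(\<lambda>i. v i \<bullet> g (x i)) \<longlonglongrightarrow> v0 \<bullet> g x0" by (intro tendsto_inner v)
  have tv: "(\<lambda>i. t i * norm (v i)) \<longlonglongrightarrow> 0"
    using tendsto_mult[OF t(1) tendsto_norm[OF v]] by simp
  define q where "q i = (\<phi> (to_torus (x i + t i *\<^sub>R v i)) - \<phi> (to_torus (x i))) / t i - v i \<bullet> g (x i)" for i
  have "q \<longlonglongrightarrow> 0"
  proof (rule tendstoI)
    fix e :: real assume "e > 0"
    define e' where "e' = e / (norm v0 + 1)"
    have "norm v0 + 1 > 0" by (smt (verit) norm_ge_zero)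
    then have "e' > 0" using \<open>e > 0\<close> by (simp add: e'_def)
    obtain d where "d > 0" and d: "\<And>x y. norm y \<le> d \<Longrightarrow>
        \<bar>\<phi> (to_torus (x + y)) - \<phi> (to_torus x) - y \<bullet> g x\<bar> \<le> e' * norm y"
      using torus_C1_uniformly_differentiable[OF \<phi> \<open>e' > 0\<close>] unfolding g_def by blast
    have "\<forall>\<^sub>F i in sequentially. t i * norm (v i) < d" using order_tendstoD(2)[OF tv \<open>d > 0\<close>] .
    moreover have "\<forall>\<^sub>F i in sequentially. norm (v i) < norm v0 + 1"
      by (rule order_tendstoD(2)[OF tendsto_norm[OF v]]) simp
    ultimately show "\<forall>\<^sub>F i in sequentially. dist (q i) 0 < e"
    proof eventually_elim
      case (elim i)
      have ti: "t i > 0" by (rule t)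
      have "\<bar>\<phi> (to_torus (x i + t i *\<^sub>R v i)) - \<phi> (to_torus (x i)) - (t i *\<^sub>R v i) \<bullet> g (x i)\<bar> \<le> e' * norm (t i *\<^sub>R v i)"
        by (rule d) (use elim ti in simp)
      moreover have "\<phi> (to_torus (x i + t i *\<^sub>R v i)) - \<phi> (to_torus (x i)) - (t i *\<^sub>R v i) \<bullet> g (x i) = t i * q i"
        using ti by (simp add: q_def field_simps)
      ultimately have "t i * \<bar>q i\<bar> \<le> t i * (e' * norm (v i))"
        using ti by (simp add: abs_mult mult_ac)
      then have "\<bar>q i\<bar> \<le> e' * norm (v i)" using ti by simp
      also have "\<dots> < e' * (norm v0 + 1)" using elim \<open>e' > 0\<close> by (intro mult_strict_left_mono) auto
      also have "\<dots> = e" using \<open>norm v0 + 1 > 0\<close> by (simp add: e'_def)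
      finally show ?case by simp
    qed
  qed
  from tendsto_add[OF this lim] show ?thesis by (simp add: q_def g_def)
qed

text \<open>Balance says that the difference quotient of a test function along a step has mean zero.
  Almost surely it converges to v . D phi. Adding a small multiple of the Lagrangian makes it
  bounded below, Fatou gives one inequality, and both signs give closedness.\<close>

lemma closed_limit:
  fixes H :: "'n::finite torus \<Rightarrow> real ^ 'n \<Rightarrow> real"
  assumes H: "tonelli_hamiltonian H"
    and h: "\<And>n. mesh_size (h n)" and \<tau>: "\<And>n. 0 < \<tau> n" "\<tau> \<longlonglongrightarrow> 0"
    and \<mu>: "\<And>n::nat. \<mu> n \<in> discrete_measures (h n)"
    and act: "\<And>n. discrete_action H (h n) (\<tau> n) (\<mu> n) \<le> ereal (b n)" and b: "b \<longlonglongrightarrow> c"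
  obtains \<Omega> :: "real measure" and r :: "nat \<Rightarrow> nat" and X X0
  where "strict_mono r" "prob_space \<Omega>" "\<And>i::nat. X i \<in> borel_measurable \<Omega>" "X0 \<in> borel_measurable \<Omega>"
    "\<And>i. distr \<Omega> borel (X i) = reconstruction (h (r i)) (\<tau> (r i)) (\<mu> (r i))"
    "AE \<omega> in \<Omega>. (\<lambda>i. X i \<omega>) \<longlonglongrightarrow> X0 \<omega>"
    "closed_measure (distr \<Omega> borel X0)" "action H (distr \<Omega> borel X0) \<le> ereal c"
proof -
  define L where "L = (\<lambda>(x, v). lagrangian H (to_torus x) v)"
  define P where "P n = family_measure (h n) (\<mu> n)" for n
  define M where "M n = distr (P n) borel (phase_point (\<tau> n))" for n
  define d where "d = real CARD('n)"
  have L_cont: "continuous_on UNIV L"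
    using continuous_on_compose2[OF lagrangian_continuous[OF H] continuous_on_torus_proj]
    by (simp add: L_def torus_proj_def case_prod_unfold)
  have L_meas[measurable]: "L \<in> borel_measurable borel"
    by (rule borel_measurable_continuous_onI[OF L_cont])
  have hpos: "h n \<ge> 0" for n using h[of n] by (auto simp: mesh_size_def)
  interpret P: prob_space "P n" for n
    unfolding P_def by (rule prob_space_family_measure[OF h \<mu>])
  have P_meas[measurable]: "f \<in> measurable (P n) borel" for f :: "_ \<Rightarrow> 'b::topological_space" and n
    by (simp add: P_def family_measure_def)
  have probM: "prob_space (M n)" for n
    unfolding M_def by (rule P.prob_space_distr) measurable
  have setsM: "sets (M n) = sets borel" for n by (simp add: M_def)
  note actL = discrete_action_le[OF h \<mu> act]
  have L_phase: "(\<lambda>s. L (phase_point (\<tau> n) s)) =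
      (\<lambda>(x, y, l). lagrangian H (to_torus x) (velocity (\<tau> n) x y l))" for n
    by (auto simp: L_def phase_point_def)
  have "integrable (M n) L \<longleftrightarrow> integrable (P n) (\<lambda>s. L (phase_point (\<tau> n) s))" for n
    unfolding M_def by (rule integrable_distr_eq) measurable
  then have L_int: "integrable (M n) L" for n
    using actL(1) unfolding L_phase P_def by blast
  have "(\<integral>z. L z \<partial>M n) = (\<integral>s. L (phase_point (\<tau> n) s) \<partial>P n)" for n
    unfolding M_def by (rule integral_distr) measurable
  then have L_le: "(\<integral>z. L z \<partial>M n) \<le> b n" for n
    using actL(2) unfolding L_phase P_def by simp
  obtain D where D: "\<And>a v. lagrangian H a v \<ge> 1 * norm v - D"
    using lagrangian_superlinear[OF H] by blast
  obtain b0 where b0: "\<And>n. b n \<le> b0"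
    using convergent_imp_bounded[of b] b unfolding convergent_def bounded_iff
    by (metis (no_types, lifting) abs_le_D1 rangeI real_norm_def convergentI)
  have cnt: "countable (phase_point (\<tau> n) ` grid_steps (h n))" for n
    using finite_grid[OF h] by (intro countable_image countable_SIGMA) (auto intro: countable_finite)
  have supp: "AE z in M n. z \<in> phase_point (\<tau> n) ` grid_steps (h n)" for n
  proof -
    have [measurable]: "phase_point (\<tau> n) ` grid_steps (h n) \<in> sets borel"
      by (rule sets.countable[OF _ cnt]) auto
    show ?thesis unfolding M_def
      by (subst AE_distr_iff) (auto simp: P_def intro!: AE_I2)
  qed
  \<comment> \<open>Superlinearity with slope 1 turns the action bound into a bound on first moments
    of the velocity; positions are bounded anyway.\<close>
  have moment: "(\<integral>\<^sup>+z. ennreal (norm z) \<partial>M n) \<le> ennreal (d + D + b0)" for n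
  proof -
    interpret M: prob_space "M n" by (rule probM)
    have "AE z in M n. norm z \<le> d + (L z + D)"
      using supp[of n]
    proof eventually_elim
      case (elim z)
      then obtain x v where z: "z = (x, v)" "x \<in> grid (h n)" by (auto simp: phase_point_def)
      have "norm z \<le> norm x + norm v" unfolding z by (rule norm_Pair_le)
      also have "norm x \<le> d" unfolding d_def by (rule grid_norm_le[OF z(2) hpos])
      also have "norm v \<le> L z + D" using D[of v "to_torus x"] by (simp add: L_def z)
      finally show ?case by simp
    qed
    then have "(\<integral>\<^sup>+z. ennreal (norm z) \<partial>M n) \<le> (\<integral>\<^sup>+z. ennreal (d + (L z + D)) \<partial>M n)"
      by (intro nn_integral_mono_AE) (auto elim!: eventually_mono intro: ennreal_leI)
    also have "\<dots> = ennreal (\<integral>z. d + (L z + D) \<partial>M n)"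
    proof (rule nn_integral_eq_integral)
      show "AE z in M n. 0 \<le> d + (L z + D)"
        using \<open>AE z in M n. norm z \<le> d + (L z + D)\<close>
        by eventually_elim (rule order_trans[OF norm_ge_zero])
    qed (use L_int in simp)
    also have "(\<integral>z. d + (L z + D) \<partial>M n) = d + ((\<integral>z. L z \<partial>M n) + D)"
      using L_int[of n] by (simp add: M.prob_space)
    also have "ennreal \<dots> \<le> ennreal (d + D + b0)"
      using L_le[of n] b0[of n] by (intro ennreal_leI) simp
    finally show ?thesis .
  qed
  obtain \<Omega> :: "real measure" and r Y Y0 where r: "strict_mono r" and \<Omega>: "prob_space \<Omega>"
    and Y: "\<And>i. Y i \<in> borel_measurable \<Omega>" "Y0 \<in> borel_measurable \<Omega>"
    and law: "\<And>i. distr \<Omega> borel (Y i) = M (r i)" and conv: "AE \<omega> in \<Omega>. (\<lambda>i. Y i \<omega>) \<longlonglongrightarrow> Y0 \<omega>"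
    by (rule almost_sure_selection[OF probM setsM cnt supp moment]) (rule that, assumption+)
  note [measurable] = Y
  interpret \<Omega>: prob_space \<Omega> by (rule \<Omega>)
  have br: "(\<lambda>i. b (r i)) \<longlonglongrightarrow> c" and tr: "(\<lambda>i. \<tau> (r i)) \<longlonglongrightarrow> 0"
    using LIMSEQ_subseq_LIMSEQ[OF b r] LIMSEQ_subseq_LIMSEQ[OF \<tau>(2) r] by (simp_all add: comp_def)
  have transfer: "integrable \<Omega> (\<lambda>\<omega>. f (Y i \<omega>))" "(\<integral>\<omega>. f (Y i \<omega>) \<partial>\<Omega>) = (\<integral>z. f z \<partial>M (r i))"
    if "integrable (M (r i)) f" for f :: "_ \<Rightarrow> real" and i
  proof -
    have [measurable]: "f \<in> borel_measurable borel"
      using borel_measurable_integrable[OF that] measurable_cong_sets[OF setsM refl] by blast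
    show "integrable \<Omega> (\<lambda>\<omega>. f (Y i \<omega>))"
      using that unfolding law[symmetric] by (subst (asm) integrable_distr_eq) auto
    show "(\<integral>\<omega>. f (Y i \<omega>) \<partial>\<Omega>) = (\<integral>z. f z \<partial>M (r i))"
      unfolding law[symmetric] by (subst integral_distr) auto
  qed
  have convL: "AE \<omega> in \<Omega>. (\<lambda>i. L (Y i \<omega>)) \<longlonglongrightarrow> L (Y0 \<omega>)"
    using conv by eventually_elim (rule continuous_on_tendsto_compose[OF L_cont], auto)
  have L_lower: "L z \<ge> - D" for z
    using D[of "snd z" "to_torus (fst z)"] by (simp add: L_def case_prod_unfold) (smt (verit) norm_ge_zero)
  have le_b: "(\<integral>\<omega>. L (Y i \<omega>) \<partial>\<Omega>) \<le> b (r i)" for i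
    unfolding transfer(2)[OF L_int] by (rule L_le)
  have L0_meas: "(\<lambda>\<omega>. L (Y0 \<omega>)) \<in> borel_measurable \<Omega>" by measurable
  note L0 = fatou_integral_le[OF \<Omega> transfer(1)[OF L_int] L0_meas L_lower convL le_b br]
  define X where "X i \<omega> = torus_proj (Y i \<omega>)" for i \<omega>
  define X0 where "X0 \<omega> = torus_proj (Y0 \<omega>)" for \<omega>
  have X_meas[measurable]: "X i \<in> borel_measurable \<Omega>" "X0 \<in> borel_measurable \<Omega>" for i
    unfolding X_def X0_def by measurable
  show ?thesis
  proof (rule that[OF r \<Omega> X_meas])
    fix i
    show "distr \<Omega> borel (X i) = reconstruction (h (r i)) (\<tau> (r i)) (\<mu> (r i))"
      unfolding reconstruction_eq P_def[symmetric] M_def[symmetric] law[symmetric] X_def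
      by (subst distr_distr) (auto simp: comp_def)
  next
    show "AE \<omega> in \<Omega>. (\<lambda>i. X i \<omega>) \<longlonglongrightarrow> X0 \<omega>"
      using conv unfolding X_def X0_def
      by eventually_elim (rule continuous_on_tendsto_compose[OF continuous_on_torus_proj], auto)
  next
    have "integrable (distr \<Omega> borel X0) (\<lambda>(x, v). lagrangian H x v)"
      using L0(1) lagrangian_measurable[OF H] 
      by (subst integrable_distr_eq) (auto simp: L_def X0_def torus_proj_def case_prod_unfold)
    moreover have "(\<integral>(x, v). lagrangian H x v \<partial>distr \<Omega> borel X0) = (\<integral>\<omega>. L (Y0 \<omega>) \<partial>\<Omega>)"
      using lagrangian_measurable[OF H]
      by (subst integral_distr) (auto simp: L_def X0_def torus_proj_def case_prod_unfold)
    ultimately show "action H (distr \<Omega> borel X0) \<le> ereal c"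
      using L0(2) by (simp add: action_def)
  next
    show "closed_measure (distr \<Omega> borel X0)"
      unfolding closed_measure_def
    proof (intro conjI allI impI)
      show "prob_space (distr \<Omega> borel X0)" by (rule \<Omega>.prob_space_distr) measurable
      show "sets (distr \<Omega> borel X0) = sets borel" by simp
      fix \<phi> :: "'n torus \<Rightarrow> real" assume \<phi>: "torus_C1 \<phi>"
      obtain G where G: "G \<ge> 0" "\<And>a. norm (torus_gradient \<phi> a) \<le> G"
        using torus_gradient_bounded[OF \<phi>] by blast
      define g0 where "g0 = (\<lambda>(x, v). v \<bullet> torus_gradient \<phi> (to_torus x))"
      define q where "q t = (\<lambda>(x, v). (\<phi> (to_torus (x + t *\<^sub>R v)) - \<phi> (to_torus x)) / t)" for t :: real
      have \<phi>_cont: "continuous_on UNIV (\<lambda>x. \<phi> (to_torus x))"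
        using has_derivative_continuous[OF torus_C1_has_derivative[OF \<phi>]] continuous_at_imp_continuous_on by blast
      have grad_cont: "continuous_on UNIV (\<lambda>(a, v). v \<bullet> torus_gradient \<phi> a)"
        unfolding case_prod_unfold
        by (intro continuous_intros continuous_on_compose2[OF torus_gradient_continuous[OF \<phi>]]) auto
      have grad_meas: "(\<lambda>(a, v). v \<bullet> torus_gradient \<phi> a) \<in> borel_measurable borel"
        by (rule borel_measurable_continuous_onI[OF grad_cont])
      have g0_proj: "g0 z = (case torus_proj z of (a, v) \<Rightarrow> v \<bullet> torus_gradient \<phi> a)" for z
        by (simp add: g0_def torus_proj_def case_prod_unfold)
      have g0_meas[measurable]: "g0 \<in> borel_measurable borel"
        unfolding g0_proj[abs_def] using grad_meas by measurable
      have q_meas[measurable]: "q t \<in> borel_measurable borel" for t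
        unfolding q_def case_prod_unfold divide_inverse
        by (intro borel_measurable_continuous_onI continuous_intros continuous_on_compose2[OF \<phi>_cont]) auto
      have q_bound: "\<bar>q t (x, v)\<bar> \<le> G * norm v" if "t > 0" for t x v
        using torus_C1_lipschitz[OF \<phi> G(2), of x "t *\<^sub>R v"] that
        by (simp add: q_def field_simps abs_mult)
      \<comment> \<open>Following the velocity for one time step leads to \<open>y\<close> plus an
        integer vector, so on the torus the quotient is an end-point difference over
        \<open>\<tau> n\<close>.\<close>
      have q_zero: "has_bochner_integral (M n) (q (\<tau> n)) 0" for n
        unfolding M_def
      proof (rule has_bochner_integral_distr)
        have "q (\<tau> n) (phase_point (\<tau> n) (x, y, l)) = (\<phi> (to_torus y) - \<phi> (to_torus x)) / \<tau> n" for x y l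
        proof -
          have "x + \<tau> n *\<^sub>R velocity (\<tau> n) x y l = y + int_vec l"
            using \<tau>(1)[of n] by (simp add: velocity_def)
          then show ?thesis by (simp add: q_def phase_point_def)
        qed
        then have "(\<lambda>s. q (\<tau> n) (phase_point (\<tau> n) s)) = (\<lambda>s. (case s of (x, y, l) \<Rightarrow> \<phi> (to_torus y) - \<phi> (to_torus x)) / \<tau> n)"
          by auto
        moreover have "has_bochner_integral (P n) (\<lambda>s. (case s of (x, y, l) \<Rightarrow> \<phi> (to_torus y) - \<phi> (to_torus x)) / \<tau> n) (0 / \<tau> n)"
          unfolding P_def by (intro has_bochner_integral_divide_zero family_measure_balanced[OF h \<mu>])
        ultimately show "has_bochner_integral (P n) (\<lambda>s. q (\<tau> n) (phase_point (\<tau> n) s)) 0" by simp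
      qed measurable
      have convq: "AE \<omega> in \<Omega>. (\<lambda>i. q (\<tau> (r i)) (Y i \<omega>)) \<longlonglongrightarrow> g0 (Y0 \<omega>)"
        using conv
      proof eventually_elim
        case (elim \<omega>)
        from torus_C1_difference_quotient[OF \<phi> tendsto_fst[OF elim] tendsto_snd[OF elim] tr \<tau>(1)]
        show ?case by (simp add: q_def g0_def case_prod_unfold)
      qed
      \<comment> \<open>Fatou for \<open>e\<close> times the Lagrangian plus \<open>s\<close> times
        the quotient; the quotient drops out of the approximating integrals by
        \<open>q_zero\<close>.\<close>
      have key: "integrable \<Omega> (\<lambda>\<omega>. e * L (Y0 \<omega>) + s * g0 (Y0 \<omega>))"
          "(\<integral>\<omega>. e * L (Y0 \<omega>) + s * g0 (Y0 \<omega>) \<partial>\<Omega>) \<le> e * c"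
        if e: "e > 0" and s: "\<bar>s\<bar> = 1" for e s
      proof -
        \<comment> \<open>After multiplication by \<open>e\<close>, slope \<open>G / e\<close>
          outweighs the bound \<open>G * norm v\<close> on the quotient.\<close>
        obtain E where E: "\<And>a v. lagrangian H a v \<ge> (G / e) * norm v - E"
          using lagrangian_superlinear[OF H] by blast
        have low: "e * L z + s * q (\<tau> (r i)) z \<ge> - (e * E)" for z i
        proof -
          obtain x v where z: "z = (x, v)" by (cases z)
          have "e * L z \<ge> e * ((G / e) * norm v - E)"
            using E[of v "to_torus x"] e by (intro mult_left_mono) (auto simp: L_def z)
          then have "e * L z \<ge> G * norm v - e * E" using e by (simp add: algebra_simps)
          moreover have "\<bar>s * q (\<tau> (r i)) z\<bar> \<le> G * norm v"
            using q_bound[OF \<tau>(1), of "r i" x v] s by (simp add: z abs_mult)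
          ultimately show ?thesis by linarith
        qed
        have int: "integrable (M (r i)) (\<lambda>z. e * L z + s * q (\<tau> (r i)) z)" for i
          using L_int q_zero by (auto simp: has_bochner_integral_iff)
        have le: "(\<integral>\<omega>. e * L (Y i \<omega>) + s * q (\<tau> (r i)) (Y i \<omega>) \<partial>\<Omega>) \<le> e * b (r i)" for i
        proof -
          have "(\<integral>\<omega>. e * L (Y i \<omega>) + s * q (\<tau> (r i)) (Y i \<omega>) \<partial>\<Omega>) = (\<integral>z. e * L z + s * q (\<tau> (r i)) z \<partial>M (r i))"
            by (rule transfer(2)[OF int])
          also have "\<dots> = e * (\<integral>z. L z \<partial>M (r i))"
            using L_int[of "r i"] q_zero[of "r i"] by (simp add: has_bochner_integral_iff)
          also have "\<dots> \<le> e * b (r i)" using L_le e by (intro mult_left_mono) auto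
          finally show ?thesis .
        qed
        have cv: "AE \<omega> in \<Omega>. (\<lambda>i. e * L (Y i \<omega>) + s * q (\<tau> (r i)) (Y i \<omega>)) \<longlonglongrightarrow> e * L (Y0 \<omega>) + s * g0 (Y0 \<omega>)"
          using convL convq by eventually_elim (intro tendsto_intros)
        have meas: "(\<lambda>\<omega>. e * L (Y0 \<omega>) + s * g0 (Y0 \<omega>)) \<in> borel_measurable \<Omega>" by measurable
        note fatou = fatou_integral_le[OF \<Omega> transfer(1)[OF int] meas low cv le tendsto_mult_left[OF br]]
        show "integrable \<Omega> (\<lambda>\<omega>. e * L (Y0 \<omega>) + s * g0 (Y0 \<omega>))" by (rule fatou(1))
        show "(\<integral>\<omega>. e * L (Y0 \<omega>) + s * g0 (Y0 \<omega>) \<partial>\<Omega>) \<le> e * c" by (rule fatou(2))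
      qed
      have g0_int: "integrable \<Omega> (\<lambda>\<omega>. g0 (Y0 \<omega>))"
        using Bochner_Integration.integrable_diff[OF key(1)[of 1 1] L0(1)] by simp
      have small: "s * (\<integral>\<omega>. g0 (Y0 \<omega>) \<partial>\<Omega>) \<le> 0" if s: "\<bar>s\<bar> = 1" for s
      proof (rule field_le_epsilon)
        fix e :: real assume "e > 0"
        define K where "K = c - (\<integral>\<omega>. L (Y0 \<omega>) \<partial>\<Omega>)"
        have "K \<ge> 0" using L0(2) by (simp add: K_def)
        \<comment> \<open>\<open>K\<close> is the action possibly lost in the limit; the factor
          \<open>e'\<close> makes its contribution at most \<open>e\<close>.\<close>
        define e' where "e' = e / (K + 1)"
        have "e' > 0" using \<open>e > 0\<close> \<open>K \<ge> 0\<close> by (simp add: e'_def)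
        have "e' * (\<integral>\<omega>. L (Y0 \<omega>) \<partial>\<Omega>) + s * (\<integral>\<omega>. g0 (Y0 \<omega>) \<partial>\<Omega>) \<le> e' * c"
          using key(2)[OF \<open>e' > 0\<close> s] L0(1) g0_int by simp
        then have "s * (\<integral>\<omega>. g0 (Y0 \<omega>) \<partial>\<Omega>) \<le> e' * K" by (simp add: K_def algebra_simps)
        also have "\<dots> \<le> e' * (K + 1)" using \<open>e' > 0\<close> by simp
        also have "\<dots> = e" using \<open>K \<ge> 0\<close> by (simp add: e'_def)
        finally show "s * (\<integral>\<omega>. g0 (Y0 \<omega>) \<partial>\<Omega>) \<le> 0 + e" by simp
      qed
      have "(\<integral>\<omega>. g0 (Y0 \<omega>) \<partial>\<Omega>) = 0" using small[of 1] small[of "-1"] by simp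
      then have "has_bochner_integral \<Omega> (\<lambda>\<omega>. case X0 \<omega> of (a, v) \<Rightarrow> v \<bullet> torus_gradient \<phi> a) 0"
        using g0_int unfolding g0_proj X0_def by (simp add: has_bochner_integral_iff)
      then show "has_bochner_integral (distr \<Omega> borel X0) (\<lambda>(x, v). v \<bullet> torus_gradient \<phi> x) 0"
        by (rule has_bochner_integral_distr[OF grad_meas X_meas(2)])
    qed
  qed
qed

section \<open>Discrete minimizers\<close>

lemma finite_pointwise_subseq:
  fixes f :: "nat \<Rightarrow> 'a \<Rightarrow> real"
  assumes "finite A" "\<And>n a. a \<in> A \<Longrightarrow> f n a \<in> {0..1}"
  shows "\<exists>r l. strict_mono (r :: nat \<Rightarrow> nat) \<and> (\<forall>a\<in>A. (\<lambda>n. f (r n) a) \<longlonglongrightarrow> l a)"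
  using assms
proof (induction A rule: finite_induct)
  case empty
  show ?case using strict_mono_id by auto
next
  case (insert b A)
  then obtain r l where r: "strict_mono (r :: nat \<Rightarrow> nat)" "\<And>a. a \<in> A \<Longrightarrow> (\<lambda>n. f (r n) a) \<longlonglongrightarrow> l a"
    by fastforce
  have "seq_compact {0..1::real}" by (rule compact_imp_seq_compact) simp
  moreover have "\<forall>n. f (r n) b \<in> {0..1}" using insert.prems by blast
  ultimately obtain t s where s: "strict_mono (s :: nat \<Rightarrow> nat)" "((\<lambda>n. f (r n) b) \<circ> s) \<longlonglongrightarrow> t"
    unfolding seq_compact_def by metis
  have conv: "(\<lambda>n. f ((r \<circ> s) n) a) \<longlonglongrightarrow> (if a = b then t else l a)" if "a \<in> insert b A" for a
  proof (cases "a = b")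
    case True
    then show ?thesis using s(2) by (simp add: comp_def)
  next
    case False
    then show ?thesis using LIMSEQ_subseq_LIMSEQ[OF r(2)[of a] s(1)] that by (simp add: comp_def)
  qed
  show ?case
    by (rule exI[of _ "r \<circ> s"], rule exI[of _ "\<lambda>a. if a = b then t else l a"])
      (intro conjI ballI conv strict_mono_o[OF r(1) s(1)])
qed

lemma finite_bounded_int_vec: "finite {l :: int ^ 'n::finite. norm (int_vec l) \<le> R}"
proof (rule finite_subset)
  show "{l :: int ^ 'n. norm (int_vec l) \<le> R} \<subseteq> vec_lambda ` PiE UNIV (\<lambda>_. {- \<lceil>R\<rceil>..\<lceil>R\<rceil>})"
  proof
    fix l :: "int ^ 'n" assume "l \<in> {l. norm (int_vec l) \<le> R}"
    then have "\<bar>real_of_int (l $ k)\<bar> \<le> R" for k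
      using component_le_norm_cart[of "int_vec l" k] by (simp add: int_vec_def)
    then have "l $ k \<in> {- \<lceil>R\<rceil>..\<lceil>R\<rceil>}" for k
      by (smt (verit) atLeastAtMost_iff ceiling_correct le_of_int_ceiling of_int_le_iff of_int_minus)
    then show "l \<in> vec_lambda ` PiE UNIV (\<lambda>_. {- \<lceil>R\<rceil>..\<lceil>R\<rceil>})"
      by (intro image_eqI[of _ _ "vec_nth l"]) auto
  qed
  show "finite (vec_lambda ` PiE (UNIV :: 'n set) (\<lambda>_. {- \<lceil>R\<rceil>..\<lceil>R\<rceil>}))"
    by (intro finite_imageI finite_PiE) auto
qed

text \<open>For each pair of grid points only a cheapest winding number matters, so the problem
  reduces to a continuous one on a simplex.\<close>

lemma discrete_minimizer_exists:
  fixes H :: "'n::finite torus \<Rightarrow> real ^ 'n \<Rightarrow> real"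
  assumes H: "tonelli_hamiltonian H" and h: "mesh_size h" and \<tau>: "\<tau> > 0"
  obtains \<mu> where "\<mu> \<in> discrete_measures h" "discrete_action H h \<tau> \<mu> = discrete_min H h \<tau>"
proof -
  define cost where "cost x y l = lagrangian H (to_torus x) (velocity \<tau> x y l)" for x y l
  have "\<exists>l. \<forall>l'. cost x y l \<le> cost x y l'" for x y
  proof -
    define S where "S = {l. cost x y l \<le> cost x y 0}"
    obtain D where D: "\<And>a v. lagrangian H a v \<ge> 1 * norm v - D"
      using lagrangian_superlinear[OF H] by blast
    \<comment> \<open>By superlinearity, winding numbers that do no worse than 0 are bounded, so a
      cheapest one is found among finitely many.\<close>
    have "S \<subseteq> {l. norm (int_vec l) \<le> \<tau> * (cost x y 0 + D) + norm (x - y)}"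
    proof
      fix l assume "l \<in> S"
      then have "norm (velocity \<tau> x y l) \<le> cost x y 0 + D"
        using D[of "velocity \<tau> x y l" "to_torus x"] by (simp add: S_def cost_def)
      moreover have "norm (y + int_vec l - x) = \<tau> * norm (velocity \<tau> x y l)"
        using \<tau> by (simp add: velocity_def)
      ultimately have "norm (y + int_vec l - x) \<le> \<tau> * (cost x y 0 + D)" using \<tau> by simp
      moreover have "norm (int_vec l) \<le> norm (y + int_vec l - x) + norm (x - y)"
        using norm_triangle_ineq[of "y + int_vec l - x" "x - y"] by simp
      ultimately show "l \<in> {l. norm (int_vec l) \<le> \<tau> * (cost x y 0 + D) + norm (x - y)}" by simp
    qed
    then have "finite S" using finite_bounded_int_vec finite_subset by blast
    moreover have "0 \<in> S" by (simp add: S_def)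
    ultimately obtain l where l: "l \<in> S" "\<And>l'. l' \<in> S \<Longrightarrow> cost x y l \<le> cost x y l'"
      using ex_is_arg_min_if_finite[of S "cost x y"] by (auto simp: is_arg_min_linorder)
    have "cost x y l \<le> cost x y l'" for l'
      using l(2)[of l'] l(1) by (cases "l' \<in> S") (auto simp: S_def)
    then show ?thesis by blast
  qed
  then obtain best where best: "\<And>x y l. cost x y (best x y) \<le> cost x y l" by metis
  define G :: "((real ^ 'n) \<times> (real ^ 'n)) set" where "G = grid h \<times> grid h"
  define s where "s i = (fst i, snd i, best (fst i) (snd i))" for i
  define cmin where "cmin i = cost (fst i) (snd i) (best (fst i) (snd i))" for i
  have finG: "finite G" unfolding G_def by (intro finite_cartesian_product finite_grid[OF h])
  define \<M> where "\<M> = {m :: (real ^ 'n) \<times> (real ^ 'n) \<Rightarrow> real. (\<forall>i\<in>G. 0 \<le> m i) \<and> (\<Sum>i\<in>G. m i) = 1 \<and>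
    (\<forall>x\<in>(grid h :: (real ^ 'n) set). (\<Sum>i\<in>G. m i * of_bool (x = fst i)) = (\<Sum>i\<in>G. m i * of_bool (x = snd i)))}"
  define A where "A m = (\<Sum>i\<in>G. cmin i * m i)" for m
  define fam where "fam m = (\<lambda>x. \<Sum>i\<in>G. m i * of_bool (x = s i))" for m :: "_ \<Rightarrow> real"
  have s_mem: "s i \<in> grid_steps h" if "i \<in> G" for i
    using that by (auto simp: s_def G_def)
  have fam: "fam m \<in> discrete_measures h" "discrete_action H h \<tau> (fam m) = ereal (A m)" if "m \<in> \<M>" for m
  proof -
    show "fam m \<in> discrete_measures h"
      unfolding fam_def by (rule atomic_family(1)[OF finG s_mem]) (use that in \<open>auto simp: \<M>_def s_def\<close>)
    have "discrete_action H h \<tau> (fam m) =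
        ereal (\<Sum>i\<in>G. step_lagrangian H \<tau> (s i) * m i)"
      unfolding fam_def by (rule atomic_family(2)[OF finG s_mem]) (use that in \<open>auto simp: \<M>_def s_def\<close>)
    then show "discrete_action H h \<tau> (fam m) = ereal (A m)"
      by (simp add: A_def s_def cmin_def cost_def)
  qed
  \<comment> \<open>The law \<open>m\<close> of the pair of end points retains total mass and
    balance. Moving all mass of a pair to its cheapest winding number does not increase the
    action.\<close>
  have reduce: "\<exists>m\<in>\<M>. ereal (A m) \<le> discrete_action H h \<tau> \<mu>"
    if \<mu>: "\<mu> \<in> discrete_measures h" and fin: "discrete_action H h \<tau> \<mu> \<le> ereal b" for \<mu> b
  proof -
    define P where "P = family_measure h \<mu>"
    interpret P: prob_space P unfolding P_def by (rule prob_space_family_measure[OF h \<mu>])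
    have P_meas[measurable]: "f \<in> borel_measurable P" for f :: "_ \<Rightarrow> real"
      by (simp add: P_def)
    have spaceP: "space P = grid_steps h" by (simp add: P_def)
    define ends where "ends s = (fst s, fst (snd s))" for s :: "(real ^ 'n) \<times> (real ^ 'n) \<times> (int ^ 'n)"
    define m :: "_ \<Rightarrow> real" where "m i = (\<integral>s. of_bool (ends s = i) \<partial>P)" for i
    have int: "integrable P (\<lambda>s. of_bool (Q s) :: real)" for Q
      by (rule P.integrable_const_bound[of _ 1]) auto
    have expand: "integrable P (\<lambda>s. F (ends s))" "(\<integral>s. F (ends s) \<partial>P) = (\<Sum>i\<in>G. F i * m i)" for F :: "_ \<Rightarrow> real"
    proof -
      have eq: "F (ends s) = (\<Sum>i\<in>G. F i * of_bool (ends s = i))" if "s \<in> space P" for s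
      proof -
        have "ends s \<in> G" using that by (auto simp: spaceP G_def ends_def)
        then show ?thesis using finG by (simp add: of_bool_def if_distrib cong: if_cong)
      qed
      have "integrable P (\<lambda>s. \<Sum>i\<in>G. F i * of_bool (ends s = i))"
        using int by (intro Bochner_Integration.integrable_sum integrable_mult_right) auto
      then show "integrable P (\<lambda>s. F (ends s))"
        using eq by (subst Bochner_Integration.integrable_cong[OF refl]) auto
      have "(\<integral>s. F (ends s) \<partial>P) = (\<integral>s. (\<Sum>i\<in>G. F i * of_bool (ends s = i)) \<partial>P)"
        by (rule Bochner_Integration.integral_cong[OF refl eq])
      also have "\<dots> = (\<Sum>i\<in>G. F i * m i)"
        unfolding m_def using int by (subst Bochner_Integration.integral_sum) auto
      finally show "(\<integral>s. F (ends s) \<partial>P) = (\<Sum>i\<in>G. F i * m i)" .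
    qed
    have "m \<in> \<M>"
      unfolding \<M>_def
    proof (intro CollectI conjI ballI)
      show "0 \<le> m i" for i unfolding m_def by (rule integral_nonneg_AE) auto
      show "(\<Sum>i\<in>G. m i) = 1" using expand(2)[of "\<lambda>_. 1"] by (simp add: P.prob_space)
      fix x :: "real ^ 'n"
      have "has_bochner_integral P (\<lambda>(a, b, l). of_bool (x = b) - of_bool (x = a)) (0 :: real)"
        unfolding P_def by (rule family_measure_balanced[OF h \<mu>])
      then have "(\<integral>s. of_bool (x = snd (ends s)) - of_bool (x = fst (ends s)) \<partial>P) = (0::real)"
        by (simp add: has_bochner_integral_iff case_prod_unfold ends_def)
      then have "(\<integral>s. of_bool (x = snd (ends s)) \<partial>P) = (\<integral>s. (of_bool (x = fst (ends s)) :: real) \<partial>P)"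
        using int by simp
      then show "(\<Sum>i\<in>G. m i * of_bool (x = fst i)) = (\<Sum>i\<in>G. m i * of_bool (x = snd i))"
        using expand(2)[of "\<lambda>i. of_bool (x = fst i)"] expand(2)[of "\<lambda>i. of_bool (x = snd i)"]
        by (simp add: mult.commute)
    qed
    moreover have "ereal (A m) \<le> discrete_action H h \<tau> \<mu>"
    proof -
      obtain a where a: "discrete_action H h \<tau> \<mu> = ereal a"
        using fin by (cases "discrete_action H h \<tau> \<mu>") (auto simp: discrete_action_def Let_def split: if_splits)
      note act = discrete_action_le[OF h \<mu> eq_refl[OF a]]
      have "A m = (\<integral>s. cmin (ends s) \<partial>P)" unfolding A_def expand(2) ..
      also have "\<dots> \<le> (\<integral>s. step_lagrangian H \<tau> s \<partial>P)"
        using expand(1)[of cmin] act(1) unfolding P_def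
        by (rule integral_mono) (use best in \<open>auto simp: cmin_def ends_def cost_def\<close>)
      also have "\<dots> \<le> a" using act(2) by (simp add: P_def)
      finally show ?thesis by (simp add: a)
    qed
    ultimately show ?thesis by blast
  qed
  have bounds: "m i \<in> {0..1}" if "m \<in> \<M>" "i \<in> G" for m i
    using that member_le_sum[of i G m] finG by (auto simp: \<M>_def)
  \<comment> \<open>A unit mass on the loop at the origin is balanced, so the simplex is
    nonempty.\<close>
  have ne: "(\<lambda>i. of_bool (i = (0, 0))) \<in> \<M>"
  proof -
    have "(0, 0) \<in> G" by (auto simp: G_def grid_def intro!: exI[of _ 0])
    then have "(\<Sum>i\<in>G. of_bool (i = (0, 0))) = (1 :: real)"
      using finG by (simp add: of_bool_def)
    then show ?thesis
      unfolding \<M>_def by (intro CollectI conjI ballI sum.cong refl) auto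
  qed
  define v where "v = Inf (A ` \<M>)"
  have bdd: "bdd_below (A ` \<M>)"
  proof (rule bdd_belowI2)
    fix m assume m: "m \<in> \<M>"
    have "- (\<Sum>i\<in>G. \<bar>cmin i\<bar>) = (\<Sum>i\<in>G. - \<bar>cmin i\<bar>)" by (simp add: sum_negf)
    also have "\<dots> \<le> A m"
      unfolding A_def
    proof (rule sum_mono)
      fix i assume "i \<in> G"
      then have "\<bar>cmin i * m i\<bar> \<le> \<bar>cmin i\<bar> * 1"
        using bounds[OF m] unfolding abs_mult by (intro mult_left_mono) auto
      then show "- \<bar>cmin i\<bar> \<le> cmin i * m i" by linarith
    qed
    finally show "- (\<Sum>i\<in>G. \<bar>cmin i\<bar>) \<le> A m" .
  qed
  have "\<exists>m\<in>\<M>. A m < v + 1 / real (Suc n)" for n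
  proof (rule ccontr)
    assume "\<not> ?thesis"
    then have "v + 1 / real (Suc n) \<le> v"
      unfolding v_def using ne by (intro cINF_greatest) (auto simp: not_less v_def)
    then show False by simp
  qed
  then obtain m where m: "\<And>n. m n \<in> \<M>" "\<And>n. A (m n) < v + 1 / real (Suc n)" by metis
  from finite_pointwise_subseq[OF finG, of m] bounds[OF m(1)]
  obtain r m0 where r: "strict_mono (r :: nat \<Rightarrow> nat)" "\<And>i. i \<in> G \<Longrightarrow> (\<lambda>n. m (r n) i) \<longlonglongrightarrow> m0 i"
    by blast
  have lim: "(\<lambda>n. \<Sum>i\<in>G. f i * m (r n) i) \<longlonglongrightarrow> (\<Sum>i\<in>G. f i * m0 i)" for f
    by (intro tendsto_intros r(2))
  have "m0 \<in> \<M>"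
    unfolding \<M>_def
  proof (intro CollectI conjI ballI)
    fix i assume i: "i \<in> G"
    show "0 \<le> m0 i"
      by (rule LIMSEQ_le_const[OF r(2)[OF i]]) (use m(1) i in \<open>auto simp: \<M>_def\<close>)
  next
    have "(\<lambda>n. \<Sum>i\<in>G. 1 * m (r n) i) = (\<lambda>n. 1)" using m(1) by (auto simp: \<M>_def)
    with lim[of "\<lambda>_. 1"] have "(\<lambda>n::nat. 1) \<longlonglongrightarrow> (\<Sum>i\<in>G. m0 i)" by simp
    then show "(\<Sum>i\<in>G. m0 i) = 1" using LIMSEQ_unique tendsto_const by metis
  next
    fix x :: "real ^ 'n" assume x: "x \<in> grid h"
    have eq: "(\<Sum>i\<in>G. of_bool (x = fst i) * m (r n) i) = (\<Sum>i\<in>G. of_bool (x = snd i) * m (r n) i)" for n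
      using m(1)[of "r n"] x by (simp add: \<M>_def mult.commute)
    have "(\<Sum>i\<in>G. of_bool (x = fst i) * m0 i) = (\<Sum>i\<in>G. of_bool (x = snd i) * m0 i)"
      by (rule LIMSEQ_unique[OF lim[of "\<lambda>i. of_bool (x = fst i)", unfolded eq] lim])
    then show "(\<Sum>i\<in>G. m0 i * of_bool (x = fst i)) = (\<Sum>i\<in>G. m0 i * of_bool (x = snd i))"
      by (simp add: mult.commute)
  qed
  have "A m0 \<le> v"
  proof (rule LIMSEQ_le[OF lim[of cmin, folded A_def]])
    have "(\<lambda>n. v + 1 / real (Suc n)) \<longlonglongrightarrow> v + 0"
      by (intro tendsto_intros LIMSEQ_Suc[OF lim_1_over_n])
    from LIMSEQ_subseq_LIMSEQ[OF this r(1)] show "(\<lambda>n. v + 1 / real (Suc (r n))) \<longlonglongrightarrow> v"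
      by (simp add: comp_def)
    show "\<exists>N. \<forall>n\<ge>N. A (m (r n)) \<le> v + 1 / real (Suc (r n))"
      using m(2) less_imp_le by blast
  qed
  have "discrete_action H h \<tau> (fam m0) \<le> discrete_action H h \<tau> \<mu>" if mem: "\<mu> \<in> discrete_measures h" for \<mu>
  proof (cases "\<exists>b. discrete_action H h \<tau> \<mu> \<le> ereal b")
    case True
    then obtain m' where "m' \<in> \<M>" "ereal (A m') \<le> discrete_action H h \<tau> \<mu>"
      using reduce[OF mem] by blast
    moreover have "v \<le> A m'" unfolding v_def by (rule cINF_lower[OF bdd \<open>m' \<in> \<M>\<close>])
    then have "ereal (A m0) \<le> ereal (A m')" using \<open>A m0 \<le> v\<close> by simp
    ultimately show ?thesis unfolding fam(2)[OF \<open>m0 \<in> \<M>\<close>] by (meson order_trans)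
  next
    case False
    then have "discrete_action H h \<tau> \<mu> = \<infinity>" by (metis ereal_top nle_le)
    then show ?thesis by simp
  qed
  then have "discrete_action H h \<tau> (fam m0) = discrete_min H h \<tau>"
    unfolding discrete_min_def using fam(1)[OF \<open>m0 \<in> \<M>\<close>]
    by (intro antisym INF_greatest INF_lower) auto
  then show ?thesis using that fam(1)[OF \<open>m0 \<in> \<M>\<close>] by blast
qed

section \<open>Mather measures and local masses\<close>

lemma closed_measure_test:
  fixes H :: "'n::finite torus \<Rightarrow> real ^ 'n \<Rightarrow> real"
  assumes \<mu>: "closed_measure \<mu>" and int: "integrable \<mu> (\<lambda>(x, v). lagrangian H x v)" and \<phi>: "torus_C1 \<phi>"
  shows "integrable \<mu> (\<lambda>(x, v). lagrangian H x v - c - v \<bullet> torus_gradient \<phi> x + e)"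
    "(\<integral>(x, v). lagrangian H x v - c - v \<bullet> torus_gradient \<phi> x + e \<partial>\<mu>) = (\<integral>(x, v). lagrangian H x v \<partial>\<mu>) - c + e"
proof -
  interpret prob_space \<mu> using \<mu> by (simp add: closed_measure_def)
  have g: "has_bochner_integral \<mu> (\<lambda>(x, v). v \<bullet> torus_gradient \<phi> x) 0"
    using \<mu> \<phi> by (simp add: closed_measure_def)
  have L: "has_bochner_integral \<mu> (\<lambda>(x, v). lagrangian H x v) (\<integral>(x, v). lagrangian H x v \<partial>\<mu>)"
    by (rule has_bochner_integral_integrable[OF int])
  have const: "has_bochner_integral \<mu> (\<lambda>_. k) k" for k :: real
    by (simp add: has_bochner_integral_iff prob_space)
  have "has_bochner_integral \<mu> (\<lambda>z. (case z of (x, v) \<Rightarrow> lagrangian H x v) - c - (case z of (x, v) \<Rightarrow> v \<bullet> torus_gradient \<phi> x) + e)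
      ((\<integral>(x, v). lagrangian H x v \<partial>\<mu>) - c - 0 + e)"
    by (intro has_bochner_integral_add has_bochner_integral_diff L g const)
  then show "integrable \<mu> (\<lambda>(x, v). lagrangian H x v - c - v \<bullet> torus_gradient \<phi> x + e)"
    "(\<integral>(x, v). lagrangian H x v - c - v \<bullet> torus_gradient \<phi> x + e \<partial>\<mu>) = (\<integral>(x, v). lagrangian H x v \<partial>\<mu>) - c + e"
    by (simp_all add: has_bochner_integral_iff case_prod_unfold)
qed

context
  fixes H :: "'n::finite torus \<Rightarrow> real ^ 'n \<Rightarrow> real" and c :: "nat \<Rightarrow> real" and c0 R :: real
  assumes c: "c \<longlonglongrightarrow> c0"
    and sub: "\<And>e. e > 0 \<Longrightarrow> \<forall>\<^sub>F n in sequentially. \<exists>\<phi>. almost_subsolution H R (c n) e \<phi>"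
begin

lemma subsolution_near_critical:
  assumes "e > 0"
  obtains \<phi> k where "torus_C1 \<phi>" "\<bar>k - c0\<bar> < e"
    "\<And>a v. v \<bullet> torus_gradient \<phi> a \<le> lagrangian H a v - k + e"
    "\<And>a v. norm v \<ge> R \<Longrightarrow> v \<bullet> torus_gradient \<phi> a + 1 \<le> lagrangian H a v - k"
proof -
  have "\<forall>\<^sub>F n in sequentially. \<bar>c n - c0\<bar> < e"
    using tendstoD[OF c assms] by (simp add: dist_real_def)
  from eventually_happens[OF eventually_conj[OF sub[OF assms] this]]
  show ?thesis using that unfolding almost_subsolution_def by auto
qed

text \<open>Integrating the subsolution inequality removes the gradient term by closedness and
  leaves \<open>c0\<close> up to an arbitrarily small error.\<close>

lemma closed_measure_action_ge:
  assumes \<mu>: "closed_measure \<mu>"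
  shows "ereal c0 \<le> action H \<mu>"
proof (cases "integrable \<mu> (\<lambda>(x, v). lagrangian H x v)")
  case True
  define I where "I = (\<integral>(x, v). lagrangian H x v \<partial>\<mu>)"
  have "c0 \<le> I"
  proof (rule field_le_epsilon)
    fix e :: real assume "e > 0"
    then have "e / 2 > 0" by simp
    from subsolution_near_critical[OF this] obtain \<phi> k where \<phi>: "torus_C1 \<phi>" "\<bar>k - c0\<bar> < e / 2"
      "\<And>a v. v \<bullet> torus_gradient \<phi> a \<le> lagrangian H a v - k + e / 2" by metis
    have "0 \<le> (\<integral>(x, v). lagrangian H x v - k - v \<bullet> torus_gradient \<phi> x + e / 2 \<partial>\<mu>)"
    proof (rule integral_nonneg_AE, rule AE_I2)
      fix z
      show "0 \<le> (case z of (x, v) \<Rightarrow> lagrangian H x v - k - v \<bullet> torus_gradient \<phi> x + e / 2)"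
        using \<phi>(3)[of "snd z" "fst z"] by (simp add: case_prod_unfold)
    qed
    then show "c0 \<le> I + e"
      unfolding closed_measure_test(2)[OF \<mu> True \<phi>(1)] I_def[symmetric] using \<phi>(2) by linarith
  qed
  then show ?thesis using True by (simp add: action_def I_def)
qed (simp add: action_def)

text \<open>The defect of the subsolution inequality is nonnegative everywhere and at least 1 for
  velocities beyond \<open>R\<close>, while its integral is at most \<open>e\<close>. So the set of
  large velocities has mass at most every \<open>e\<close>; being open and null, it misses the
  support.\<close>

lemma minimal_measure_support_bounded:
  assumes \<mu>: "closed_measure \<mu>" and act: "action H \<mu> \<le> ereal c0"
  shows "spt \<mu> \<subseteq> UNIV \<times> cball 0 R"
proof -
  interpret prob_space \<mu> using \<mu> by (simp add: closed_measure_def)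
  have sets: "sets \<mu> = sets borel" using \<mu> by (simp add: closed_measure_def)
  have int: "integrable \<mu> (\<lambda>(x, v). lagrangian H x v)"
    and I: "(\<integral>(x, v). lagrangian H x v \<partial>\<mu>) \<le> c0"
    using act by (auto simp: action_def split: if_splits)
  define U where "U = (UNIV :: 'n torus set) \<times> - cball (0 :: real ^ 'n) R"
  have "open U" unfolding U_def by (intro open_Times open_Compl closed_cball open_UNIV)
  then have U: "U \<in> sets \<mu>" by (simp add: sets)
  have "measure \<mu> U \<le> 0"
  proof (rule field_le_epsilon)
    fix e :: real assume "e > 0"
    then have "e / 2 > 0" by simp
    from subsolution_near_critical[OF this] obtain \<phi> k where \<phi>: "torus_C1 \<phi>" "\<bar>k - c0\<bar> < e / 2"
      "\<And>a v. v \<bullet> torus_gradient \<phi> a \<le> lagrangian H a v - k + e / 2"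
      "\<And>a v. norm v \<ge> R \<Longrightarrow> v \<bullet> torus_gradient \<phi> a + 1 \<le> lagrangian H a v - k" by metis
    have "measure \<mu> U = (\<integral>z. indicat_real U z \<partial>\<mu>)"
      using U by simp
    also have "\<dots> \<le> (\<integral>(x, v). lagrangian H x v - k - v \<bullet> torus_gradient \<phi> x + e / 2 \<partial>\<mu>)"
    proof (rule integral_mono[OF _ closed_measure_test(1)[OF \<mu> int \<phi>(1)]])
      show "integrable \<mu> (indicat_real U)"
        using U by (simp add: emeasure_eq_measure)
      fix z
      show "indicat_real U z \<le> (case z of (x, v) \<Rightarrow> lagrangian H x v - k - v \<bullet> torus_gradient \<phi> x + e / 2)"
        using \<phi>(3)[of "snd z" "fst z"] \<phi>(4)[of "snd z" "fst z"] \<open>e > 0\<close>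
        by (cases "z \<in> U") (auto simp: case_prod_unfold U_def)
    qed
    also have "\<dots> \<le> 0 + e"
      unfolding closed_measure_test(2)[OF \<mu> int \<phi>(1)] using I \<phi>(2) by linarith
    finally show "measure \<mu> U \<le> 0 + e" .
  qed
  then have "emeasure \<mu> U = 0"
    using measure_nonneg[of \<mu> U] by (simp add: emeasure_eq_measure)
  show ?thesis
  proof
    fix z assume "z \<in> spt \<mu>"
    then have "z \<notin> U" using \<open>open U\<close> \<open>emeasure \<mu> U = 0\<close> by (auto simp: spt_def)
    then show "z \<in> UNIV \<times> cball 0 R" by (auto simp: U_def mem_Times_iff)
  qed
qed

end

text \<open>Otherwise null open sets cover \<open>U\<close>. Pulled back to Euclidean space the
  cover has a countable subcover by Lindelof, so \<open>U\<close> itself is null.\<close>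

lemma spt_meets_open:
  fixes \<mu> :: "('n::finite torus \<times> (real ^ 'n)) measure"
  assumes sets: "sets \<mu> = sets borel" and U: "open U" "emeasure \<mu> U \<noteq> 0"
  shows "\<exists>z\<in>U. z \<in> spt \<mu>"
proof (rule ccontr)
  assume none: "\<not> ?thesis"
  define \<V> where "\<V> = {V. open V \<and> emeasure \<mu> V = 0}"
  have op: "open S" if "S \<in> (vimage torus_proj) ` \<V>" for S
    using that continuous_on_open_vimage[of UNIV torus_proj] continuous_on_torus_proj
    by (auto simp: \<V>_def)
  obtain \<F> where \<F>: "\<F> \<subseteq> (vimage torus_proj) ` \<V>" "countable \<F>" "\<Union> \<F> = \<Union> ((vimage torus_proj) ` \<V>)"
    using Lindelof[OF op] by blast
  obtain \<W> where \<W>: "countable \<W>" "\<W> \<subseteq> \<V>" "\<F> = (vimage torus_proj) ` \<W>"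
    using \<F>(1,2) by (metis countable_subset_image)
  have "U \<subseteq> \<Union> \<W>"
  proof
    fix z assume "z \<in> U"
    then obtain V where V: "open V" "z \<in> V" "emeasure \<mu> V = 0"
      using none unfolding spt_def by (auto simp: not_less)
    obtain x where x: "torus_proj x = z"
      using to_torus_rep[of "fst z"] by (auto simp: torus_proj_def intro: that[of "(rep_torus (fst z), snd z)"])
    have "x \<in> \<Union> ((vimage torus_proj) ` \<V>)" using V x by (auto simp: \<V>_def)
    then have "x \<in> \<Union> \<F>" using \<F>(3) by simp
    then show "z \<in> \<Union> \<W>" using \<W>(3) x by auto
  qed
  moreover have "(\<Union>V\<in>\<W>. V) \<in> null_sets \<mu>"
    using \<W>(1,2) by (intro null_sets_UN') (auto simp: \<V>_def null_sets_def sets)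
  ultimately have "emeasure \<mu> U = 0"
    using null_sets_subset[of "\<Union> \<W>" \<mu> U] U(1) by (auto simp: sets)
  then show False using U(2) by simp
qed

section \<open>Local masses\<close>

context
  fixes \<kappa> :: "real \<Rightarrow> real" and r :: real
  assumes \<kappa>: "cutoff \<kappa>" and r: "r > 0"
begin

lemma cutoff_bounds: "t \<ge> 0 \<Longrightarrow> 0 \<le> \<kappa> t \<and> \<kappa> t \<le> 1"
  using \<kappa> unfolding cutoff_def by (auto simp: image_subset_iff)

lemma cutoff_dist_tendsto:
  assumes "(f \<longlongrightarrow> a) F" "(g \<longlongrightarrow> b) F"
  shows "((\<lambda>x. \<kappa> (dist (f x) (g x) / r)) \<longlongrightarrow> \<kappa> (dist a b / r)) F"
proof -
  have "continuous_on {0..} \<kappa>"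
    using \<kappa> lipschitz_on_continuous_on unfolding cutoff_def by blast
  then show ?thesis
    by (rule continuous_on_tendsto_compose) (use assms r in \<open>auto intro!: tendsto_intros\<close>)
qed

lemma cutoff_dist_continuous: "continuous_on UNIV (\<lambda>w. \<kappa> (dist z w / r))"
  unfolding continuous_on_def by (intro ballI cutoff_dist_tendsto tendsto_intros)

lemma cutoff_dist_measurable: "(\<lambda>w. \<kappa> (dist z w / r)) \<in> borel_measurable borel"
  by (rule borel_measurable_continuous_onI[OF cutoff_dist_continuous])

lemma cutoff_dist_bounds: "0 \<le> \<kappa> (dist z w / r)" "\<kappa> (dist z w / r) \<le> 1"
  using cutoff_bounds[of "dist z w / r"] r by auto

context
  fixes \<nu> :: "'a::metric_space measure"
  assumes prob: "prob_space \<nu>" and sets: "sets \<nu> = sets borel"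
begin

interpretation prob_space \<nu> by (rule prob)

lemma local_mass_integrable: "integrable \<nu> (\<lambda>w. \<kappa> (dist z w / r))"
proof (rule integrable_const_bound[of _ 1])
  show "(\<lambda>w. \<kappa> (dist z w / r)) \<in> borel_measurable \<nu>"
    using cutoff_dist_measurable measurable_cong_sets[OF sets refl] by blast
qed (auto simp: cutoff_dist_bounds)

lemma local_mass_le_1: "local_mass \<kappa> \<nu> r z \<le> 1"
proof -
  have "local_mass \<kappa> \<nu> r z \<le> (\<integral>w. 1 \<partial>\<nu>)"
    unfolding local_mass_def by (rule integral_mono[OF local_mass_integrable]) (auto simp: cutoff_dist_bounds)
  then show ?thesis by (simp add: prob_space)
qed

text \<open>The cutoff equals 1 up to 1/2, so the local mass dominates the measure of the ball of
  radius \<open>r / 2\<close>.\<close>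

lemma local_mass_pos:
  assumes "z \<in> spt \<nu>" shows "local_mass \<kappa> \<nu> r z > 0"
proof -
  have "0 < emeasure \<nu> (ball z (r / 2))"
    using assms r by (auto simp: spt_def)
  then have "0 < measure \<nu> (ball z (r / 2))" by (simp add: emeasure_eq_measure)
  also have "measure \<nu> (ball z (r / 2)) = (\<integral>w. indicat_real (ball z (r / 2)) w \<partial>\<nu>)"
    by (simp add: sets)
  also have "\<dots> \<le> local_mass \<kappa> \<nu> r z"
    unfolding local_mass_def
  proof (rule integral_mono[OF _ local_mass_integrable])
    show "integrable \<nu> (indicat_real (ball z (r / 2)))" by (simp add: sets emeasure_eq_measure)
    fix w
    have "\<kappa> (dist z w / r) = 1" if "dist z w < r / 2"
      using \<kappa> that r unfolding cutoff_def by (auto simp: field_simps)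
    then show "indicat_real (ball z (r / 2)) w \<le> \<kappa> (dist z w / r)"
      by (auto simp: indicator_def cutoff_dist_bounds)
  qed
  finally show ?thesis .
qed

text \<open>The local mass inherits the Lipschitz constant \<open>C / r\<close> of the cutoff.
  Continuity is needed for a positive minimum on the Mather set.\<close>

lemma local_mass_continuous: "continuous_on UNIV (local_mass \<kappa> \<nu> r)"
proof -
  obtain C where C: "C-lipschitz_on {0..} \<kappa>" using \<kappa> by (auto simp: cutoff_def)
  have "(C / r)-lipschitz_on UNIV (local_mass \<kappa> \<nu> r)"
  proof (rule lipschitz_onI)
    show "0 \<le> C / r" using lipschitz_on_nonneg[OF C] r by simp
    fix z z' :: 'a
    have le: "\<bar>\<kappa> (dist z w / r) - \<kappa> (dist z' w / r)\<bar> \<le> C / r * dist z z'" for w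
    proof -
      have "dist (\<kappa> (dist z w / r)) (\<kappa> (dist z' w / r)) \<le> C * dist (dist z w / r) (dist z' w / r)"
        by (rule lipschitz_onD[OF C]) (use r in auto)
      also have "dist (dist z w / r) (dist z' w / r) = \<bar>dist z w - dist z' w\<bar> / r"
        using r by (simp add: dist_real_def diff_divide_distrib[symmetric])
      also have "\<dots> \<le> dist z z' / r"
        using r dist_triangle[of z w z'] dist_triangle[of z' w z] by (intro divide_right_mono) (auto simp: dist_commute)
      finally show ?thesis using lipschitz_on_nonneg[OF C] by (simp add: dist_real_def mult_left_mono)
    qed
    have "dist (local_mass \<kappa> \<nu> r z) (local_mass \<kappa> \<nu> r z') = \<bar>\<integral>w. \<kappa> (dist z w / r) - \<kappa> (dist z' w / r) \<partial>\<nu>\<bar>"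
      by (simp add: local_mass_def dist_real_def local_mass_integrable)
    also have "\<dots> \<le> (\<integral>w. \<bar>\<kappa> (dist z w / r) - \<kappa> (dist z' w / r)\<bar> \<partial>\<nu>)"
      by (rule integral_abs_bound)
    also have "\<dots> \<le> (\<integral>w. C / r * dist z z' \<partial>\<nu>)"
      by (intro integral_mono integrable_abs Bochner_Integration.integrable_diff local_mass_integrable le) simp
    finally show "dist (local_mass \<kappa> \<nu> r z) (local_mass \<kappa> \<nu> r z') \<le> C / r * dist z z'"
      by (simp add: prob_space)
  qed
  then show ?thesis by (rule lipschitz_on_continuous_on)
qed

end

end

lemma reconstruction_prob:
  assumes "mesh_size h" "\<mu> \<in> discrete_measures h"
  shows "prob_space (reconstruction h \<tau> \<mu>)" "sets (reconstruction h \<tau> \<mu>) = sets borel"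
proof -
  interpret prob_space "family_measure h \<mu>" by (rule prob_space_family_measure[OF assms])
  have "prob_space (distr (family_measure h \<mu>) borel (phase_point \<tau>))"
    by (rule prob_space_distr) simp
  then show "prob_space (reconstruction h \<tau> \<mu>)"
    unfolding reconstruction_eq by (rule prob_space.prob_space_distr) simp
  show "sets (reconstruction h \<tau> \<mu>) = sets borel" by (simp add: reconstruction_def)
qed

text \<open>A supremum of reals dominates its members only if bounded above; local masses of
  probability measures are at most 1.\<close>

lemma max_local_mass_ge:
  assumes "cutoff \<kappa>" "r > 0" "mesh_size h" "\<mu> \<in> almost_minimizers H h \<tau> \<epsilon>"
  shows "local_mass \<kappa> (reconstruction h \<tau> \<mu>) r z \<le> max_local_mass \<kappa> H h \<tau> \<epsilon> r z"
  unfolding max_local_mass_def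
proof (rule cSUP_upper)
  show "reconstruction h \<tau> \<mu> \<in> reconstruction h \<tau> ` almost_minimizers H h \<tau> \<epsilon>"
    using assms(4) by blast
  show "bdd_above ((\<lambda>\<mu>. local_mass \<kappa> \<mu> r z) ` reconstruction h \<tau> ` almost_minimizers H h \<tau> \<epsilon>)"
  proof (rule bdd_aboveI2)
    fix \<nu> assume "\<nu> \<in> reconstruction h \<tau> ` almost_minimizers H h \<tau> \<epsilon>"
    then obtain \<mu>' where "\<nu> = reconstruction h \<tau> \<mu>'" "\<mu>' \<in> discrete_measures h"
      by (auto simp: almost_minimizers_def)
    then show "local_mass \<kappa> \<nu> r z \<le> 1"
      using local_mass_le_1[OF assms(1,2) reconstruction_prob[OF assms(3)]] by simp
  qed
qed

section \<open>Convergence of discrete minima and limits of almost minimizers\<close>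

lemma discrete_min_lower_bound:
  assumes "mesh_size h" "\<And>a v. lagrangian H a v \<ge> - B"
  shows "ereal (- B) \<le> discrete_min H h \<tau>"
  unfolding discrete_min_def
  by (rule INF_greatest) (rule discrete_action_lower_bound[OF assms(1) _ assms(2)])

text \<open>The minimum is squeezed between the recovery action and that action minus the vanishing
  gap.\<close>

lemma recovery_discrete_min_converges:
  fixes H :: "'n::finite torus \<Rightarrow> real ^ 'n \<Rightarrow> real"
  assumes H: "tonelli_hamiltonian H" and h: "\<And>n. mesh_size (h n)"
    and lim: "\<tau> \<longlonglongrightarrow> 0" "(\<lambda>n. h n / \<tau> n) \<longlonglongrightarrow> 0"
    and rec: "recovery_sequence H h \<tau> \<mu> \<nu>"
  obtains c C where "\<And>n. discrete_min H (h n) (\<tau> n) = ereal (c n)" "c \<longlonglongrightarrow> - critical_value H" "\<And>n. \<bar>c n\<bar> \<le> C"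
proof -
  define a where "a n = discrete_action H (h n) (\<tau> n) (\<nu> n)" for n
  define m where "m n = discrete_min H (h n) (\<tau> n)" for n
  obtain B where B: "\<And>a v. lagrangian H a v \<ge> - B"
    using lagrangian_superlinear[OF H, of 0] by auto
  have \<nu>: "\<nu> n \<in> discrete_measures (h n)" for n using rec by (simp add: recovery_sequence_def)
  have a_lim: "a \<longlonglongrightarrow> ereal (- critical_value H)"
    using rec unfolding recovery_sequence_def a_def by blast
  obtain K where K: "K > 0" "\<And>n. a n - m n \<le> ereal (K * (\<tau> n + h n / \<tau> n))"
    using rec unfolding recovery_sequence_def a_def m_def by blast
  \<comment> \<open>Both values are finite: the Lagrangian is bounded below, and an infinite
    recovery action would make the gap infinite.\<close>
  have "\<exists>x y. a n = ereal x \<and> m n = ereal y \<and> y \<le> x" for n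
  proof -
    have "ereal (- B) \<le> m n" unfolding m_def by (rule discrete_min_lower_bound[OF h B])
    moreover have le: "m n \<le> a n" unfolding m_def a_def discrete_min_def by (rule INF_lower[OF \<nu>])
    moreover have "a n \<noteq> \<infinity>" using K(2)[of n] by auto
    ultimately show ?thesis by (cases "a n"; cases "m n") auto
  qed
  then obtain x c where x: "\<And>n. a n = ereal (x n)" and c: "\<And>n. m n = ereal (c n)" "\<And>n. c n \<le> x n"
    by metis
  have x_lim: "x \<longlonglongrightarrow> - critical_value H" using a_lim by (simp add: x[abs_def])
  have "(\<lambda>n. K * (\<tau> n + h n / \<tau> n)) \<longlonglongrightarrow> K * (0 + 0)"
    by (intro tendsto_intros lim)
  from tendsto_diff[OF x_lim this]
  have low_lim: "(\<lambda>n. x n - K * (\<tau> n + h n / \<tau> n)) \<longlonglongrightarrow> - critical_value H" by simp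
  have low: "x n - K * (\<tau> n + h n / \<tau> n) \<le> c n" for n
    using K(2)[of n] by (simp add: x c)
  have c_lim: "c \<longlonglongrightarrow> - critical_value H"
    by (rule tendsto_sandwich[OF _ _ low_lim x_lim]) (simp_all add: low c(2))
  then have "Bseq c" by (rule convergentI[THEN convergent_imp_Bseq])
  then obtain C where "\<And>n. \<bar>c n\<bar> \<le> C" by (auto simp: Bseq_def)
  with c_lim c(1) show ?thesis using that unfolding m_def by blast
qed

text \<open>The limit measure is closed with least action, hence a Mather measure. Local masses at
  moving centres converge by dominated convergence, so it keeps mass \<open>\<delta>\<close> at
  \<open>z\<close>. A cutoff vanishing from 1 on then forces it to charge the open ball, which
  yields the strict inequality.\<close>

lemma limit_of_almost_minimizers_charges_mather_set:
  fixes H :: "'n::finite torus \<Rightarrow> real ^ 'n \<Rightarrow> real"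
  assumes H: "tonelli_hamiltonian H" and h: "\<And>n. mesh_size (h n)"
    and \<tau>: "\<And>n. 0 < \<tau> n" "\<tau> \<longlonglongrightarrow> 0" and \<kappa>: "cutoff \<kappa>" and r: "r > 0" and \<delta>: "\<delta> > 0"
    and \<mu>: "\<And>n. \<mu> n \<in> discrete_measures (h n)"
      "\<And>n. discrete_action H (h n) (\<tau> n) (\<mu> n) \<le> ereal (b n)" "b \<longlonglongrightarrow> c"
    and least: "\<And>\<mu>'. closed_measure \<mu>' \<Longrightarrow> ereal c \<le> action H \<mu>'"
    and w: "w \<longlonglongrightarrow> z" "\<And>n. \<delta> \<le> local_mass \<kappa> (reconstruction (h n) (\<tau> n) (\<mu> n)) r (w n)"
  shows "\<exists>y\<in>mather_set H. dist z y < r"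
proof -
  obtain \<Omega> :: "real measure" and s :: "nat \<Rightarrow> nat" and X X0 where s: "strict_mono s" and \<Omega>: "prob_space \<Omega>"
    and X: "\<And>i::nat. X i \<in> borel_measurable \<Omega>" "X0 \<in> borel_measurable \<Omega>"
    and law: "\<And>i. distr \<Omega> borel (X i) = reconstruction (h (s i)) (\<tau> (s i)) (\<mu> (s i))"
    and conv: "AE \<omega> in \<Omega>. (\<lambda>i. X i \<omega>) \<longlonglongrightarrow> X0 \<omega>"
    and X0: "closed_measure (distr \<Omega> borel X0)" "action H (distr \<Omega> borel X0) \<le> ereal c"
    by (rule closed_limit[OF H h \<tau> \<mu>]) (rule that, assumption+)
  note [measurable] = X
  interpret \<Omega>: prob_space \<Omega> by (rule \<Omega>)
  define \<mu>0 where "\<mu>0 = distr \<Omega> borel X0"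
  have "mather_measure H \<mu>0"
    using X0 least order_trans unfolding mather_measure_def \<mu>0_def by blast
  then have "spt \<mu>0 \<subseteq> \<Union> {spt \<mu> |\<mu>. mather_measure H \<mu>}" by auto
  then have sub: "spt \<mu>0 \<subseteq> mather_set H"
    unfolding mather_set_def by (rule order_trans[OF _ closure_subset])
  define K where "K z w = \<kappa> (dist z w / r)" for z w :: "'n torus \<times> (real ^ 'n)"
  have K_meas: "K z \<in> borel_measurable borel" for z
    unfolding K_def[abs_def] by (rule cutoff_dist_measurable[OF \<kappa> r])
  have ws: "(\<lambda>i. w (s i)) \<longlonglongrightarrow> z" using LIMSEQ_subseq_LIMSEQ[OF w(1) s] by (simp add: comp_def)
  have "(\<lambda>i. \<integral>\<omega>. K (w (s i)) (X i \<omega>) \<partial>\<Omega>) \<longlonglongrightarrow> (\<integral>\<omega>. K z (X0 \<omega>) \<partial>\<Omega>)"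
  proof (rule integral_dominated_convergence[where w = "\<lambda>_. 1"])
    show "AE \<omega> in \<Omega>. (\<lambda>i. K (w (s i)) (X i \<omega>)) \<longlonglongrightarrow> K z (X0 \<omega>)"
      using conv unfolding K_def by eventually_elim (rule cutoff_dist_tendsto[OF \<kappa> r ws])
    show "AE \<omega> in \<Omega>. norm (K (w (s i)) (X i \<omega>)) \<le> 1" for i
      unfolding K_def by (simp add: cutoff_dist_bounds[OF \<kappa> r])
  qed (rule measurable_compose[OF X(2) K_meas], rule measurable_compose[OF X(1) K_meas], simp)
  moreover have "\<delta> \<le> (\<integral>\<omega>. K (w (s i)) (X i \<omega>) \<partial>\<Omega>)" for i
  proof -
    have "(\<integral>\<omega>. K (w (s i)) (X i \<omega>) \<partial>\<Omega>) = local_mass \<kappa> (distr \<Omega> borel (X i)) r (w (s i))"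
      unfolding local_mass_def K_def[symmetric] by (subst integral_distr[OF X(1) K_meas]) (rule refl)
    then show ?thesis using w(2) by (simp add: law)
  qed
  ultimately have pos: "\<delta> \<le> (\<integral>\<omega>. K z (X0 \<omega>) \<partial>\<Omega>)"
    by (intro LIMSEQ_le_const) auto
  have "emeasure \<mu>0 (ball z r) \<noteq> 0"
  proof
    assume "emeasure \<mu>0 (ball z r) = 0"
    then have "ball z r \<in> null_sets \<mu>0" by (simp add: null_sets_def \<mu>0_def)
    then have "AE y in \<mu>0. y \<notin> ball z r" by (rule AE_not_in)
    then have "AE \<omega> in \<Omega>. X0 \<omega> \<notin> ball z r" unfolding \<mu>0_def by (rule AE_distrD[OF X(2)])
    then have "AE \<omega> in \<Omega>. K z (X0 \<omega>) = 0"
    proof eventually_elim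
      case (elim \<omega>)
      \<comment> \<open>Off the open ball the scaled distance is at least 1, exactly where the
        cutoff is zero.\<close>
      then have "1 \<le> dist z (X0 \<omega>) / r" using r by simp
      then show ?case using \<kappa> unfolding K_def cutoff_def by auto
    qed
    then have "(\<integral>\<omega>. K z (X0 \<omega>) \<partial>\<Omega>) = 0" by (rule integral_eq_zero_AE)
    then show False using pos \<delta> by simp
  qed
  from spt_meets_open[OF _ open_ball this] sub show ?thesis
    by (auto simp: \<mu>0_def)
qed

theorem corollary6p8:
  fixes H :: "'n::finite torus \<Rightarrow> real ^ 'n \<Rightarrow> real"
    and h \<tau> \<epsilon> :: "nat \<Rightarrow> real"
    and \<kappa> :: "real \<Rightarrow> real"
    and \<mu>\<^sub>0 :: "('n torus \<times> (real ^ 'n)) measure"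
    and \<nu> :: "nat \<Rightarrow> 'n family"
  assumes "tonelli_hamiltonian H"
    and "\<And>n. mesh_size (h n)"
    and "\<And>n. 0 < \<tau> n"
    and "\<tau> \<longlonglongrightarrow> 0"
    and "h \<longlonglongrightarrow> 0"
    and "(\<lambda>n. h n / \<tau> n) \<longlonglongrightarrow> 0"
    and "cutoff \<kappa>"
    and "mather_measure H \<mu>\<^sub>0"
    and "spt \<mu>\<^sub>0 = mather_set H"
    and "recovery_sequence H h \<tau> \<mu>\<^sub>0 \<nu>"
    and "\<And>n. 0 \<le> \<epsilon> n"
    and "\<epsilon> \<longlonglongrightarrow> 0"
    and "\<forall>\<^sub>F n in sequentially.
      discrete_action H (h n) (\<tau> n) (\<nu> n) - discrete_min H (h n) (\<tau> n) \<le> ereal (\<epsilon> n)"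
  shows "\<forall>r>0. \<exists>\<delta>>0. \<delta> \<le> 1 \<and>
    mather_set H
      \<subseteq> kuratowski_liminf (\<lambda>n. threshold_set \<kappa> H (h n) (\<tau> n) (\<epsilon> n) r \<delta>) \<and>
    kuratowski_liminf (\<lambda>n. threshold_set \<kappa> H (h n) (\<tau> n) (\<epsilon> n) r \<delta>)
      \<subseteq> kuratowski_limsup (\<lambda>n. threshold_set \<kappa> H (h n) (\<tau> n) (\<epsilon> n) r \<delta>) \<and>
    kuratowski_limsup (\<lambda>n. threshold_set \<kappa> H (h n) (\<tau> n) (\<epsilon> n) r \<delta>)
      \<subseteq> nbhd (mather_set H) r"
proof (intro allI impI)
  fix r :: real assume r: "r > 0"
  note H = assms(1) and h = assms(2) and \<tau> = assms(3,4) and \<kappa> = assms(7)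
  obtain c C where c: "\<And>n. discrete_min H (h n) (\<tau> n) = ereal (c n)"
      "c \<longlonglongrightarrow> - critical_value H" "\<And>n. \<bar>c n\<bar> \<le> C"
    using recovery_discrete_min_converges[OF H h \<tau>(2) assms(6,10)] by blast
  define c0 where "c0 = - critical_value H"
  have c_lim: "c \<longlonglongrightarrow> c0" using c(2) by (simp add: c0_def)
  have c_le: "ereal (c n) \<le> discrete_min H (h n) (\<tau> n)" for n by (simp add: c(1))
  obtain R where sub: "\<And>e. e > 0 \<Longrightarrow> \<forall>\<^sub>F n in sequentially. \<exists>\<phi>. almost_subsolution H R (c n) e \<phi>"
    by (rule almost_subsolution_exists[OF H h \<tau>(1,2) assms(5,6) c_le c(3)]) (rule that, assumption)
  have least: "ereal c0 \<le> action H \<mu>" if "closed_measure \<mu>" for \<mu>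
    by (rule closed_measure_action_ge[OF c_lim sub that])
  have "\<exists>\<mu>. \<mu> \<in> discrete_measures (h n) \<and> discrete_action H (h n) (\<tau> n) \<mu> = ereal (c n)" for n
    by (rule discrete_minimizer_exists[OF H h \<tau>(1)]) (auto simp: c(1)[symmetric])
  then obtain m where m: "\<And>n. m n \<in> discrete_measures (h n)"
      "\<And>n. discrete_action H (h n) (\<tau> n) (m n) = ereal (c n)"
    by metis
  \<comment> \<open>Exact minimizers qualify for every \<open>n\<close> since
    \<open>\<epsilon> n\<close> is nonnegative, also at early indices where the recovery family need
    not qualify.\<close>
  have minimizers: "\<exists>\<mu>. \<mu> \<in> almost_minimizers H (h n) (\<tau> n) (\<epsilon> n)" for n
    using assms(11)[of n] m[of n] by (auto simp: almost_minimizers_def c(1))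
  let ?S = "\<lambda>\<delta> n. threshold_set \<kappa> H (h n) (\<tau> n) (\<epsilon> n) r \<delta>"
  have S_mono: "?S \<delta> n \<subseteq> ?S \<delta>' n" if "\<delta>' \<le> \<delta>" for \<delta> \<delta>' n
    using that by (auto simp: threshold_set_def)
  have S_mem: "z \<in> ?S \<delta> n"
    if "\<mu> \<in> almost_minimizers H (h n) (\<tau> n) (\<epsilon> n)" "\<delta> \<le> local_mass \<kappa> (reconstruction (h n) (\<tau> n) \<mu>) r z" for \<mu> \<delta> n z
    using max_local_mass_ge[OF \<kappa> r h that(1), of z] that(2) by (simp add: threshold_set_def)
  have upper: "kuratowski_limsup (?S \<delta>) \<subseteq> nbhd (mather_set H) r" if \<delta>: "\<delta> > 0" for \<delta>
  proof
    fix z assume "z \<in> kuratowski_limsup (?S \<delta>)"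
    then obtain k w where k: "strict_mono (k :: nat \<Rightarrow> nat)" and w: "\<And>j. w j \<in> ?S \<delta> (k j)" "w \<longlonglongrightarrow> z"
      by (auto simp: kuratowski_limsup_def)
    \<comment> \<open>The supremum in the threshold may not be attained; half of
      \<open>\<delta>\<close> is reached by some almost minimizer.\<close>
    have "\<exists>\<mu>\<in>almost_minimizers H (h (k j)) (\<tau> (k j)) (\<epsilon> (k j)).
        \<delta> / 2 \<le> local_mass \<kappa> (reconstruction (h (k j)) (\<tau> (k j)) \<mu>) r (w j)" for j
    proof (rule ccontr)
      assume "\<not> ?thesis"
      then have "max_local_mass \<kappa> H (h (k j)) (\<tau> (k j)) (\<epsilon> (k j)) r (w j) \<le> \<delta> / 2"
        unfolding max_local_mass_def using minimizers[of "k j"] by (intro cSUP_least) (auto simp: not_le less_imp_le)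
      then show False using w(1)[of j] \<delta> by (simp add: threshold_set_def)
    qed
    then obtain \<mu> where \<mu>: "\<And>j. \<mu> j \<in> almost_minimizers H (h (k j)) (\<tau> (k j)) (\<epsilon> (k j))"
        "\<And>j. \<delta> / 2 \<le> local_mass \<kappa> (reconstruction (h (k j)) (\<tau> (k j)) (\<mu> j)) r (w j)"
      by metis
    have lim: "(\<lambda>j. c (k j) + \<epsilon> (k j)) \<longlonglongrightarrow> c0"
      using tendsto_add[OF LIMSEQ_subseq_LIMSEQ[OF c_lim k] LIMSEQ_subseq_LIMSEQ[OF assms(12) k]] by (simp add: comp_def)
    have \<tau>k: "(\<lambda>j. \<tau> (k j)) \<longlonglongrightarrow> 0" using LIMSEQ_subseq_LIMSEQ[OF \<tau>(2) k] by (simp add: comp_def)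
    have "\<exists>y\<in>mather_set H. dist z y < r"
    proof (rule limit_of_almost_minimizers_charges_mather_set[OF H _ _ \<tau>k \<kappa> r _ _ _ lim least w(2) \<mu>(2)])
      show "\<mu> j \<in> discrete_measures (h (k j))" for j
        using \<mu>(1)[of j] by (simp add: almost_minimizers_def)
      show "discrete_action H (h (k j)) (\<tau> (k j)) (\<mu> j) \<le> ereal (c (k j) + \<epsilon> (k j))" for j
        using \<mu>(1)[of j] by (simp add: almost_minimizers_def c(1))
    qed (use h \<tau>(1) \<delta> in auto)
    then show "z \<in> nbhd (mather_set H) r"
      unfolding nbhd_def using infdist_le le_less_trans by (metis (mono_tags, lifting) empty_iff mem_Collect_eq)
  qed
  have middle: "kuratowski_liminf (?S \<delta>) \<subseteq> kuratowski_limsup (?S \<delta>)" for \<delta>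
    unfolding kuratowski_liminf_def kuratowski_limsup_def
    using strict_mono_id by (auto intro!: exI[of _ id])
  have "\<exists>\<delta>>0. \<delta> \<le> 1 \<and> mather_set H \<subseteq> kuratowski_liminf (?S \<delta>)"
  proof (cases "mather_set H = {}")
    case True
    then show ?thesis by (intro exI[of _ 1]) simp
  next
    case False
    have \<mu>0: "closed_measure \<mu>\<^sub>0" using assms(8) by (simp add: mather_measure_def)
    then have prob: "prob_space \<mu>\<^sub>0" and sets: "sets \<mu>\<^sub>0 = sets borel" by (simp_all add: closed_measure_def)
    have \<nu>: "\<nu> n \<in> discrete_measures (h n)" for n using assms(10) by (simp add: recovery_sequence_def)
    text \<open>A limit of minimizers realises the critical action, hence so does every Mather measure.\<close>
    have act: "action H \<mu>\<^sub>0 \<le> ereal c0"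
    proof -
      obtain \<mu> where "closed_measure \<mu>" "action H \<mu> \<le> ereal c0"
        by (rule closed_limit[OF H h \<tau> m(1) eq_refl[OF m(2)] c_lim]) (rule that, assumption+)
      then show ?thesis using assms(8) order_trans unfolding mather_measure_def by blast
    qed
    \<comment> \<open>Full support makes the Mather set the support of the single measure
      \<open>\<mu>\<^sub>0\<close>, so confining that one measure suffices for compactness.\<close>
    have "mather_set H \<subseteq> UNIV \<times> cball 0 R"
      using minimal_measure_support_bounded[OF c_lim sub \<mu>0 act] assms(9) by simp
    then have "compact (mather_set H)"
      using compact_Int_closed[OF compact_Times[OF compact_torus compact_cball], of "mather_set H" 0 R]
      by (simp add: Int_absorb1) (simp add: mather_set_def)
    then obtain z0 where z0: "z0 \<in> mather_set H"
        "\<And>z. z \<in> mather_set H \<Longrightarrow> local_mass \<kappa> \<mu>\<^sub>0 r z0 \<le> local_mass \<kappa> \<mu>\<^sub>0 r z"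
      using continuous_attains_inf[OF _ False continuous_on_subset[OF local_mass_continuous[OF \<kappa> r prob sets]]] by blast
    \<comment> \<open>The least local mass of the full-support measure over the compact Mather set.
      Halving it leaves room for narrow convergence, which is pointwise in \<open>z\<close>.\<close>
    define m0 where "m0 = local_mass \<kappa> \<mu>\<^sub>0 r z0"
    have "m0 > 0" unfolding m0_def
      by (rule local_mass_pos[OF \<kappa> r prob sets]) (use z0(1) assms(9) in simp)
    have eventually: "\<forall>\<^sub>F n in sequentially. z \<in> ?S (m0 / 2) n" if z: "z \<in> mather_set H" for z
    proof -
      have "bounded (range (\<lambda>w. \<kappa> (dist z w / r)))"
        unfolding bounded_iff by (rule exI[of _ 1]) (auto simp: cutoff_dist_bounds[OF \<kappa> r])
      then have "(\<lambda>n. local_mass \<kappa> (reconstruction (h n) (\<tau> n) (\<nu> n)) r z) \<longlonglongrightarrow> local_mass \<kappa> \<mu>\<^sub>0 r z"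
        using assms(10) cutoff_dist_continuous[OF \<kappa> r]
        unfolding recovery_sequence_def narrowly_converges_def local_mass_def by blast
      moreover have "m0 / 2 < local_mass \<kappa> \<mu>\<^sub>0 r z" using z0(2)[OF z] \<open>m0 > 0\<close> by (simp add: m0_def)
      ultimately have "\<forall>\<^sub>F n in sequentially. m0 / 2 < local_mass \<kappa> (reconstruction (h n) (\<tau> n) (\<nu> n)) r z"
        by (rule order_tendstoD(1))
      then show ?thesis using assms(13)
      proof eventually_elim
        case (elim n)
        have "discrete_action H (h n) (\<tau> n) (\<nu> n) \<le> discrete_min H (h n) (\<tau> n) + ereal (\<epsilon> n)"
          using elim(2) by (cases "discrete_action H (h n) (\<tau> n) (\<nu> n)") (auto simp: c(1))
        then have "\<nu> n \<in> almost_minimizers H (h n) (\<tau> n) (\<epsilon> n)"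
          using \<nu> by (simp add: almost_minimizers_def)
        then show ?case using elim(1) by (intro S_mem) auto
      qed
    qed
    then obtain N where N: "\<And>n. n \<ge> N \<Longrightarrow> z0 \<in> ?S (m0 / 2) n"
      using z0(1) unfolding eventually_sequentially by blast
    \<comment> \<open>At any single index a point of the support of some almost minimizer has
      positive local mass; the threshold \<open>q\<close> may depend on \<open>n\<close>.\<close>
    have "\<exists>q>0. ?S q n \<noteq> {}" for n
    proof -
      obtain \<mu> where \<mu>: "\<mu> \<in> almost_minimizers H (h n) (\<tau> n) (\<epsilon> n)" using minimizers by blast
      then have "\<mu> \<in> discrete_measures (h n)" by (simp add: almost_minimizers_def)
      note rp = reconstruction_prob[OF h this, of "\<tau> n"]
      have "emeasure (reconstruction (h n) (\<tau> n) \<mu>) UNIV \<noteq> 0"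
        using prob_space.emeasure_space_1[OF rp(1)] sets_eq_imp_space_eq[OF rp(2)] by simp
      then obtain z where z: "z \<in> spt (reconstruction (h n) (\<tau> n) \<mu>)"
        using spt_meets_open[OF rp(2) open_UNIV] by blast
      show ?thesis
        using local_mass_pos[OF \<kappa> r rp z] S_mem[OF \<mu> order_refl] by blast
    qed
    then obtain q where q: "\<And>n. q n > 0" "\<And>n. ?S (q n) n \<noteq> {}" by metis
    \<comment> \<open>Only the indices below \<open>N\<close> need individual thresholds, so the
      minimum is over a finite set and stays positive.\<close>
    define \<delta> where "\<delta> = Min ({1, m0 / 2} \<union> q ` {..<N})"
    have "\<delta> > 0" using q(1) \<open>m0 > 0\<close> by (simp add: \<delta>_def)
    have \<delta>_le: "\<delta> \<le> 1" "\<delta> \<le> m0 / 2" "\<And>n. n < N \<Longrightarrow> \<delta> \<le> q n"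
      unfolding \<delta>_def by (rule Min_le; simp)+
    have nonempty: "?S \<delta> n \<noteq> {}" for n
    proof (cases "n < N")
      case True
      then show ?thesis using q(2)[of n] S_mono[OF \<delta>_le(3)] by blast
    next
      case False
      then show ?thesis using N[of n] S_mono[OF \<delta>_le(2)] by (auto simp: not_less)
    qed
    have "mather_set H \<subseteq> kuratowski_liminf (?S \<delta>)"
    proof
      fix z assume z: "z \<in> mather_set H"
      \<comment> \<open>Constantly \<open>z\<close> once \<open>z\<close> belongs to the sets; the
        finitely many earlier terms are arbitrary members.\<close>
      define w where "w n = (if z \<in> ?S \<delta> n then z else (SOME y. y \<in> ?S \<delta> n))" for n
      have "w n \<in> ?S \<delta> n" for n using nonempty[of n] by (simp add: w_def some_in_eq)
      moreover have "\<forall>\<^sub>F n in sequentially. w n = z"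
        using eventually[OF z] S_mono[OF \<delta>_le(2)] by (auto simp: w_def elim!: eventually_mono)
      then have "w \<longlonglongrightarrow> z" by (rule tendsto_eventually)
      ultimately show "z \<in> kuratowski_liminf (?S \<delta>)" by (auto simp: kuratowski_liminf_def)
    qed
    then show ?thesis using \<open>\<delta> > 0\<close> \<delta>_le(1) by blast
  qed
  then show "\<exists>\<delta>>0. \<delta> \<le> 1 \<and> mather_set H \<subseteq> kuratowski_liminf (?S \<delta>) \<and>
      kuratowski_liminf (?S \<delta>) \<subseteq> kuratowski_limsup (?S \<delta>) \<and> kuratowski_limsup (?S \<delta>) \<subseteq> nbhd (mather_set H) r"
    using upper middle by blast
qed

end
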